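(* Let $\mathcal{C}$ be a bicomplete closed symmetric monoidal category with monoidal product $\otimes$, internal hom $\mathrm{Hom}$ and unit $S$. Then the arrow category $\mathrm{Arr}\,\mathcal{C}$ has the following two closed symmetric monoidal structures. Let $f\colon X_0\to X_1$ and $g\colon Y_0\to Y_1$ denote objects of $\mathrm{Arr}\,\mathcal{C}$. (1) (Tensor product monoidal structure.) The monoidal product of $f$ and $g$ is $f\otimes g\colon X_0\otimes Y_0\to X_1\otimes Y_1$; the unit is $L_0S=(1_S\colon S\to S)$; the closed structure $\mathrm{Hom}_{\otimes}(f,g)$ is the projection map $$\mathrm{Hom}(X_0,Y_0)\times_{\mathrm{Hom}(X_0,Y_1)}\mathrm{Hom}(X_1,Y_1)\to \mathrm{Hom}(X_1,Y_1).$$ (2) (Pushout product monoidal structure.) The monoidal product $f\mathbin{\square} g$ of $f$ and $g$ is the pushout product $$(X_0\otimes Y_1)\amalg_{(X_0\otimes Y_0)}(X_1\otimes Y_0)\to X_1\otimes Y_1;$$ the unit is $L_1S=(0\to S)$; the closed structure $\mathrm{Hom}_{\square}(f,g)$ is the natural map $$\mathrm{Hom}(X_1,Y_0)\to \mathrm{Hom}(X_0,Y_0)\times_{\mathrm{Hom}(X_0,Y_1)}\mathrm{Hom}(X_1,Y_1).$$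
   Context: $\mathrm{Arr}\,\mathcal{C}$ is the category whose objects are the morphisms of $\mathcal{C}$ and whose morphisms $f\to g$ are commutative squares; equivalently, the category of functors from $\{0\to 1\}$ to $\mathcal{C}$. The symbol $0$ denotes the initial object of $\mathcal{C}$. $L_0X$ is the identity map $1_X$ and $L_1X$ is the map $0\to X$. *)

theory Defs
  imports Main "HOL-Library.Equipollence"
begin

section \<open>Categories\<close>

text \<open>The fields are only meaningful on the carriers; \<open>g \<cdot> f\<close> is \<open>g\<close> after \<open>f\<close>.\<close>

record ('o, 'm) category =
  Obj :: "'o set"
  Mor :: "'m set"
  Dom :: "'m \<Rightarrow> 'o"
  Cod :: "'m \<Rightarrow> 'o"
  Ident :: "'o \<Rightarrow> 'm"
  Comp :: "'m \<Rightarrow> 'm \<Rightarrow> 'm"  (infixr "\<cdot>\<index>" 75)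

definition hom :: "('o, 'm) category \<Rightarrow> 'o \<Rightarrow> 'o \<Rightarrow> 'm set" where
  "hom C X Y = {f \<in> Mor C. Dom C f = X \<and> Cod C f = Y}"

locale category =
  fixes C :: "('o, 'm) category"
  assumes Dom_in_Obj: "f \<in> Mor C \<Longrightarrow> Dom C f \<in> Obj C"
    and Cod_in_Obj: "f \<in> Mor C \<Longrightarrow> Cod C f \<in> Obj C"
    and Ident_in_hom: "X \<in> Obj C \<Longrightarrow> Ident C X \<in> hom C X X"
    and Comp_in_hom: "\<lbrakk>f \<in> hom C X Y; g \<in> hom C Y Z\<rbrakk> \<Longrightarrow> g \<cdot>\<^bsub>C\<^esub> f \<in> hom C X Z"
    and Comp_Ident: "f \<in> hom C X Y \<Longrightarrow> f \<cdot>\<^bsub>C\<^esub> Ident C X = f"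
    and Ident_Comp: "f \<in> hom C X Y \<Longrightarrow> Ident C Y \<cdot>\<^bsub>C\<^esub> f = f"
    and Comp_assoc: "\<lbrakk>f \<in> hom C W X; g \<in> hom C X Y; h \<in> hom C Y Z\<rbrakk>
      \<Longrightarrow> (h \<cdot>\<^bsub>C\<^esub> g) \<cdot>\<^bsub>C\<^esub> f = h \<cdot>\<^bsub>C\<^esub> (g \<cdot>\<^bsub>C\<^esub> f)"

definition is_iso :: "('o, 'm) category \<Rightarrow> 'm \<Rightarrow> bool" where
  "is_iso C f \<longleftrightarrow> f \<in> Mor C \<and> (\<exists>g \<in> hom C (Cod C f) (Dom C f).
     g \<cdot>\<^bsub>C\<^esub> f = Ident C (Dom C f) \<and> f \<cdot>\<^bsub>C\<^esub> g = Ident C (Cod C f))"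

definition is_functor ::
  "('o, 'm) category \<Rightarrow> ('p, 'n) category \<Rightarrow> ('o \<Rightarrow> 'p) \<Rightarrow> ('m \<Rightarrow> 'n) \<Rightarrow> bool" where
  "is_functor A B Fo Fm \<longleftrightarrow>
     (\<forall>X \<in> Obj A. Fo X \<in> Obj B) \<and>
     (\<forall>X Y. \<forall>f \<in> hom A X Y. Fm f \<in> hom B (Fo X) (Fo Y)) \<and>
     (\<forall>X \<in> Obj A. Fm (Ident A X) = Ident B (Fo X)) \<and>
     (\<forall>X Y Z. \<forall>f \<in> hom A X Y. \<forall>g \<in> hom A Y Z. Fm (g \<cdot>\<^bsub>A\<^esub> f) = Fm g \<cdot>\<^bsub>B\<^esub> Fm f)"

definition prod_category ::
  "('o, 'm) category \<Rightarrow> ('p, 'n) category \<Rightarrow> ('o \<times> 'p, 'm \<times> 'n) category" where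
  "prod_category A B =
     \<lparr> Obj = Obj A \<times> Obj B,
       Mor = Mor A \<times> Mor B,
       Dom = (\<lambda>(f, g). (Dom A f, Dom B g)),
       Cod = (\<lambda>(f, g). (Cod A f, Cod B g)),
       Ident = (\<lambda>(X, Y). (Ident A X, Ident B Y)),
       Comp = (\<lambda>(f', g') (f, g). (f' \<cdot>\<^bsub>A\<^esub> f, g' \<cdot>\<^bsub>B\<^esub> g)) \<rparr>"


section \<open>Limits and colimits\<close>

definition is_cone ::
  "('j, 'k) category \<Rightarrow> ('o, 'm) category \<Rightarrow> ('j \<Rightarrow> 'o) \<Rightarrow> ('k \<Rightarrow> 'm) \<Rightarrow> 'o \<Rightarrow> ('j \<Rightarrow> 'm) \<Rightarrow> bool"
where
  "is_cone J C Fo Fm X p \<longleftrightarrow> X \<in> Obj C \<and>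
     (\<forall>j \<in> Obj J. p j \<in> hom C X (Fo j)) \<and>
     (\<forall>u \<in> Mor J. Fm u \<cdot>\<^bsub>C\<^esub> p (Dom J u) = p (Cod J u))"

definition is_limit ::
  "('j, 'k) category \<Rightarrow> ('o, 'm) category \<Rightarrow> ('j \<Rightarrow> 'o) \<Rightarrow> ('k \<Rightarrow> 'm) \<Rightarrow> 'o \<Rightarrow> ('j \<Rightarrow> 'm) \<Rightarrow> bool"
where
  "is_limit J C Fo Fm L p \<longleftrightarrow> is_cone J C Fo Fm L p \<and>
     (\<forall>X q. is_cone J C Fo Fm X q \<longrightarrow>
        (\<exists>!h. h \<in> hom C X L \<and> (\<forall>j \<in> Obj J. p j \<cdot>\<^bsub>C\<^esub> h = q j)))"

definition is_cocone ::
  "('j, 'k) category \<Rightarrow> ('o, 'm) category \<Rightarrow> ('j \<Rightarrow> 'o) \<Rightarrow> ('k \<Rightarrow> 'm) \<Rightarrow> 'o \<Rightarrow> ('j \<Rightarrow> 'm) \<Rightarrow> bool"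
where
  "is_cocone J C Fo Fm X p \<longleftrightarrow> X \<in> Obj C \<and>
     (\<forall>j \<in> Obj J. p j \<in> hom C (Fo j) X) \<and>
     (\<forall>u \<in> Mor J. p (Cod J u) \<cdot>\<^bsub>C\<^esub> Fm u = p (Dom J u))"

definition is_colimit ::
  "('j, 'k) category \<Rightarrow> ('o, 'm) category \<Rightarrow> ('j \<Rightarrow> 'o) \<Rightarrow> ('k \<Rightarrow> 'm) \<Rightarrow> 'o \<Rightarrow> ('j \<Rightarrow> 'm) \<Rightarrow> bool"
where
  "is_colimit J C Fo Fm L p \<longleftrightarrow> is_cocone J C Fo Fm L p \<and>
     (\<forall>X q. is_cocone J C Fo Fm X q \<longrightarrow>
        (\<exists>!h. h \<in> hom C L X \<and> (\<forall>j \<in> Obj J. h \<cdot>\<^bsub>C\<^esub> p j = q j)))"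

text \<open>
  Size is measured against a type \<open>'u\<close>: a category is small if it has fewer than \<open>|'u|\<close>
  morphisms (hence also fewer than \<open>|'u|\<close> objects). If \<open>|'u|\<close> is an inaccessible cardinal, these
  are, up to isomorphism, the small categories of the corresponding Grothendieck universe; if
  \<open>'u\<close> is countably infinite, they are the finite categories. A category under consideration for
  completeness may itself have objects and morphisms of any types.
\<close>

definition small_category :: "('u, 'u) category \<Rightarrow> bool" where
  "small_category J \<longleftrightarrow> category J \<and> Mor J \<prec> (UNIV :: 'u set)"

definition small_complete :: "'u itself \<Rightarrow> ('o, 'm) category \<Rightarrow> bool" where
  "small_complete U C \<longleftrightarrow> (\<forall>(J :: ('u, 'u) category) Fo Fm.
     small_category J \<longrightarrow> is_functor J C Fo Fm \<longrightarrow> (\<exists>L p. is_limit J C Fo Fm L p))"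

definition small_cocomplete :: "'u itself \<Rightarrow> ('o, 'm) category \<Rightarrow> bool" where
  "small_cocomplete U C \<longleftrightarrow> (\<forall>(J :: ('u, 'u) category) Fo Fm.
     small_category J \<longrightarrow> is_functor J C Fo Fm \<longrightarrow> (\<exists>L p. is_colimit J C Fo Fm L p))"

definition bicomplete :: "'u itself \<Rightarrow> ('o, 'm) category \<Rightarrow> bool" where
  "bicomplete U C \<longleftrightarrow> category C \<and> small_complete U C \<and> small_cocomplete U C"

definition is_initial :: "('o, 'm) category \<Rightarrow> 'o \<Rightarrow> bool" where
  "is_initial C Z \<longleftrightarrow> Z \<in> Obj C \<and> (\<forall>X \<in> Obj C. \<exists>!h. h \<in> hom C Z X)"

definition initial_obj :: "('o, 'm) category \<Rightarrow> 'o" where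
  "initial_obj C = (SOME Z. is_initial C Z)"

definition from_initial :: "('o, 'm) category \<Rightarrow> 'o \<Rightarrow> 'm" where
  "from_initial C X = (THE h. h \<in> hom C (initial_obj C) X)"

text \<open>A pullback of \<open>f : A \<rightarrow> D\<close> and \<open>g : B \<rightarrow> D\<close> is a triple \<open>(P, p : P \<rightarrow> A, q : P \<rightarrow> B)\<close>; a pushout
  of \<open>f : D \<rightarrow> A\<close> and \<open>g : D \<rightarrow> B\<close> is a triple \<open>(P, i : A \<rightarrow> P, j : B \<rightarrow> P)\<close>.\<close>

fun is_pullback :: "('o, 'm) category \<Rightarrow> 'm \<Rightarrow> 'm \<Rightarrow> 'o \<times> 'm \<times> 'm \<Rightarrow> bool" where
  "is_pullback C f g (P, p, q) \<longleftrightarrow>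
     f \<in> Mor C \<and> g \<in> Mor C \<and> Cod C f = Cod C g \<and>
     p \<in> hom C P (Dom C f) \<and> q \<in> hom C P (Dom C g) \<and> f \<cdot>\<^bsub>C\<^esub> p = g \<cdot>\<^bsub>C\<^esub> q \<and>
     (\<forall>X. \<forall>u \<in> hom C X (Dom C f). \<forall>v \<in> hom C X (Dom C g). f \<cdot>\<^bsub>C\<^esub> u = g \<cdot>\<^bsub>C\<^esub> v \<longrightarrow>
        (\<exists>!h. h \<in> hom C X P \<and> p \<cdot>\<^bsub>C\<^esub> h = u \<and> q \<cdot>\<^bsub>C\<^esub> h = v))"

fun is_pushout :: "('o, 'm) category \<Rightarrow> 'm \<Rightarrow> 'm \<Rightarrow> 'o \<times> 'm \<times> 'm \<Rightarrow> bool" where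
  "is_pushout C f g (P, i, j) \<longleftrightarrow>
     f \<in> Mor C \<and> g \<in> Mor C \<and> Dom C f = Dom C g \<and>
     i \<in> hom C (Cod C f) P \<and> j \<in> hom C (Cod C g) P \<and> i \<cdot>\<^bsub>C\<^esub> f = j \<cdot>\<^bsub>C\<^esub> g \<and>
     (\<forall>X. \<forall>u \<in> hom C (Cod C f) X. \<forall>v \<in> hom C (Cod C g) X. u \<cdot>\<^bsub>C\<^esub> f = v \<cdot>\<^bsub>C\<^esub> g \<longrightarrow>
        (\<exists>!h. h \<in> hom C P X \<and> h \<cdot>\<^bsub>C\<^esub> i = u \<and> h \<cdot>\<^bsub>C\<^esub> j = v))"

definition pullback :: "('o, 'm) category \<Rightarrow> 'm \<Rightarrow> 'm \<Rightarrow> 'o \<times> 'm \<times> 'm" where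
  "pullback C f g = (SOME t. is_pullback C f g t)"

definition pushout :: "('o, 'm) category \<Rightarrow> 'm \<Rightarrow> 'm \<Rightarrow> 'o \<times> 'm \<times> 'm" where
  "pushout C f g = (SOME t. is_pushout C f g t)"

fun into_pullback :: "('o, 'm) category \<Rightarrow> 'o \<times> 'm \<times> 'm \<Rightarrow> 'm \<Rightarrow> 'm \<Rightarrow> 'm" where
  "into_pullback C (P, p, q) u v =
     (THE h. h \<in> hom C (Dom C u) P \<and> p \<cdot>\<^bsub>C\<^esub> h = u \<and> q \<cdot>\<^bsub>C\<^esub> h = v)"

fun from_pushout :: "('o, 'm) category \<Rightarrow> 'o \<times> 'm \<times> 'm \<Rightarrow> 'm \<Rightarrow> 'm \<Rightarrow> 'm" where
  "from_pushout C (P, i, j) u v =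
     (THE h. h \<in> hom C P (Cod C u) \<and> h \<cdot>\<^bsub>C\<^esub> i = u \<and> h \<cdot>\<^bsub>C\<^esub> j = v)"


section \<open>Closed symmetric monoidal structures\<close>

record ('o, 'm) csm_structure =
  tensor_obj :: "'o \<Rightarrow> 'o \<Rightarrow> 'o"  (infixr "\<otimes>\<^sub>o\<index>" 80)
  tensor_mor :: "'m \<Rightarrow> 'm \<Rightarrow> 'm"  (infixr "\<otimes>\<index>" 80)
  unit_obj :: "'o"
  assoc :: "'o \<Rightarrow> 'o \<Rightarrow> 'o \<Rightarrow> 'm"
  lunit :: "'o \<Rightarrow> 'm"
  runit :: "'o \<Rightarrow> 'm"
  symm :: "'o \<Rightarrow> 'o \<Rightarrow> 'm"
  ihom :: "'o \<Rightarrow> 'o \<Rightarrow> 'o"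
  ev :: "'o \<Rightarrow> 'o \<Rightarrow> 'm"

locale monoidal = category C
  for C :: "('o, 'm) category" +
  fixes M :: "('o, 'm) csm_structure"
  assumes tensor_functor:
      "is_functor (prod_category C C) C (\<lambda>(X, Y). X \<otimes>\<^sub>o\<^bsub>M\<^esub> Y) (\<lambda>(f, g). f \<otimes>\<^bsub>M\<^esub> g)"
    and unit_in_Obj: "unit_obj M \<in> Obj C"
    and assoc_in_hom: "\<lbrakk>X \<in> Obj C; Y \<in> Obj C; Z \<in> Obj C\<rbrakk> \<Longrightarrow>
      assoc M X Y Z \<in> hom C ((X \<otimes>\<^sub>o\<^bsub>M\<^esub> Y) \<otimes>\<^sub>o\<^bsub>M\<^esub> Z) (X \<otimes>\<^sub>o\<^bsub>M\<^esub> (Y \<otimes>\<^sub>o\<^bsub>M\<^esub> Z))"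
    and assoc_iso: "\<lbrakk>X \<in> Obj C; Y \<in> Obj C; Z \<in> Obj C\<rbrakk> \<Longrightarrow> is_iso C (assoc M X Y Z)"
    and assoc_natural:
      "\<lbrakk>f \<in> hom C X X'; g \<in> hom C Y Y'; h \<in> hom C Z Z'\<rbrakk> \<Longrightarrow>
        assoc M X' Y' Z' \<cdot>\<^bsub>C\<^esub> ((f \<otimes>\<^bsub>M\<^esub> g) \<otimes>\<^bsub>M\<^esub> h) = (f \<otimes>\<^bsub>M\<^esub> (g \<otimes>\<^bsub>M\<^esub> h)) \<cdot>\<^bsub>C\<^esub> assoc M X Y Z"
    and lunit_in_hom: "X \<in> Obj C \<Longrightarrow> lunit M X \<in> hom C (unit_obj M \<otimes>\<^sub>o\<^bsub>M\<^esub> X) X"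
    and lunit_iso: "X \<in> Obj C \<Longrightarrow> is_iso C (lunit M X)"
    and lunit_natural: "f \<in> hom C X Y \<Longrightarrow>
        lunit M Y \<cdot>\<^bsub>C\<^esub> (Ident C (unit_obj M) \<otimes>\<^bsub>M\<^esub> f) = f \<cdot>\<^bsub>C\<^esub> lunit M X"
    and runit_in_hom: "X \<in> Obj C \<Longrightarrow> runit M X \<in> hom C (X \<otimes>\<^sub>o\<^bsub>M\<^esub> unit_obj M) X"
    and runit_iso: "X \<in> Obj C \<Longrightarrow> is_iso C (runit M X)"
    and runit_natural: "f \<in> hom C X Y \<Longrightarrow>
        runit M Y \<cdot>\<^bsub>C\<^esub> (f \<otimes>\<^bsub>M\<^esub> Ident C (unit_obj M)) = f \<cdot>\<^bsub>C\<^esub> runit M X"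
    and pentagon: "\<lbrakk>W \<in> Obj C; X \<in> Obj C; Y \<in> Obj C; Z \<in> Obj C\<rbrakk> \<Longrightarrow>
        assoc M W X (Y \<otimes>\<^sub>o\<^bsub>M\<^esub> Z) \<cdot>\<^bsub>C\<^esub> assoc M (W \<otimes>\<^sub>o\<^bsub>M\<^esub> X) Y Z =
        (Ident C W \<otimes>\<^bsub>M\<^esub> assoc M X Y Z) \<cdot>\<^bsub>C\<^esub> assoc M W (X \<otimes>\<^sub>o\<^bsub>M\<^esub> Y) Z
          \<cdot>\<^bsub>C\<^esub> (assoc M W X Y \<otimes>\<^bsub>M\<^esub> Ident C Z)"
    and triangle: "\<lbrakk>X \<in> Obj C; Y \<in> Obj C\<rbrakk> \<Longrightarrow>
        (Ident C X \<otimes>\<^bsub>M\<^esub> lunit M Y) \<cdot>\<^bsub>C\<^esub> assoc M X (unit_obj M) Y = runit M X \<otimes>\<^bsub>M\<^esub> Ident C Y"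

locale symmetric_monoidal = monoidal +
  assumes symm_in_hom: "\<lbrakk>X \<in> Obj C; Y \<in> Obj C\<rbrakk> \<Longrightarrow> symm M X Y \<in> hom C (X \<otimes>\<^sub>o\<^bsub>M\<^esub> Y) (Y \<otimes>\<^sub>o\<^bsub>M\<^esub> X)"
    and symm_natural: "\<lbrakk>f \<in> hom C X X'; g \<in> hom C Y Y'\<rbrakk> \<Longrightarrow>
        symm M X' Y' \<cdot>\<^bsub>C\<^esub> (f \<otimes>\<^bsub>M\<^esub> g) = (g \<otimes>\<^bsub>M\<^esub> f) \<cdot>\<^bsub>C\<^esub> symm M X Y"
    and symm_symm: "\<lbrakk>X \<in> Obj C; Y \<in> Obj C\<rbrakk> \<Longrightarrow>
        symm M Y X \<cdot>\<^bsub>C\<^esub> symm M X Y = Ident C (X \<otimes>\<^sub>o\<^bsub>M\<^esub> Y)"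
    and hexagon: "\<lbrakk>X \<in> Obj C; Y \<in> Obj C; Z \<in> Obj C\<rbrakk> \<Longrightarrow>
        assoc M Y Z X \<cdot>\<^bsub>C\<^esub> symm M X (Y \<otimes>\<^sub>o\<^bsub>M\<^esub> Z) \<cdot>\<^bsub>C\<^esub> assoc M X Y Z =
        (Ident C Y \<otimes>\<^bsub>M\<^esub> symm M X Z) \<cdot>\<^bsub>C\<^esub> assoc M Y X Z \<cdot>\<^bsub>C\<^esub> (symm M X Y \<otimes>\<^bsub>M\<^esub> Ident C Z)"

text \<open>
  Closedness says that \<open>ev : ihom Y Z \<otimes> Y \<rightarrow> Z\<close> is a universal arrow from \<open>- \<otimes> Y\<close> to \<open>Z\<close>, so
  \<open>ihom Y -\<close> is right adjoint to \<open>- \<otimes> Y\<close>. The action of \<open>ihom\<close> on morphisms is determined by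
  \<open>ev\<close> and is given by \<open>ihom_mor\<close> below.
\<close>

locale closed_symmetric_monoidal = symmetric_monoidal +
  assumes ihom_in_Obj: "\<lbrakk>Y \<in> Obj C; Z \<in> Obj C\<rbrakk> \<Longrightarrow> ihom M Y Z \<in> Obj C"
    and ev_in_hom: "\<lbrakk>Y \<in> Obj C; Z \<in> Obj C\<rbrakk> \<Longrightarrow> ev M Y Z \<in> hom C (ihom M Y Z \<otimes>\<^sub>o\<^bsub>M\<^esub> Y) Z"
    and ev_universal: "\<lbrakk>X \<in> Obj C; Y \<in> Obj C; Z \<in> Obj C; f \<in> hom C (X \<otimes>\<^sub>o\<^bsub>M\<^esub> Y) Z\<rbrakk> \<Longrightarrow>
        \<exists>!g. g \<in> hom C X (ihom M Y Z) \<and> ev M Y Z \<cdot>\<^bsub>C\<^esub> (g \<otimes>\<^bsub>M\<^esub> Ident C Y) = f"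

definition curry_mor ::
  "('o, 'm) category \<Rightarrow> ('o, 'm) csm_structure \<Rightarrow> 'o \<Rightarrow> 'o \<Rightarrow> 'o \<Rightarrow> 'm \<Rightarrow> 'm" where
  "curry_mor C M X Y Z f =
     (THE g. g \<in> hom C X (ihom M Y Z) \<and> ev M Y Z \<cdot>\<^bsub>C\<^esub> (g \<otimes>\<^bsub>M\<^esub> Ident C Y) = f)"

text \<open>For \<open>u : X' \<rightarrow> X\<close> and \<open>v : Y \<rightarrow> Y'\<close>, the induced map \<open>ihom X Y \<rightarrow> ihom X' Y'\<close>.\<close>

definition ihom_mor ::
  "('o, 'm) category \<Rightarrow> ('o, 'm) csm_structure \<Rightarrow> 'm \<Rightarrow> 'm \<Rightarrow> 'm" where
  "ihom_mor C M u v =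
     (let X' = Dom C u; X = Cod C u; Y = Dom C v; Y' = Cod C v
      in curry_mor C M (ihom M X Y) X' Y'
           (v \<cdot>\<^bsub>C\<^esub> ev M X Y \<cdot>\<^bsub>C\<^esub> (Ident C (ihom M X Y) \<otimes>\<^bsub>M\<^esub> u)))"


section \<open>The arrow category\<close>

text \<open>\<open>Square f g a b\<close> is the square from \<open>f : X\<^sub>0 \<rightarrow> X\<^sub>1\<close> to \<open>g : Y\<^sub>0 \<rightarrow> Y\<^sub>1\<close> with components
  \<open>a : X\<^sub>0 \<rightarrow> Y\<^sub>0\<close> and \<open>b : X\<^sub>1 \<rightarrow> Y\<^sub>1\<close>.\<close>

datatype 'm square = Square (sq_dom: 'm) (sq_cod: 'm) (comp0: 'm) (comp1: 'm)

definition Arr :: "('o, 'm) category \<Rightarrow> ('m, 'm square) category" where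
  "Arr C =
     \<lparr> Obj = Mor C,
       Mor = {Square f g a b | f g a b.
                f \<in> Mor C \<and> g \<in> Mor C \<and>
                a \<in> hom C (Dom C f) (Dom C g) \<and> b \<in> hom C (Cod C f) (Cod C g) \<and>
                g \<cdot>\<^bsub>C\<^esub> a = b \<cdot>\<^bsub>C\<^esub> f},
       Dom = sq_dom,
       Cod = sq_cod,
       Ident = (\<lambda>f. Square f f (Ident C (Dom C f)) (Ident C (Cod C f))),
       Comp = (\<lambda>t s. Square (sq_dom s) (sq_cod t)
                 (comp0 t \<cdot>\<^bsub>C\<^esub> comp0 s) (comp1 t \<cdot>\<^bsub>C\<^esub> comp1 s)) \<rparr>"

definition L0 :: "('o, 'm) category \<Rightarrow> 'o \<Rightarrow> 'm" where
  "L0 C X = Ident C X"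

definition L1 :: "('o, 'm) category \<Rightarrow> 'o \<Rightarrow> 'm" where
  "L1 C X = from_initial C X"

definition tensor_square ::
  "('o, 'm) csm_structure \<Rightarrow> 'm square \<Rightarrow> 'm square \<Rightarrow> 'm square" where
  "tensor_square M s t =
     Square (sq_dom s \<otimes>\<^bsub>M\<^esub> sq_dom t) (sq_cod s \<otimes>\<^bsub>M\<^esub> sq_cod t)
       (comp0 s \<otimes>\<^bsub>M\<^esub> comp0 t) (comp1 s \<otimes>\<^bsub>M\<^esub> comp1 t)"

text \<open>\<open>Hom(X\<^sub>0,Y\<^sub>0) \<times>\<^bsub>Hom(X\<^sub>0,Y\<^sub>1)\<^esub> Hom(X\<^sub>1,Y\<^sub>1)\<close> with its two projections, for
  \<open>f : X\<^sub>0 \<rightarrow> X\<^sub>1\<close> and \<open>g : Y\<^sub>0 \<rightarrow> Y\<^sub>1\<close>.\<close>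

definition hom_pullback ::
  "('o, 'm) category \<Rightarrow> ('o, 'm) csm_structure \<Rightarrow> 'm \<Rightarrow> 'm \<Rightarrow> 'o \<times> 'm \<times> 'm" where
  "hom_pullback C M f g =
     pullback C (ihom_mor C M (Ident C (Dom C f)) g) (ihom_mor C M f (Ident C (Cod C g)))"

definition hom_tensor ::
  "('o, 'm) category \<Rightarrow> ('o, 'm) csm_structure \<Rightarrow> 'm \<Rightarrow> 'm \<Rightarrow> 'm" where
  "hom_tensor C M f g = (case hom_pullback C M f g of (P, p, q) \<Rightarrow> q)"

definition hom_box ::
  "('o, 'm) category \<Rightarrow> ('o, 'm) csm_structure \<Rightarrow> 'm \<Rightarrow> 'm \<Rightarrow> 'm" where
  "hom_box C M f g =
     into_pullback C (hom_pullback C M f g)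
       (ihom_mor C M f (Ident C (Dom C g))) (ihom_mor C M (Ident C (Cod C f)) g)"

text \<open>\<open>(X\<^sub>0 \<otimes> Y\<^sub>1) \<amalg>\<^bsub>X\<^sub>0 \<otimes> Y\<^sub>0\<^esub> (X\<^sub>1 \<otimes> Y\<^sub>0)\<close> with its two coprojections.\<close>

definition box_pushout ::
  "('o, 'm) category \<Rightarrow> ('o, 'm) csm_structure \<Rightarrow> 'm \<Rightarrow> 'm \<Rightarrow> 'o \<times> 'm \<times> 'm" where
  "box_pushout C M f g =
     pushout C (Ident C (Dom C f) \<otimes>\<^bsub>M\<^esub> g) (f \<otimes>\<^bsub>M\<^esub> Ident C (Dom C g))"

definition box ::
  "('o, 'm) category \<Rightarrow> ('o, 'm) csm_structure \<Rightarrow> 'm \<Rightarrow> 'm \<Rightarrow> 'm" where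
  "box C M f g =
     from_pushout C (box_pushout C M f g)
       (f \<otimes>\<^bsub>M\<^esub> Ident C (Cod C g)) (Ident C (Cod C f) \<otimes>\<^bsub>M\<^esub> g)"

definition box_square ::
  "('o, 'm) category \<Rightarrow> ('o, 'm) csm_structure \<Rightarrow> 'm square \<Rightarrow> 'm square \<Rightarrow> 'm square" where
  "box_square C M s t =
     (case box_pushout C M (sq_cod s) (sq_cod t) of (P, i, j) \<Rightarrow>
        Square (box C M (sq_dom s) (sq_dom t)) (box C M (sq_cod s) (sq_cod t))
          (from_pushout C (box_pushout C M (sq_dom s) (sq_dom t))
             (i \<cdot>\<^bsub>C\<^esub> (comp0 s \<otimes>\<^bsub>M\<^esub> comp1 t)) (j \<cdot>\<^bsub>C\<^esub> (comp1 s \<otimes>\<^bsub>M\<^esub> comp0 t)))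
          (comp1 s \<otimes>\<^bsub>M\<^esub> comp1 t))"

end

theory Submission imports Defs begin

text \<open>
  An object of the arrow category is a functor from the poset \<open>{0 < 1}\<close> to \<open>C\<close>. Both structures
  come from this description: the first is the pointwise tensor product, the second is Day
  convolution for the minimum on \<open>{0 < 1}\<close>. Truth values stand for the two elements of the
  poset, so that the minimum is conjunction.

  For the pointwise product every axiom holds because it holds in \<open>C\<close> at each vertex. Only the
  internal hom needs an idea. For \<open>f : X\<^sub>0 \<rightarrow> X\<^sub>1\<close> and \<open>g : Y\<^sub>0 \<rightarrow> Y\<^sub>1\<close>, the pullback
  \<open>Hom(X\<^sub>0,Y\<^sub>0) \<times>\<^bsub>Hom(X\<^sub>0,Y\<^sub>1)\<^esub> Hom(X\<^sub>1,Y\<^sub>1)\<close> represents squares: by currying, maps from \<open>W\<close> into it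
  correspond to squares from \<open>W \<otimes> f\<close> to \<open>g\<close> (\<open>ex1_into_square_obj\<close>). A square from \<open>k \<otimes> f\<close> to
  \<open>g\<close> then splits into a map \<open>Cod k \<rightarrow> Hom(X\<^sub>1,Y\<^sub>1)\<close> and a map from \<open>Dom k\<close> to the pullback with
  the same second component.

  For the pushout product there are maps \<open>corner f g a b\<close> from \<open>f(a) \<otimes> g(b)\<close> to
  \<open>(f \<box> g)(a \<and> b)\<close> for all truth values \<open>a\<close>, \<open>b\<close>, and \<open>f \<box> g\<close> is the universal arrow receiving
  such a natural family (\<open>box_lift\<close>). Since \<open>C\<close> is closed, tensoring with an object preserves
  pushouts, initial objects and jointly epimorphic families. Hence threefold pushout products
  have the corresponding property for three indices (\<open>box3_lift\<close>), and maps out of threefold and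
  fourfold products are determined by their restrictions to the corners (\<open>corner3_joint_epi\<close>,
  \<open>corner4_joint_epi\<close>). Each structure map is the map that restricts to the structure
  map of \<open>C\<close> on all corners, and its naturality and coherence follow on each corner from those of
  \<open>C\<close>, by one computation that is uniform in the truth values. The unit
  \<open>0 \<rightarrow> S\<close> is the functor represented by the neutral element \<open>1\<close> of the minimum; the corners
  that involve its vertex \<open>0\<close> have an initial source and impose no condition.

  Finally, a square from \<open>k \<box> f\<close> to \<open>g\<close> amounts to maps \<open>Dom k \<otimes> X\<^sub>1 \<rightarrow> Y\<^sub>0\<close>, \<open>Cod k \<otimes> X\<^sub>0 \<rightarrow> Y\<^sub>0\<close> and
  \<open>Cod k \<otimes> X\<^sub>1 \<rightarrow> Y\<^sub>1\<close>. The first is a map \<open>Dom k \<rightarrow> Hom(X\<^sub>1,Y\<^sub>0)\<close>, the other two form a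
  square from \<open>Cod k \<otimes> f\<close> to \<open>g\<close>, that is, a map from \<open>Cod k\<close> to the pullback, and the
  remaining compatibilities say that these two maps form a square to \<open>hom_box\<close>
  (\<open>box_closed\<close>).
\<close>

section \<open>Categories\<close>

context category
begin

text \<open>Composability is expressed below by equations between \<open>Dom\<close> and \<open>Cod\<close> instead of membership in
  hom sets, because the simplifier can discharge such equations, whereas the hom sets of the
  locale axioms mention objects that it would have to guess. Composites are
  normalised to be nested to the right.\<close>

lemma ident_simps [simp]:
  assumes "X \<in> Obj C"
  shows "Ident C X \<in> Mor C" "Dom C (Ident C X) = X" "Cod C (Ident C X) = X"
  using Ident_in_hom[OF assms] by (auto simp: hom_def)

lemma vertex_in_Obj [simp]:
  assumes "f \<in> Mor C"
  shows "Dom C f \<in> Obj C" "Cod C f \<in> Obj C"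
  using assms Dom_in_Obj Cod_in_Obj by auto

lemma comp_simps [simp]:
  assumes "f \<in> Mor C" "g \<in> Mor C" "Cod C f = Dom C g"
  shows "g \<cdot>\<^bsub>C\<^esub> f \<in> Mor C" "Dom C (g \<cdot>\<^bsub>C\<^esub> f) = Dom C f" "Cod C (g \<cdot>\<^bsub>C\<^esub> f) = Cod C g"
  using Comp_in_hom[of f "Dom C f" "Dom C g" g "Cod C g"] assms by (auto simp: hom_def)

lemma comp_ident [simp]:
  assumes "f \<in> Mor C" 
  shows "Dom C f = X \<Longrightarrow> f \<cdot>\<^bsub>C\<^esub> Ident C X = f" "Cod C f = X \<Longrightarrow> Ident C X \<cdot>\<^bsub>C\<^esub> f = f"
  using assms Comp_Ident[of f] Ident_Comp[of f] by (auto simp: hom_def)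

lemma comp_assoc [simp]:
  assumes "f \<in> Mor C" "g \<in> Mor C" "h \<in> Mor C" "Cod C f = Dom C g" "Cod C g = Dom C h"
  shows "(h \<cdot>\<^bsub>C\<^esub> g) \<cdot>\<^bsub>C\<^esub> f = h \<cdot>\<^bsub>C\<^esub> g \<cdot>\<^bsub>C\<^esub> f"
  using Comp_assoc[of f "Dom C f" "Dom C g" g "Dom C h" h "Cod C h"] assms
  by (auto simp: hom_def)

text \<open>With composites nested to the right, an equation between two composites only matches the
  end of a longer composite. This form matches in the middle.\<close>

lemma comp_reassoc:
  assumes "g \<cdot>\<^bsub>C\<^esub> f = g' \<cdot>\<^bsub>C\<^esub> f'"
    and "f \<in> Mor C" "g \<in> Mor C" "Cod C f = Dom C g"
    and "f' \<in> Mor C" "g' \<in> Mor C" "Cod C f' = Dom C g'"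
    and "z \<in> Mor C" "Cod C z = Dom C f" "Dom C f' = Dom C f"
  shows "g \<cdot>\<^bsub>C\<^esub> f \<cdot>\<^bsub>C\<^esub> z = g' \<cdot>\<^bsub>C\<^esub> f' \<cdot>\<^bsub>C\<^esub> z"
proof -
  have "(g \<cdot>\<^bsub>C\<^esub> f) \<cdot>\<^bsub>C\<^esub> z = (g' \<cdot>\<^bsub>C\<^esub> f') \<cdot>\<^bsub>C\<^esub> z" by (simp only: assms(1))
  then show ?thesis using assms(2-) by simp
qed

lemma is_isoI:
  assumes "f \<in> hom C X Y" "g \<in> hom C Y X" "g \<cdot>\<^bsub>C\<^esub> f = Ident C X" "f \<cdot>\<^bsub>C\<^esub> g = Ident C Y"
  shows "is_iso C f"
  using assms by (auto simp: is_iso_def hom_def)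

definition inverse_mor :: "'m \<Rightarrow> 'm" where
  "inverse_mor f = (SOME g. g \<in> hom C (Cod C f) (Dom C f) \<and>
     g \<cdot>\<^bsub>C\<^esub> f = Ident C (Dom C f) \<and> f \<cdot>\<^bsub>C\<^esub> g = Ident C (Cod C f))"

lemma inverse_mor [simp]:
  assumes "is_iso C f"
  shows "inverse_mor f \<in> Mor C" "Dom C (inverse_mor f) = Cod C f" "Cod C (inverse_mor f) = Dom C f"
    "inverse_mor f \<cdot>\<^bsub>C\<^esub> f = Ident C (Dom C f)" "f \<cdot>\<^bsub>C\<^esub> inverse_mor f = Ident C (Cod C f)"
proof -
  have "\<exists>g. g \<in> hom C (Cod C f) (Dom C f) \<and>
     g \<cdot>\<^bsub>C\<^esub> f = Ident C (Dom C f) \<and> f \<cdot>\<^bsub>C\<^esub> g = Ident C (Cod C f)"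
    using assms by (auto simp: is_iso_def)
  from someI_ex[OF this, folded inverse_mor_def]
  show "inverse_mor f \<in> Mor C" "Dom C (inverse_mor f) = Cod C f" "Cod C (inverse_mor f) = Dom C f"
    "inverse_mor f \<cdot>\<^bsub>C\<^esub> f = Ident C (Dom C f)" "f \<cdot>\<^bsub>C\<^esub> inverse_mor f = Ident C (Cod C f)"
    by (auto simp: hom_def)
qed

lemma inverse_mor_comp [simp]:
  assumes "is_iso C f" "z \<in> Mor C" "f \<in> Mor C"
  shows "Cod C z = Dom C f \<Longrightarrow> inverse_mor f \<cdot>\<^bsub>C\<^esub> f \<cdot>\<^bsub>C\<^esub> z = z"
    "Cod C z = Cod C f \<Longrightarrow> f \<cdot>\<^bsub>C\<^esub> inverse_mor f \<cdot>\<^bsub>C\<^esub> z = z"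
proof -
  show "inverse_mor f \<cdot>\<^bsub>C\<^esub> f \<cdot>\<^bsub>C\<^esub> z = z" if "Cod C z = Dom C f"
    using assms that by (subst comp_assoc[symmetric]) simp_all
  show "f \<cdot>\<^bsub>C\<^esub> inverse_mor f \<cdot>\<^bsub>C\<^esub> z = z" if "Cod C z = Cod C f"
    using assms that by (subst comp_assoc[symmetric]) simp_all
qed

lemma inverse_natural:
  assumes "is_iso C s" "is_iso C t" "t \<cdot>\<^bsub>C\<^esub> f = g \<cdot>\<^bsub>C\<^esub> s"
    "f \<in> Mor C" "g \<in> Mor C" "s \<in> Mor C" "t \<in> Mor C" "Cod C f = Dom C t" "Dom C f = Dom C s"
    "Cod C s = Dom C g" "Cod C g = Cod C t"
  shows "inverse_mor t \<cdot>\<^bsub>C\<^esub> g = f \<cdot>\<^bsub>C\<^esub> inverse_mor s"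
proof -
  have "inverse_mor t \<cdot>\<^bsub>C\<^esub> g = inverse_mor t \<cdot>\<^bsub>C\<^esub> (g \<cdot>\<^bsub>C\<^esub> s) \<cdot>\<^bsub>C\<^esub> inverse_mor s"
    using assms(1,2,4-) by simp
  also have "\<dots> = inverse_mor t \<cdot>\<^bsub>C\<^esub> (t \<cdot>\<^bsub>C\<^esub> f) \<cdot>\<^bsub>C\<^esub> inverse_mor s"
    using assms(3) by simp
  also have "\<dots> = f \<cdot>\<^bsub>C\<^esub> inverse_mor s"
    using assms(1,2,4-) by simp
  finally show ?thesis .
qed

end

lemma bifunctorI:
  assumes "\<And>X Y. X \<in> Obj A \<Longrightarrow> Y \<in> Obj B \<Longrightarrow> Fo X Y \<in> Obj D"
    and "\<And>f g. f \<in> Mor A \<Longrightarrow> g \<in> Mor B \<Longrightarrow>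
      Fm f g \<in> hom D (Fo (Dom A f) (Dom B g)) (Fo (Cod A f) (Cod B g))"
    and "\<And>X Y. X \<in> Obj A \<Longrightarrow> Y \<in> Obj B \<Longrightarrow> Fm (Ident A X) (Ident B Y) = Ident D (Fo X Y)"
    and "\<And>f g f' g'. f \<in> Mor A \<Longrightarrow> g \<in> Mor B \<Longrightarrow> f' \<in> Mor A \<Longrightarrow> g' \<in> Mor B \<Longrightarrow>
      Cod A f = Dom A f' \<Longrightarrow> Cod B g = Dom B g' \<Longrightarrow>
      Fm (f' \<cdot>\<^bsub>A\<^esub> f) (g' \<cdot>\<^bsub>B\<^esub> g) = Fm f' g' \<cdot>\<^bsub>D\<^esub> Fm f g"
  shows "is_functor (prod_category A B) D (\<lambda>(X, Y). Fo X Y) (\<lambda>(f, g). Fm f g)"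
  using assms unfolding is_functor_def prod_category_def by (auto simp: hom_def)

section \<open>Pushouts, pullbacks and jointly epimorphic families\<close>

context category
begin

text \<open>Equations between maps out of an iterated pushout product are checked on a family of maps into
  it. This cancellation property is stable under tensoring with an object and under composition
  of families, so it passes from single to iterated products.\<close>

definition joint_epi :: "'o \<Rightarrow> 'm set \<Rightarrow> bool" where
  "joint_epi A S \<longleftrightarrow> A \<in> Obj C \<and> (\<forall>m \<in> S. m \<in> Mor C \<and> Cod C m = A) \<and>
     (\<forall>W. \<forall>k \<in> hom C A W. \<forall>k' \<in> hom C A W.
        (\<forall>m \<in> S. k \<cdot>\<^bsub>C\<^esub> m = k' \<cdot>\<^bsub>C\<^esub> m) \<longrightarrow> k = k')"

lemma joint_epiD:
  assumes "joint_epi A S" "\<And>m. m \<in> S \<Longrightarrow> k \<cdot>\<^bsub>C\<^esub> m = k' \<cdot>\<^bsub>C\<^esub> m"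
    and "k \<in> Mor C" "k' \<in> Mor C" "Dom C k = A" "Dom C k' = A" "Cod C k = Cod C k'"
  shows "k = k'"
proof -
  have "k \<in> hom C A (Cod C k)" "k' \<in> hom C A (Cod C k)"
    using assms by (simp_all add: hom_def)
  then show ?thesis using assms(1,2) unfolding joint_epi_def by blast
qed

lemma joint_epiI:
  assumes "A \<in> Obj C" "\<And>m. m \<in> S \<Longrightarrow> m \<in> Mor C" "\<And>m. m \<in> S \<Longrightarrow> Cod C m = A"
    and "\<And>k k'. \<lbrakk>k \<in> Mor C; k' \<in> Mor C; Dom C k = A; Dom C k' = A; Cod C k = Cod C k';
      \<And>m. m \<in> S \<Longrightarrow> k \<cdot>\<^bsub>C\<^esub> m = k' \<cdot>\<^bsub>C\<^esub> m\<rbrakk> \<Longrightarrow> k = k'"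
  shows "joint_epi A S"
  unfolding joint_epi_def
proof (intro conjI ballI allI impI)
  fix W k k'
  assume k: "k \<in> hom C A W" "k' \<in> hom C A W" "\<forall>m \<in> S. k \<cdot>\<^bsub>C\<^esub> m = k' \<cdot>\<^bsub>C\<^esub> m"
  show "k = k'" by (rule assms(4)) (use k in \<open>simp_all add: hom_def\<close>)
qed (use assms(1-3) in auto)

lemma joint_epi_simps:
  assumes "joint_epi A S"
  shows "A \<in> Obj C" "m \<in> S \<Longrightarrow> m \<in> Mor C" "m \<in> S \<Longrightarrow> Cod C m = A"
  using assms by (auto simp: joint_epi_def)

text \<open>A family covering every member of a covering family covers the target.\<close>

lemma joint_epi_trans:
  assumes S: "joint_epi A S"
    and T: "\<And>m. m \<in> T \<Longrightarrow> m \<in> Mor C" "\<And>m. m \<in> T \<Longrightarrow> Cod C m = A"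
    and R: "\<And>m. m \<in> S \<Longrightarrow> \<exists>R. joint_epi (Dom C m) R \<and> (\<forall>r \<in> R. m \<cdot>\<^bsub>C\<^esub> r \<in> T)"
  shows "joint_epi A T"
proof (rule joint_epiI)
  fix k k'
  assume k: "k \<in> Mor C" "k' \<in> Mor C" "Dom C k = A" "Dom C k' = A" "Cod C k = Cod C k'"
    and eq: "\<And>m. m \<in> T \<Longrightarrow> k \<cdot>\<^bsub>C\<^esub> m = k' \<cdot>\<^bsub>C\<^esub> m"
  show "k = k'"
  proof (rule joint_epiD[OF S])
    fix m assume m: "m \<in> S"
    note mm = joint_epi_simps(2,3)[OF S m]
    obtain R where R: "joint_epi (Dom C m) R" "\<forall>r \<in> R. m \<cdot>\<^bsub>C\<^esub> r \<in> T" using R[OF m] by blast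
    show "k \<cdot>\<^bsub>C\<^esub> m = k' \<cdot>\<^bsub>C\<^esub> m"
    proof (rule joint_epiD[OF R(1)])
      fix r assume r: "r \<in> R"
      have "k \<cdot>\<^bsub>C\<^esub> m \<cdot>\<^bsub>C\<^esub> r = k' \<cdot>\<^bsub>C\<^esub> m \<cdot>\<^bsub>C\<^esub> r" using eq R(2) r by blast
      then show "(k \<cdot>\<^bsub>C\<^esub> m) \<cdot>\<^bsub>C\<^esub> r = (k' \<cdot>\<^bsub>C\<^esub> m) \<cdot>\<^bsub>C\<^esub> r"
        using k mm joint_epi_simps(2,3)[OF R(1) r] by simp
    qed (use k mm in auto)
  qed (use k in auto)
qed (use T joint_epi_simps(1)[OF S] in auto)

lemma pushout_universal:
  assumes "is_pushout C f g (P, i, j)" "u \<cdot>\<^bsub>C\<^esub> f = v \<cdot>\<^bsub>C\<^esub> g"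
    and "u \<in> Mor C" "Dom C u = Cod C f" "Cod C u = W" "v \<in> Mor C" "Dom C v = Cod C g" "Cod C v = W"
  shows "\<exists>!h. h \<in> hom C P W \<and> h \<cdot>\<^bsub>C\<^esub> i = u \<and> h \<cdot>\<^bsub>C\<^esub> j = v"
proof -
  have "u \<in> hom C (Cod C f) W" "v \<in> hom C (Cod C g) W" using assms by (simp_all add: hom_def)
  then show ?thesis using assms(1,2) unfolding is_pushout.simps by blast
qed

lemma pullback_universal:
  assumes "is_pullback C f g (P, p, q)" "f \<cdot>\<^bsub>C\<^esub> u = g \<cdot>\<^bsub>C\<^esub> v"
    and "u \<in> Mor C" "Cod C u = Dom C f" "Dom C u = W" "v \<in> Mor C" "Cod C v = Dom C g" "Dom C v = W"
  shows "\<exists>!h. h \<in> hom C W P \<and> p \<cdot>\<^bsub>C\<^esub> h = u \<and> q \<cdot>\<^bsub>C\<^esub> h = v"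
proof -
  have "u \<in> hom C W (Dom C f)" "v \<in> hom C W (Dom C g)" using assms by (simp_all add: hom_def)
  then show ?thesis using assms(1,2) unfolding is_pullback.simps by blast
qed

lemma pushout_joint_epi:
  assumes "is_pushout C f g (P, i, j)"
  shows "joint_epi P {i, j}"
  unfolding joint_epi_def
proof (intro conjI ballI allI impI)
  have ij: "f \<in> Mor C" "g \<in> Mor C" "Dom C f = Dom C g" "i \<in> Mor C" "Dom C i = Cod C f" "Cod C i = P"
    "j \<in> Mor C" "Dom C j = Cod C g" "Cod C j = P" "i \<cdot>\<^bsub>C\<^esub> f = j \<cdot>\<^bsub>C\<^esub> g"
    using assms by (auto simp: hom_def)
  show "P \<in> Obj C" using ij vertex_in_Obj by blast
  show "m \<in> Mor C" "Cod C m = P" if "m \<in> {i, j}" for m using ij that by auto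
  fix W k k'
  assume k: "k \<in> hom C P W" "k' \<in> hom C P W" and eq: "\<forall>m \<in> {i, j}. k \<cdot>\<^bsub>C\<^esub> m = k' \<cdot>\<^bsub>C\<^esub> m"
  have "(k \<cdot>\<^bsub>C\<^esub> i) \<cdot>\<^bsub>C\<^esub> f = (k \<cdot>\<^bsub>C\<^esub> j) \<cdot>\<^bsub>C\<^esub> g"
    using ij k by (simp add: hom_def)
  moreover have "k \<cdot>\<^bsub>C\<^esub> i \<in> hom C (Cod C f) W" "k \<cdot>\<^bsub>C\<^esub> j \<in> hom C (Cod C g) W"
    using ij k by (simp_all add: hom_def)
  ultimately have "\<exists>!h. h \<in> hom C P W \<and> h \<cdot>\<^bsub>C\<^esub> i = k \<cdot>\<^bsub>C\<^esub> i \<and> h \<cdot>\<^bsub>C\<^esub> j = k \<cdot>\<^bsub>C\<^esub> j"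
    using assms by simp
  then show "k = k'" using k eq by (metis insertI1 insertI2)
qed

lemma initial_joint_epi: "is_initial C Z \<Longrightarrow> joint_epi Z {}"
  unfolding is_initial_def joint_epi_def hom_def by (auto, metis vertex_in_Obj(2))

lemma from_pushout:
  assumes "is_pushout C f g (P, i, j)" "u \<cdot>\<^bsub>C\<^esub> f = v \<cdot>\<^bsub>C\<^esub> g"
    and "u \<in> Mor C" "Dom C u = Cod C f" "Cod C u = W" "v \<in> Mor C" "Dom C v = Cod C g" "Cod C v = W"
  shows "from_pushout C (P, i, j) u v \<in> hom C P W \<and>
    from_pushout C (P, i, j) u v \<cdot>\<^bsub>C\<^esub> i = u \<and> from_pushout C (P, i, j) u v \<cdot>\<^bsub>C\<^esub> j = v"
  using theI'[OF pushout_universal[OF assms]] assms(5) by simp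

text \<open>Recognises a map as the one induced by its restrictions, also when it was constructed without
  mentioning \<open>from_pushout\<close>.\<close>

lemma from_pushout_comp:
  assumes p: "is_pushout C f g (P, i, j)" and h: "h \<in> Mor C" "Dom C h = P"
  shows "from_pushout C (P, i, j) (h \<cdot>\<^bsub>C\<^esub> i) (h \<cdot>\<^bsub>C\<^esub> j) = h"
proof -
  have ij: "i \<in> Mor C" "Cod C i = P" "j \<in> Mor C" "Cod C j = P"
    using p by (auto simp: hom_def)
  show ?thesis
    unfolding from_pushout.simps
  proof (rule the_equality)
    fix k assume k: "k \<in> hom C P (Cod C (h \<cdot>\<^bsub>C\<^esub> i)) \<and> k \<cdot>\<^bsub>C\<^esub> i = h \<cdot>\<^bsub>C\<^esub> i \<and> k \<cdot>\<^bsub>C\<^esub> j = h \<cdot>\<^bsub>C\<^esub> j"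
    show "k = h"
      by (rule joint_epiD[OF pushout_joint_epi[OF p]]) (use k h ij in \<open>auto simp: hom_def\<close>)
  qed (use h ij in \<open>simp add: hom_def\<close>)
qed

end

section \<open>Initial objects, pushouts and pullbacks from bicompleteness\<close>

text \<open>The shapes \<open>a \<leftarrow> z \<rightarrow> b\<close> and \<open>a \<rightarrow> z \<leftarrow> b\<close> with non-identity morphisms \<open>u\<close> and \<open>v\<close>; every object is
  its own identity. Two composable morphisms are never both different from identities, so the
  composite is the one that is \<open>u\<close> or \<open>v\<close>, if any.\<close>

definition span_shape :: "'u \<Rightarrow> 'u \<Rightarrow> 'u \<Rightarrow> 'u \<Rightarrow> 'u \<Rightarrow> ('u, 'u) category" where
  "span_shape z a b u v =
     \<lparr> Obj = {z, a, b}, Mor = {z, a, b, u, v},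
       Dom = (\<lambda>m. if m = u \<or> m = v then z else m),
       Cod = (\<lambda>m. if m = u then a else if m = v then b else m),
       Ident = (\<lambda>x. x),
       Comp = (\<lambda>g f. if f = u \<or> f = v then f else g) \<rparr>"

definition cospan_shape :: "'u \<Rightarrow> 'u \<Rightarrow> 'u \<Rightarrow> 'u \<Rightarrow> 'u \<Rightarrow> ('u, 'u) category" where
  "cospan_shape z a b u v =
     \<lparr> Obj = {z, a, b}, Mor = {z, a, b, u, v},
       Dom = (\<lambda>m. if m = u then a else if m = v then b else m),
       Cod = (\<lambda>m. if m = u \<or> m = v then z else m),
       Ident = (\<lambda>x. x),
       Comp = (\<lambda>g f. if f = u \<or> f = v then f else g) \<rparr>"

text \<open>A finite set has strictly fewer elements than an infinite type, so the shapes count as small.\<close>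

lemma small_span_shape:
  assumes "infinite (UNIV :: 'u set)" "distinct [z, a, b, u, v :: 'u]"
  shows "small_category (span_shape z a b u v)"
proof -
  have "Mor (span_shape z a b u v) \<prec> (UNIV :: 'u set)"
    using assms(1) by (intro finite_lesspoll_infinite) (auto simp: span_shape_def)
  moreover have "category (span_shape z a b u v)"
    using assms(2) by unfold_locales (auto simp: span_shape_def hom_def split: if_splits)
  ultimately show ?thesis by (simp add: small_category_def)
qed

lemma small_cospan_shape:
  assumes "infinite (UNIV :: 'u set)" "distinct [z, a, b, u, v :: 'u]"
  shows "small_category (cospan_shape z a b u v)"
proof -
  have "Mor (cospan_shape z a b u v) \<prec> (UNIV :: 'u set)"
    using assms(1) by (intro finite_lesspoll_infinite) (auto simp: cospan_shape_def)
  moreover have "category (cospan_shape z a b u v)"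
    using assms(2) by unfold_locales (auto simp: cospan_shape_def hom_def split: if_splits)
  ultimately show ?thesis by (simp add: small_category_def)
qed

text \<open>The shapes must be categories on the given type itself, so their five morphisms have to be found
  there.\<close>

lemma infinite_five_distinct:
  assumes "infinite (UNIV :: 'u set)"
  obtains z a b u v :: 'u where "distinct [z, a, b, u, v]"
proof -
  obtain e :: "nat \<Rightarrow> 'u" where "inj e"
    using assms infinite_countable_subset by blast
  then have "distinct [e 0, e 1, e 2, e 3, e 4]"
    by (simp add: inj_eq)
  then show thesis by (rule that)
qed

context category
begin

lemma ex_initial_if_small_cocomplete:
  assumes "small_cocomplete TYPE('u) C"
  shows "\<exists>Z. is_initial C Z"
proof -
  define J :: "('u, 'u) category" where
    "J = \<lparr> Obj = {}, Mor = {}, Dom = id, Cod = id, Ident = id, Comp = (\<lambda>g f. g) \<rparr>"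
  have "category J" by unfold_locales (auto simp: J_def hom_def)
  moreover have "Mor J \<prec> (UNIV :: 'u set)"
    by (auto simp: J_def lesspoll_def eqpoll_def bij_betw_def)
  ultimately have "small_category J" by (simp add: small_category_def)
  moreover have "is_functor J C (\<lambda>_. undefined) (\<lambda>_. undefined)"
    by (auto simp: is_functor_def J_def hom_def)
  ultimately obtain L p where "is_colimit J C (\<lambda>_. undefined) (\<lambda>_. undefined) L p"
    using assms unfolding small_cocomplete_def by blast
  then have "is_initial C L"
    by (auto simp: is_colimit_def is_cocone_def is_initial_def J_def)
  then show ?thesis ..
qed

lemma ex_pushout_if_small_cocomplete:
  assumes inf: "infinite (UNIV :: 'u set)" and sc: "small_cocomplete TYPE('u) C"
    and f: "f \<in> Mor C" and g: "g \<in> Mor C" and fg: "Dom C f = Dom C g"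
  shows "\<exists>t. is_pushout C f g t"
proof -
  obtain z a b u v :: 'u where d: "distinct [z, a, b, u, v]"
    using infinite_five_distinct[OF inf] .
  define J where "J = span_shape z a b u v"
  define Fo where "Fo = (\<lambda>x. if x = z then Dom C f else if x = a then Cod C f else Cod C g)"
  define Fm where "Fm = (\<lambda>x. if x = u then f else if x = v then g else Ident C (Fo x))"
  have "is_functor J C Fo Fm"
    using d f g fg
    by (auto simp: is_functor_def J_def span_shape_def hom_def Fo_def Fm_def split: if_splits)
  moreover have "small_category J" unfolding J_def by (rule small_span_shape[OF inf d])
  ultimately obtain L p where L: "is_colimit J C Fo Fm L p"
    using sc unfolding small_cocomplete_def by blast
  then have p: "L \<in> Obj C" "p z \<in> hom C (Dom C f) L" "p a \<in> hom C (Cod C f) L"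
      "p b \<in> hom C (Cod C g) L" "p a \<cdot>\<^bsub>C\<^esub> f = p z" "p b \<cdot>\<^bsub>C\<^esub> g = p z"
    using d by (auto simp: is_colimit_def is_cocone_def J_def span_shape_def Fo_def Fm_def)
  have "is_pushout C f g (L, p a, p b)"
    unfolding is_pushout.simps
  proof (intro conjI allI ballI impI)
    fix X r s
    assume r: "r \<in> hom C (Cod C f) X" and s: "s \<in> hom C (Cod C g) X"
      and rs: "r \<cdot>\<^bsub>C\<^esub> f = s \<cdot>\<^bsub>C\<^esub> g"
    define q where "q = (\<lambda>x. if x = z then r \<cdot>\<^bsub>C\<^esub> f else if x = a then r else s)"
    have "is_cocone J C Fo Fm X q"
      using d f g fg r s rs
      by (auto simp: is_cocone_def J_def span_shape_def Fo_def Fm_def q_def hom_def)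
    then have "\<exists>!h. h \<in> hom C L X \<and> (\<forall>j \<in> Obj J. h \<cdot>\<^bsub>C\<^esub> p j = q j)"
      using L by (auto simp: is_colimit_def)
    moreover have "(h \<in> hom C L X \<and> (\<forall>j \<in> Obj J. h \<cdot>\<^bsub>C\<^esub> p j = q j))
        \<longleftrightarrow> (h \<in> hom C L X \<and> h \<cdot>\<^bsub>C\<^esub> p a = r \<and> h \<cdot>\<^bsub>C\<^esub> p b = s)" for h
    proof -
      have "h \<cdot>\<^bsub>C\<^esub> p z = r \<cdot>\<^bsub>C\<^esub> f" if "h \<in> hom C L X" "h \<cdot>\<^bsub>C\<^esub> p a = r"
        using comp_assoc[of f "p a" h] that p f by (auto simp: hom_def)
      then show ?thesis using d by (auto simp: J_def span_shape_def q_def)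
    qed
    ultimately show "\<exists>!h. h \<in> hom C L X \<and> h \<cdot>\<^bsub>C\<^esub> p a = r \<and> h \<cdot>\<^bsub>C\<^esub> p b = s"
      by (simp only:)
  qed (use f g fg p in simp_all)
  then show ?thesis ..
qed

lemma ex_pullback_if_small_complete:
  assumes inf: "infinite (UNIV :: 'u set)" and sc: "small_complete TYPE('u) C"
    and f: "f \<in> Mor C" and g: "g \<in> Mor C" and fg: "Cod C f = Cod C g"
  shows "\<exists>t. is_pullback C f g t"
proof -
  obtain z a b u v :: 'u where d: "distinct [z, a, b, u, v]"
    using infinite_five_distinct[OF inf] .
  define J where "J = cospan_shape z a b u v"
  define Fo where "Fo = (\<lambda>x. if x = z then Cod C f else if x = a then Dom C f else Dom C g)"
  define Fm where "Fm = (\<lambda>x. if x = u then f else if x = v then g else Ident C (Fo x))"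
  have "is_functor J C Fo Fm"
    using d f g fg
    by (auto simp: is_functor_def J_def cospan_shape_def hom_def Fo_def Fm_def split: if_splits)
  moreover have "small_category J" unfolding J_def by (rule small_cospan_shape[OF inf d])
  ultimately obtain L p where L: "is_limit J C Fo Fm L p"
    using sc unfolding small_complete_def by blast
  then have p: "L \<in> Obj C" "p z \<in> hom C L (Cod C f)" "p a \<in> hom C L (Dom C f)"
      "p b \<in> hom C L (Dom C g)" "f \<cdot>\<^bsub>C\<^esub> p a = p z" "g \<cdot>\<^bsub>C\<^esub> p b = p z"
    using d by (auto simp: is_limit_def is_cone_def J_def cospan_shape_def Fo_def Fm_def)
  have "is_pullback C f g (L, p a, p b)"
    unfolding is_pullback.simps
  proof (intro conjI allI ballI impI)
    fix X r s
    assume r: "r \<in> hom C X (Dom C f)" and s: "s \<in> hom C X (Dom C g)"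
      and rs: "f \<cdot>\<^bsub>C\<^esub> r = g \<cdot>\<^bsub>C\<^esub> s"
    define q where "q = (\<lambda>x. if x = z then f \<cdot>\<^bsub>C\<^esub> r else if x = a then r else s)"
    have "is_cone J C Fo Fm X q"
      using d f g fg r s rs
      by (auto simp: is_cone_def J_def cospan_shape_def Fo_def Fm_def q_def hom_def)
    then have "\<exists>!h. h \<in> hom C X L \<and> (\<forall>j \<in> Obj J. p j \<cdot>\<^bsub>C\<^esub> h = q j)"
      using L by (auto simp: is_limit_def)
    moreover have "(h \<in> hom C X L \<and> (\<forall>j \<in> Obj J. p j \<cdot>\<^bsub>C\<^esub> h = q j))
        \<longleftrightarrow> (h \<in> hom C X L \<and> p a \<cdot>\<^bsub>C\<^esub> h = r \<and> p b \<cdot>\<^bsub>C\<^esub> h = s)" for h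
    proof -
      have "p z \<cdot>\<^bsub>C\<^esub> h = f \<cdot>\<^bsub>C\<^esub> r" if "h \<in> hom C X L" "p a \<cdot>\<^bsub>C\<^esub> h = r"
        using comp_assoc[of h "p a" f] that p f by (auto simp: hom_def)
      then show ?thesis using d by (auto simp: J_def cospan_shape_def q_def)
    qed
    ultimately show "\<exists>!h. h \<in> hom C X L \<and> p a \<cdot>\<^bsub>C\<^esub> h = r \<and> p b \<cdot>\<^bsub>C\<^esub> h = s"
      by (simp only:)
  qed (use f g fg p in simp_all)
  then show ?thesis ..
qed

end

section \<open>The arrow category\<close>

text \<open>An arrow \<open>f\<close> as a functor on \<open>{0 < 1}\<close>: \<open>vertex C f e\<close> is its value at \<open>e\<close>, with \<open>False\<close> for \<open>0\<close> and
  \<open>True\<close> for \<open>1\<close>, and \<open>edge C f e\<close> is its value at the morphism \<open>0 \<rightarrow> e\<close>. These edges suffice to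
  express naturality, since the only non-identity morphism is \<open>0 \<rightarrow> 1\<close>. Indexing by truth values
  makes statements about both ends of an arrow uniform.\<close>

definition vertex :: "('o, 'm) category \<Rightarrow> 'm \<Rightarrow> bool \<Rightarrow> 'o" where
  "vertex C f e = (if e then Cod C f else Dom C f)"

definition edge :: "('o, 'm) category \<Rightarrow> 'm \<Rightarrow> bool \<Rightarrow> 'm" where
  "edge C f e = (if e then f else Ident C (Dom C f))"

definition component :: "'m square \<Rightarrow> bool \<Rightarrow> 'm" where
  "component s e = (if e then comp1 s else comp0 s)"

lemma component_Square [simp]: "component (Square f g a b) e = (if e then b else a)"
  by (simp add: component_def)

lemma Arr_simps [simp]:
  "Obj (Arr C) = Mor C"
  "Dom (Arr C) = sq_dom"
  "Cod (Arr C) = sq_cod"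
  "component (t \<cdot>\<^bsub>Arr C\<^esub> s) e = component t e \<cdot>\<^bsub>C\<^esub> component s e"
  "component (Ident (Arr C) f) e = Ident C (vertex C f e)"
  "sq_dom (t \<cdot>\<^bsub>Arr C\<^esub> s) = sq_dom s"
  "sq_cod (t \<cdot>\<^bsub>Arr C\<^esub> s) = sq_cod t"
  "sq_dom (Ident (Arr C) f) = f"
  "sq_cod (Ident (Arr C) f) = f"
  by (simp_all add: Arr_def component_def vertex_def)

lemma vertex_simps [simp]: "vertex C f True = Cod C f" "vertex C f False = Dom C f"
  by (simp_all add: vertex_def)

lemma edge_simps [simp]: "edge C f True = f" "edge C f False = Ident C (Dom C f)"
  by (simp_all add: edge_def)

lemma square_eq_iff:
  "s = t \<longleftrightarrow> sq_dom s = sq_dom t \<and> sq_cod s = sq_cod t \<and>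
     component s False = component t False \<and> component s True = component t True"
  by (cases s; cases t) simp

lemma square_eqI:
  assumes "sq_dom s = sq_dom t" "sq_cod s = sq_cod t" "\<And>e. component s e = component t e"
  shows "s = t"
  using assms by (simp add: square_eq_iff)

context category
begin

lemma vertex_in_Obj_bool [simp]: "f \<in> Mor C \<Longrightarrow> vertex C f e \<in> Obj C"
  by (simp add: vertex_def)

lemma edge_mor_simps [simp]:
  assumes "f \<in> Mor C"
  shows "edge C f e \<in> Mor C" "Dom C (edge C f e) = Dom C f" "Cod C (edge C f e) = vertex C f e"
  using assms by (auto simp add: edge_def)

lemma Mor_Arr_iff:
  "s \<in> Mor (Arr C) \<longleftrightarrow> sq_dom s \<in> Mor C \<and> sq_cod s \<in> Mor C \<and>
     (\<forall>e. component s e \<in> hom C (vertex C (sq_dom s) e) (vertex C (sq_cod s) e)) \<and>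
     sq_cod s \<cdot>\<^bsub>C\<^esub> component s False = component s True \<cdot>\<^bsub>C\<^esub> sq_dom s"
  by (cases s) (auto simp: Arr_def all_bool_eq)

lemma Mor_ArrD:
  assumes "s \<in> Mor (Arr C)"
  shows "sq_dom s \<in> Mor C" "sq_cod s \<in> Mor C" "component s e \<in> Mor C"
    "Dom C (component s e) = vertex C (sq_dom s) e" "Cod C (component s e) = vertex C (sq_cod s) e"
  using assms by (auto simp: Mor_Arr_iff hom_def)

lemma square_commutes:
  assumes "s \<in> Mor (Arr C)"
  shows "component s e \<cdot>\<^bsub>C\<^esub> edge C (sq_dom s) e = edge C (sq_cod s) e \<cdot>\<^bsub>C\<^esub> component s False"
  using assms by (cases e) (auto simp: Mor_Arr_iff hom_def)

lemma Arr_homI: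
  assumes "f \<in> Mor C" "g \<in> Mor C"
    and "\<And>e. component s e \<in> Mor C" "\<And>e. Dom C (component s e) = vertex C f e"
    "\<And>e. Cod C (component s e) = vertex C g e"
    and "g \<cdot>\<^bsub>C\<^esub> component s False = component s True \<cdot>\<^bsub>C\<^esub> f"
    and "sq_dom s = f" "sq_cod s = g"
  shows "s \<in> hom (Arr C) f g"
  using assms by (simp add: hom_def Mor_Arr_iff)

declare Mor_ArrD [simp]

lemma category_Arr: "category (Arr C)"
proof
  fix f assume "f \<in> Mor (Arr C)"
  then show "Dom (Arr C) f \<in> Obj (Arr C)" "Cod (Arr C) f \<in> Obj (Arr C)" by simp_all
next
  fix f assume "f \<in> Obj (Arr C)"
  then show "Ident (Arr C) f \<in> hom (Arr C) f f"
    by (intro Arr_homI) simp_all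
next
  fix s t f g h
  assume st: "s \<in> hom (Arr C) f g" "t \<in> hom (Arr C) g h"
  then have m: "s \<in> Mor (Arr C)" "t \<in> Mor (Arr C)" by (auto simp: hom_def)
  have d: "sq_dom (t \<cdot>\<^bsub>Arr C\<^esub> s) = f" "sq_cod (t \<cdot>\<^bsub>Arr C\<^esub> s) = h"
    using st by (auto simp: hom_def)
  have "h \<cdot>\<^bsub>C\<^esub> component t False \<cdot>\<^bsub>C\<^esub> component s False
      = (h \<cdot>\<^bsub>C\<^esub> component t False) \<cdot>\<^bsub>C\<^esub> component s False"
    using st by (auto simp: hom_def)
  also have "h \<cdot>\<^bsub>C\<^esub> component t False = component t True \<cdot>\<^bsub>C\<^esub> g"
    using square_commutes[of t True] st by (auto simp: hom_def)
  also have "(component t True \<cdot>\<^bsub>C\<^esub> g) \<cdot>\<^bsub>C\<^esub> component s False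
      = component t True \<cdot>\<^bsub>C\<^esub> component s True \<cdot>\<^bsub>C\<^esub> f"
    using square_commutes[of s True] st by (auto simp: hom_def)
  finally show "t \<cdot>\<^bsub>Arr C\<^esub> s \<in> hom (Arr C) f h"
    using st by (intro Arr_homI d) (auto simp: hom_def)
next
  fix s f g assume s: "s \<in> hom (Arr C) f g"
  show "s \<cdot>\<^bsub>Arr C\<^esub> Ident (Arr C) f = s"
    using s by (intro square_eqI) (auto simp: hom_def)
  show "Ident (Arr C) g \<cdot>\<^bsub>Arr C\<^esub> s = s"
    using s by (intro square_eqI) (auto simp: hom_def)
next
  fix r s t e f g h
  assume "r \<in> hom (Arr C) e f" "s \<in> hom (Arr C) f g" "t \<in> hom (Arr C) g h"
  then show "(t \<cdot>\<^bsub>Arr C\<^esub> s) \<cdot>\<^bsub>Arr C\<^esub> r = t \<cdot>\<^bsub>Arr C\<^esub> (s \<cdot>\<^bsub>Arr C\<^esub> r)"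
    by (intro square_eqI) (auto simp: hom_def)
qed

text \<open>The inverses of the two components again form a square.\<close>

lemma is_iso_Arr:
  assumes "s \<in> Mor (Arr C)" "\<And>e. is_iso C (component s e)"
  shows "is_iso (Arr C) s"
proof -
  define t where "t = Square (sq_cod s) (sq_dom s)
    (inverse_mor (component s False)) (inverse_mor (component s True))"
  have t: "component t e = inverse_mor (component s e)" for e
    by (cases e) (simp_all add: t_def)
  have "sq_dom s \<cdot>\<^bsub>C\<^esub> component t False = component t True \<cdot>\<^bsub>C\<^esub> sq_cod s"
    unfolding t
    by (rule sym, rule inverse_natural) (use assms square_commutes[OF assms(1), of True] in simp_all)
  then have th: "t \<in> hom (Arr C) (sq_cod s) (sq_dom s)"
    using assms by (intro Arr_homI) (simp_all add: t, simp_all add: t_def)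
  interpret Arr: category "Arr C" by (rule category_Arr)
  have "t \<cdot>\<^bsub>Arr C\<^esub> s = Ident (Arr C) (sq_dom s)"
    using assms th Arr.comp_simps[of s t] Arr.ident_simps[of "sq_dom s"]
    by (intro square_eqI) (auto simp: hom_def t)
  moreover have "s \<cdot>\<^bsub>Arr C\<^esub> t = Ident (Arr C) (sq_cod s)"
    using assms th Arr.comp_simps[of t s] Arr.ident_simps[of "sq_cod s"]
    by (intro square_eqI) (auto simp: hom_def t)
  ultimately show ?thesis
    using assms th by (auto simp: is_iso_def)
qed

lemma Arr_hom_eqI:
  assumes "s \<in> hom (Arr C) f g" "t \<in> hom (Arr C) f g" "\<And>e. component s e = component t e"
  shows "s = t"
  using assms by (intro square_eqI) (auto simp: hom_def)

lemma Arr_homD: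
  assumes "s \<in> hom (Arr C) f g"
  shows "s \<in> Mor (Arr C)" "sq_dom s = f" "sq_cod s = g" "f \<in> Mor C" "g \<in> Mor C"
  using assms Mor_ArrD(1,2)[of s] by (auto simp: hom_def)

end

section \<open>Monoidal categories\<close>

context monoidal
begin

abbreviation cmp (infixr "\<bullet>" 75) where "g \<bullet> f \<equiv> g \<cdot>\<^bsub>C\<^esub> f"
abbreviation tens (infixr "\<star>" 80) where "f \<star> g \<equiv> f \<otimes>\<^bsub>M\<^esub> g"
abbreviation tens_obj (infixr "\<star>\<^sub>o" 80) where "X \<star>\<^sub>o Y \<equiv> X \<otimes>\<^sub>o\<^bsub>M\<^esub> Y"
abbreviation one ("\<one>") where "\<one> X \<equiv> Ident C X"
abbreviation unit_object ("\<I>") where "\<I> \<equiv> unit_obj M"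

lemma tens_obj_in_Obj [simp]: "X \<in> Obj C \<Longrightarrow> Y \<in> Obj C \<Longrightarrow> X \<star>\<^sub>o Y \<in> Obj C"
  using tensor_functor by (auto simp: is_functor_def prod_category_def)

lemma tens_simps [simp]:
  assumes "f \<in> Mor C" "g \<in> Mor C"
  shows "f \<star> g \<in> Mor C" "Dom C (f \<star> g) = Dom C f \<star>\<^sub>o Dom C g"
    "Cod C (f \<star> g) = Cod C f \<star>\<^sub>o Cod C g"
proof -
  have "(f, g) \<in> hom (prod_category C C) (Dom C f, Dom C g) (Cod C f, Cod C g)"
    using assms by (simp add: hom_def prod_category_def)
  then have "(\<lambda>(f, g). f \<star> g) (f, g) \<in> hom C ((\<lambda>(X, Y). X \<star>\<^sub>o Y) (Dom C f, Dom C g))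
      ((\<lambda>(X, Y). X \<star>\<^sub>o Y) (Cod C f, Cod C g))"
    using tensor_functor unfolding is_functor_def by blast
  then show "f \<star> g \<in> Mor C" "Dom C (f \<star> g) = Dom C f \<star>\<^sub>o Dom C g"
    "Cod C (f \<star> g) = Cod C f \<star>\<^sub>o Cod C g"
    by (auto simp: hom_def)
qed

lemma tens_ident [simp]: "X \<in> Obj C \<Longrightarrow> Y \<in> Obj C \<Longrightarrow> \<one> X \<star> \<one> Y = \<one> (X \<star>\<^sub>o Y)"
  using tensor_functor by (auto simp: is_functor_def prod_category_def)

lemma interchange:
  assumes "f \<in> Mor C" "g \<in> Mor C" "f' \<in> Mor C" "g' \<in> Mor C" "Cod C f = Dom C f'" "Cod C g = Dom C g'"
  shows "(f' \<star> g') \<bullet> (f \<star> g) = (f' \<bullet> f) \<star> (g' \<bullet> g)"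
proof -
  have "(f, g) \<in> hom (prod_category C C) (Dom C f, Dom C g) (Cod C f, Cod C g)"
    "(f', g') \<in> hom (prod_category C C) (Cod C f, Cod C g) (Cod C f', Cod C g')"
    using assms by (simp_all add: hom_def prod_category_def)
  then have "(\<lambda>(f, g). f \<star> g) ((f', g') \<cdot>\<^bsub>prod_category C C\<^esub> (f, g)) =
     (\<lambda>(f, g). f \<star> g) (f', g') \<bullet> (\<lambda>(f, g). f \<star> g) (f, g)"
    using tensor_functor unfolding is_functor_def by blast
  then show ?thesis by (simp add: prod_category_def)
qed

lemma interchange':
  assumes "f \<in> Mor C" "g \<in> Mor C" "f' \<in> Mor C" "g' \<in> Mor C" "Cod C f = Dom C f'" "Cod C g = Dom C g'"
    and "z \<in> Mor C" "Cod C z = Dom C f \<star>\<^sub>o Dom C g"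
  shows "(f' \<star> g') \<bullet> (f \<star> g) \<bullet> z = ((f' \<bullet> f) \<star> (g' \<bullet> g)) \<bullet> z"
  using assms by (subst comp_assoc[symmetric]) (simp_all add: interchange)

lemma unit_in_Obj' [simp]: "\<I> \<in> Obj C"
  by (rule unit_in_Obj)

lemma assoc_simps [simp]:
  assumes "X \<in> Obj C" "Y \<in> Obj C" "Z \<in> Obj C"
  shows "assoc M X Y Z \<in> Mor C" "Dom C (assoc M X Y Z) = (X \<star>\<^sub>o Y) \<star>\<^sub>o Z"
    "Cod C (assoc M X Y Z) = X \<star>\<^sub>o (Y \<star>\<^sub>o Z)" "is_iso C (assoc M X Y Z)"
  using assoc_in_hom[OF assms] assoc_iso[OF assms] by (auto simp: hom_def)

lemma lunit_simps [simp]: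
  assumes "X \<in> Obj C"
  shows "lunit M X \<in> Mor C" "Dom C (lunit M X) = \<I> \<star>\<^sub>o X" "Cod C (lunit M X) = X"
    "is_iso C (lunit M X)"
  using lunit_in_hom[OF assms] lunit_iso[OF assms] by (auto simp: hom_def)

lemma runit_simps [simp]:
  assumes "X \<in> Obj C"
  shows "runit M X \<in> Mor C" "Dom C (runit M X) = X \<star>\<^sub>o \<I>" "Cod C (runit M X) = X"
    "is_iso C (runit M X)"
  using runit_in_hom[OF assms] runit_iso[OF assms] by (auto simp: hom_def)

text \<open>Naturality with the objects as free variables and side conditions that the simplifier can solve.\<close>

lemma assoc_nat:
  assumes "f \<in> Mor C" "g \<in> Mor C" "h \<in> Mor C"
    and "Dom C f = X" "Dom C g = Y" "Dom C h = Z" "Cod C f = X'" "Cod C g = Y'" "Cod C h = Z'"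
  shows "assoc M X' Y' Z' \<bullet> ((f \<star> g) \<star> h) = (f \<star> (g \<star> h)) \<bullet> assoc M X Y Z"
  using assms by (intro assoc_natural) (auto simp: hom_def)

lemma lunit_nat:
  assumes "f \<in> Mor C" "Dom C f = X" "Cod C f = Y"
  shows "lunit M Y \<bullet> (\<one> \<I> \<star> f) = f \<bullet> lunit M X"
  using assms by (intro lunit_natural) (auto simp: hom_def)

lemma runit_nat:
  assumes "f \<in> Mor C" "Dom C f = X" "Cod C f = Y"
  shows "runit M Y \<bullet> (f \<star> \<one> \<I>) = f \<bullet> runit M X"
  using assms by (intro runit_natural) (auto simp: hom_def)

abbreviation assoc_inv where "assoc_inv X Y Z \<equiv> inverse_mor (assoc M X Y Z)"

lemma assoc_inv_nat:
  assumes "f \<in> Mor C" "g \<in> Mor C" "h \<in> Mor C"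
    and "Dom C f = X" "Dom C g = Y" "Dom C h = Z" "Cod C f = X'" "Cod C g = Y'" "Cod C h = Z'"
  shows "assoc_inv X' Y' Z' \<bullet> (f \<star> (g \<star> h)) = ((f \<star> g) \<star> h) \<bullet> assoc_inv X Y Z"
proof -
  have "X \<in> Obj C" "Y \<in> Obj C" "Z \<in> Obj C" "X' \<in> Obj C" "Y' \<in> Obj C" "Z' \<in> Obj C"
    using assms by auto
  then show ?thesis
    using assms by (intro inverse_natural assoc_nat) simp_all
qed

text \<open>An identity of a tensor product is not syntactically a tensor product of identities, so the
  general naturality rule does not match here.\<close>

lemma assoc_nat_ident:
  assumes "X \<in> Obj C" "Y \<in> Obj C" "h \<in> Mor C" "Dom C h = Z" "Cod C h = Z'"
  shows "assoc M X Y Z' \<bullet> (\<one> (X \<star>\<^sub>o Y) \<star> h) = (\<one> X \<star> (\<one> Y \<star> h)) \<bullet> assoc M X Y Z"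
proof -
  have "assoc M X Y Z' \<bullet> ((\<one> X \<star> \<one> Y) \<star> h) = (\<one> X \<star> (\<one> Y \<star> h)) \<bullet> assoc M X Y Z"
    using assms by (intro assoc_nat) simp_all
  then show ?thesis using assms by simp
qed

lemma assoc_inv_nat_ident:
  assumes "f \<in> Mor C" "Y \<in> Obj C" "Z \<in> Obj C" "Dom C f = X" "Cod C f = X'"
  shows "assoc_inv X' Y Z \<bullet> (f \<star> \<one> (Y \<star>\<^sub>o Z)) = ((f \<star> \<one> Y) \<star> \<one> Z) \<bullet> assoc_inv X Y Z"
proof -
  have "assoc_inv X' Y Z \<bullet> (f \<star> (\<one> Y \<star> \<one> Z)) = ((f \<star> \<one> Y) \<star> \<one> Z) \<bullet> assoc_inv X Y Z"
    using assms by (intro assoc_inv_nat) simp_all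
  then show ?thesis using assms by simp
qed

end

context symmetric_monoidal
begin

lemma symm_simps [simp]:
  assumes "X \<in> Obj C" "Y \<in> Obj C"
  shows "symm M X Y \<in> Mor C" "Dom C (symm M X Y) = X \<star>\<^sub>o Y" "Cod C (symm M X Y) = Y \<star>\<^sub>o X"
    "symm M Y X \<bullet> symm M X Y = \<one> (X \<star>\<^sub>o Y)"
  using symm_in_hom[OF assms] symm_symm[OF assms] by (auto simp: hom_def)

lemma symm_symm' [simp]:
  assumes "X \<in> Obj C" "Y \<in> Obj C" "z \<in> Mor C" "Cod C z = X \<star>\<^sub>o Y"
  shows "symm M Y X \<bullet> symm M X Y \<bullet> z = z"
  using assms by (subst comp_assoc[symmetric]) simp_all

lemma symm_nat:
  assumes "f \<in> Mor C" "g \<in> Mor C" "Dom C f = X" "Dom C g = Y" "Cod C f = X'" "Cod C g = Y'"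
  shows "symm M X' Y' \<bullet> (f \<star> g) = (g \<star> f) \<bullet> symm M X Y"
  using assms by (intro symm_natural) (auto simp: hom_def)

end

context closed_symmetric_monoidal
begin

lemma ihom_simps [simp]:
  assumes "Y \<in> Obj C" "Z \<in> Obj C"
  shows "ihom M Y Z \<in> Obj C" "ev M Y Z \<in> Mor C" "Dom C (ev M Y Z) = ihom M Y Z \<star>\<^sub>o Y"
    "Cod C (ev M Y Z) = Z"
  using ihom_in_Obj[OF assms] ev_in_hom[OF assms] by (auto simp: hom_def)

text \<open>Inverse to currying. Equations between maps into an internal hom are proved by comparing their
  images under \<open>uncurry\<close>.\<close>

definition uncurry :: "'a \<Rightarrow> 'a \<Rightarrow> 'b \<Rightarrow> 'b" where
  "uncurry Y Z k = ev M Y Z \<bullet> (k \<star> \<one> Y)"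

lemma uncurry_simps [simp]:
  assumes "Y \<in> Obj C" "Z \<in> Obj C" "k \<in> Mor C" "Cod C k = ihom M Y Z"
  shows "uncurry Y Z k \<in> Mor C" "Dom C (uncurry Y Z k) = Dom C k \<star>\<^sub>o Y" "Cod C (uncurry Y Z k) = Z"
  using assms by (simp_all add: uncurry_def)

lemma uncurry_comp:
  assumes "Y \<in> Obj C" "Z \<in> Obj C" "k \<in> Mor C" "Cod C k = ihom M Y Z" "l \<in> Mor C" "Cod C l = Dom C k"
  shows "uncurry Y Z (k \<bullet> l) = uncurry Y Z k \<bullet> (l \<star> \<one> Y)"
  using assms by (simp add: uncurry_def interchange)

lemma ex1_uncurry:
  assumes "X \<in> Obj C" "Y \<in> Obj C" "f \<in> Mor C" "Dom C f = X \<star>\<^sub>o Y"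
  shows "\<exists>!k. k \<in> hom C X (ihom M Y (Cod C f)) \<and> uncurry Y (Cod C f) k = f"
  unfolding uncurry_def using assms by (intro ev_universal) (simp_all add: hom_def)

lemma curry_exists:
  assumes "X \<in> Obj C" "Y \<in> Obj C" "f \<in> Mor C" "Dom C f = X \<star>\<^sub>o Y" "Cod C f = Z"
  obtains k where "k \<in> Mor C" "Dom C k = X" "Cod C k = ihom M Y Z" "uncurry Y Z k = f"
  using ex1_uncurry[OF assms(1-4)] assms(5) by (auto simp: hom_def)

lemma uncurry_inject:
  assumes "uncurry Y Z k = uncurry Y Z k'" "Y \<in> Obj C" "Z \<in> Obj C"
    and "k \<in> Mor C" "k' \<in> Mor C" "Dom C k = Dom C k'" "Cod C k = ihom M Y Z" "Cod C k' = ihom M Y Z"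
  shows "k = k'"
proof -
  have "\<exists>!l. l \<in> hom C (Dom C k) (ihom M Y Z) \<and> uncurry Y Z l = uncurry Y Z k"
    using ex1_uncurry[of "Dom C k" Y "uncurry Y Z k"] assms by simp
  then show ?thesis using assms by (auto simp: hom_def)
qed

lemma ihom_mor:
  assumes "u \<in> Mor C" "v \<in> Mor C"
  shows "ihom_mor C M u v \<in> Mor C" (is ?t1)
    "Dom C (ihom_mor C M u v) = ihom M (Cod C u) (Dom C v)" (is ?t2)
    "Cod C (ihom_mor C M u v) = ihom M (Dom C u) (Cod C v)" (is ?t3)
    "uncurry (Dom C u) (Cod C v) (ihom_mor C M u v)
      = v \<bullet> ev M (Cod C u) (Dom C v) \<bullet> (\<one> (ihom M (Cod C u) (Dom C v)) \<star> u)" (is ?t4)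
proof -
  let ?H = "ihom M (Cod C u) (Dom C v)"
  define w where "w = v \<bullet> ev M (Cod C u) (Dom C v) \<bullet> (\<one> ?H \<star> u)"
  have "w \<in> Mor C" "Dom C w = ?H \<star>\<^sub>o Dom C u" "Cod C w = Cod C v"
    using assms by (simp_all add: w_def)
  then have "\<exists>!k. k \<in> hom C ?H (ihom M (Dom C u) (Cod C v)) \<and> uncurry (Dom C u) (Cod C v) k = w"
    using ex1_uncurry[of ?H "Dom C u" w] assms by simp
  from theI'[OF this] have "ihom_mor C M u v \<in> hom C ?H (ihom M (Dom C u) (Cod C v)) \<and>
      uncurry (Dom C u) (Cod C v) (ihom_mor C M u v) = w"
    by (simp add: ihom_mor_def curry_mor_def uncurry_def w_def Let_def)
  then show ?t1 ?t2 ?t3 ?t4 by (simp_all add: hom_def w_def)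
qed

text \<open>Under the adjunction, \<open>ihom_mor u v\<close> acts by composing with \<open>v\<close> on the outside and with \<open>u\<close> on
  the argument.\<close>

lemma uncurry_ihom_mor_comp:
  assumes "u \<in> Mor C" "v \<in> Mor C" "k \<in> Mor C" "Cod C k = ihom M (Cod C u) (Dom C v)"
  shows "uncurry (Dom C u) (Cod C v) (ihom_mor C M u v \<bullet> k)
    = v \<bullet> uncurry (Cod C u) (Dom C v) k \<bullet> (\<one> (Dom C k) \<star> u)"
proof -
  have "uncurry (Dom C u) (Cod C v) (ihom_mor C M u v \<bullet> k)
    = (v \<bullet> ev M (Cod C u) (Dom C v) \<bullet> (\<one> (Cod C k) \<star> u)) \<bullet> (k \<star> \<one> (Dom C u))"
    using assms by (simp add: uncurry_comp ihom_mor)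
  also have "\<dots> = v \<bullet> ev M (Cod C u) (Dom C v) \<bullet> (\<one> (Cod C k) \<star> u) \<bullet> (k \<star> \<one> (Dom C u))"
    using assms by simp
  also have "(\<one> (Cod C k) \<star> u) \<bullet> (k \<star> \<one> (Dom C u)) = (k \<star> \<one> (Cod C u)) \<bullet> (\<one> (Dom C k) \<star> u)"
    using assms by (simp add: interchange del: tens_ident)
  also have "v \<bullet> ev M (Cod C u) (Dom C v) \<bullet> (k \<star> \<one> (Cod C u)) \<bullet> (\<one> (Dom C k) \<star> u)
    = v \<bullet> uncurry (Cod C u) (Dom C v) k \<bullet> (\<one> (Dom C k) \<star> u)"
    using assms by (simp add: uncurry_def)
  finally show ?thesis .
qed

text \<open>Maps out of \<open>A \<otimes> Z\<close> are maps from \<open>A\<close> to an internal hom, where the given family can be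
  cancelled. The other side follows by symmetry.\<close>

lemma joint_epi_tens_right:
  assumes S: "joint_epi A S" and Z: "Z \<in> Obj C"
  shows "joint_epi (A \<star>\<^sub>o Z) ((\<lambda>m. m \<star> \<one> Z) ` S)"
  unfolding joint_epi_def
proof (intro conjI ballI allI impI)
  have A: "A \<in> Obj C" using S by (simp add: joint_epi_def)
  then show "A \<star>\<^sub>o Z \<in> Obj C" using Z by simp
  have m: "m \<in> Mor C" "Cod C m = A" if "m \<in> S" for m using S that by (auto simp: joint_epi_def)
  then show "x \<in> Mor C" "Cod C x = A \<star>\<^sub>o Z" if "x \<in> (\<lambda>m. m \<star> \<one> Z) ` S" for x
    using that Z by auto
  fix W k k'
  assume k: "k \<in> hom C (A \<star>\<^sub>o Z) W" "k' \<in> hom C (A \<star>\<^sub>o Z) W"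
    and eq: "\<forall>x \<in> (\<lambda>m. m \<star> \<one> Z) ` S. k \<bullet> x = k' \<bullet> x"
  have W: "W \<in> Obj C" using k by (auto simp: hom_def)
  obtain l where l: "l \<in> Mor C" "Dom C l = A" "Cod C l = ihom M Z W" "uncurry Z W l = k"
    using k A Z curry_exists[of A Z k W] by (auto simp: hom_def)
  obtain l' where l': "l' \<in> Mor C" "Dom C l' = A" "Cod C l' = ihom M Z W" "uncurry Z W l' = k'"
    using k A Z curry_exists[of A Z k' W] by (auto simp: hom_def)
  have "l = l'"
  proof (rule joint_epiD[OF S])
    fix x assume x: "x \<in> S"
    show "l \<bullet> x = l' \<bullet> x"
    proof (rule uncurry_inject)
      have "k \<bullet> (x \<star> \<one> Z) = k' \<bullet> (x \<star> \<one> Z)" using eq x by blast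
      then show "uncurry Z W (l \<bullet> x) = uncurry Z W (l' \<bullet> x)"
        using l l' m[OF x] Z W by (simp add: uncurry_comp)
    qed (use l l' m[OF x] Z W in auto)
  qed (use l l' in auto)
  then show "k = k'" using l l' by simp
qed

lemma joint_epi_tens_left:
  assumes S: "joint_epi A S" and Z: "Z \<in> Obj C"
  shows "joint_epi (Z \<star>\<^sub>o A) ((\<lambda>m. \<one> Z \<star> m) ` S)"
  unfolding joint_epi_def
proof (intro conjI ballI allI impI)
  have A: "A \<in> Obj C" using S by (simp add: joint_epi_def)
  then show "Z \<star>\<^sub>o A \<in> Obj C" using Z by simp
  have m: "m \<in> Mor C" "Cod C m = A" if "m \<in> S" for m using S that by (auto simp: joint_epi_def)
  then show "x \<in> Mor C" "Cod C x = Z \<star>\<^sub>o A" if "x \<in> (\<lambda>m. \<one> Z \<star> m) ` S" for x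
    using that Z by auto
  fix W k k'
  assume k: "k \<in> hom C (Z \<star>\<^sub>o A) W" "k' \<in> hom C (Z \<star>\<^sub>o A) W"
    and eq: "\<forall>x \<in> (\<lambda>m. \<one> Z \<star> m) ` S. k \<bullet> x = k' \<bullet> x"
  have "k \<bullet> symm M A Z = k' \<bullet> symm M A Z"
  proof (rule joint_epiD[OF joint_epi_tens_right[OF S Z]])
    fix y assume "y \<in> (\<lambda>m. m \<star> \<one> Z) ` S"
    then obtain x where x: "x \<in> S" "y = x \<star> \<one> Z" by blast
    have n: "symm M A Z \<bullet> y = (\<one> Z \<star> x) \<bullet> symm M (Dom C x) Z"
      unfolding x(2) using m[OF x(1)] Z by (intro symm_nat) auto
    have "k \<bullet> (\<one> Z \<star> x) = k' \<bullet> (\<one> Z \<star> x)" using eq x by blast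
    then have "(k \<bullet> (\<one> Z \<star> x)) \<bullet> symm M (Dom C x) Z = (k' \<bullet> (\<one> Z \<star> x)) \<bullet> symm M (Dom C x) Z"
      by simp
    then show "(k \<bullet> symm M A Z) \<bullet> y = (k' \<bullet> symm M A Z) \<bullet> y"
      using k m[OF x(1)] x(2) A Z n by (simp add: hom_def)
  qed (use k A Z in \<open>auto simp: hom_def\<close>)
  then have "(k \<bullet> symm M A Z) \<bullet> symm M Z A = (k' \<bullet> symm M A Z) \<bullet> symm M Z A" by simp
  then show "k = k'" using k A Z by (simp add: hom_def)
qed

text \<open>The functor \<open>- \<otimes> Z\<close> is a left adjoint: cocones are curried, the induced map is uncurried.\<close>

lemma pushout_tens_right:
  assumes "is_pushout C f g (P, i, j)" and Z: "Z \<in> Obj C"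
  shows "is_pushout C (f \<star> \<one> Z) (g \<star> \<one> Z) (P \<star>\<^sub>o Z, i \<star> \<one> Z, j \<star> \<one> Z)"
proof -
  have ij: "f \<in> Mor C" "g \<in> Mor C" "Dom C f = Dom C g" "i \<in> Mor C" "Dom C i = Cod C f" "Cod C i = P"
    "j \<in> Mor C" "Dom C j = Cod C g" "Cod C j = P" "i \<bullet> f = j \<bullet> g"
    using assms(1) by (auto simp: hom_def)
  have P: "P \<in> Obj C" using ij vertex_in_Obj by blast
  have je: "joint_epi (P \<star>\<^sub>o Z) ((\<lambda>m. m \<star> \<one> Z) ` {i, j})"
    by (intro joint_epi_tens_right pushout_joint_epi[OF assms(1)] Z)
  show ?thesis
    unfolding is_pushout.simps
  proof (intro conjI allI ballI impI)
    show "(i \<star> \<one> Z) \<bullet> (f \<star> \<one> Z) = (j \<star> \<one> Z) \<bullet> (g \<star> \<one> Z)"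
      using ij Z by (simp add: interchange)
  next
    fix W u v
    assume u: "u \<in> hom C (Cod C (f \<star> \<one> Z)) W" and v: "v \<in> hom C (Cod C (g \<star> \<one> Z)) W"
      and uv: "u \<bullet> (f \<star> \<one> Z) = v \<bullet> (g \<star> \<one> Z)"
    have W: "W \<in> Obj C" using u by (auto simp: hom_def)
    obtain a where a: "a \<in> Mor C" "Dom C a = Cod C f" "Cod C a = ihom M Z W" "uncurry Z W a = u"
      using u ij Z curry_exists[of "Cod C f" Z u W] by (auto simp: hom_def)
    obtain b where b: "b \<in> Mor C" "Dom C b = Cod C g" "Cod C b = ihom M Z W" "uncurry Z W b = v"
      using v ij Z curry_exists[of "Cod C g" Z v W] by (auto simp: hom_def)
    have "a \<bullet> f = b \<bullet> g"
      by (rule uncurry_inject) (use a b ij Z W uv in \<open>auto simp: uncurry_comp\<close>)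
    then have "\<exists>!h. h \<in> hom C P (ihom M Z W) \<and> h \<bullet> i = a \<and> h \<bullet> j = b"
      using a b by (intro pushout_universal[OF assms(1)])
    then obtain h where h: "h \<in> Mor C" "Dom C h = P" "Cod C h = ihom M Z W" "h \<bullet> i = a" "h \<bullet> j = b"
      unfolding hom_def by blast
    show "\<exists>!h. h \<in> hom C (P \<star>\<^sub>o Z) W \<and> h \<bullet> (i \<star> \<one> Z) = u \<and> h \<bullet> (j \<star> \<one> Z) = v"
    proof (rule ex1I)
      show *: "uncurry Z W h \<in> hom C (P \<star>\<^sub>o Z) W \<and> uncurry Z W h \<bullet> (i \<star> \<one> Z) = u \<and>
          uncurry Z W h \<bullet> (j \<star> \<one> Z) = v"
        using h(1-3) ij(4-9) Z W
        by (simp add: hom_def uncurry_comp[symmetric] h(4,5) a(4) b(4))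
      fix k assume k: "k \<in> hom C (P \<star>\<^sub>o Z) W \<and> k \<bullet> (i \<star> \<one> Z) = u \<and> k \<bullet> (j \<star> \<one> Z) = v"
      show "k = uncurry Z W h"
      proof (rule joint_epiD[OF je])
        show "k \<bullet> m = uncurry Z W h \<bullet> m" if "m \<in> (\<lambda>m. m \<star> \<one> Z) ` {i, j}" for m
          using that k * by auto
        show "k \<in> Mor C" "uncurry Z W h \<in> Mor C" "Dom C k = P \<star>\<^sub>o Z"
          "Dom C (uncurry Z W h) = P \<star>\<^sub>o Z" "Cod C k = Cod C (uncurry Z W h)"
          using k * by (simp_all add: hom_def)
      qed
    qed
  qed (use ij Z in \<open>simp_all add: hom_def\<close>)
qed

end

section \<open>Representing the squares between two arrows\<close>

text \<open>Bicompleteness enters the construction through these three kinds of finite limits and colimits.\<close>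

locale csm_with_squares = closed_symmetric_monoidal C M
  for C :: "('o, 'm) category" and M :: "('o, 'm) csm_structure" +
  assumes ex_initial: "\<exists>Z. is_initial C Z"
    and ex_pushout: "\<lbrakk>f \<in> Mor C; g \<in> Mor C; Dom C f = Dom C g\<rbrakk> \<Longrightarrow> \<exists>t. is_pushout C f g t"
    and ex_pullback: "\<lbrakk>f \<in> Mor C; g \<in> Mor C; Cod C f = Cod C g\<rbrakk> \<Longrightarrow> \<exists>t. is_pullback C f g t"
begin

sublocale Arr: category "Arr C"
  by (rule category_Arr)

abbreviation vtx where "vtx \<equiv> vertex C"
abbreviation edg where "edg \<equiv> edge C"
abbreviation square_comp (infixr "\<odot>" 75) where "t \<odot> s \<equiv> t \<cdot>\<^bsub>Arr C\<^esub> s"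
abbreviation square_one ("\<one>\<^sub>A") where "\<one>\<^sub>A \<equiv> Ident (Arr C)"

text \<open>The universal square from \<open>P \<otimes> f\<close> to \<open>g\<close>, where \<open>P\<close> is the pullback \<open>square_obj f g\<close>: its sides are
  the projections of \<open>P\<close>, uncurried.\<close>

definition eval0 :: "'m \<Rightarrow> 'm \<Rightarrow> 'm" where
  "eval0 f g = uncurry (Dom C f) (Dom C g) (fst (snd (hom_pullback C M f g)))"

definition eval1 :: "'m \<Rightarrow> 'm \<Rightarrow> 'm" where
  "eval1 f g = uncurry (Cod C f) (Cod C g) (hom_tensor C M f g)"

definition square_obj :: "'m \<Rightarrow> 'm \<Rightarrow> 'o" where
  "square_obj f g = fst (hom_pullback C M f g)"

lemma hom_pullback:
  assumes "f \<in> Mor C" "g \<in> Mor C"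
  shows "is_pullback C (ihom_mor C M (\<one> (Dom C f)) g) (ihom_mor C M f (\<one> (Cod C g)))
     (square_obj f g, fst (snd (hom_pullback C M f g)), hom_tensor C M f g)"
proof -
  have "\<exists>t. is_pullback C (ihom_mor C M (\<one> (Dom C f)) g) (ihom_mor C M f (\<one> (Cod C g))) t"
    using assms by (intro ex_pullback) (simp_all add: ihom_mor)
  from someI_ex[OF this] have "is_pullback C (ihom_mor C M (\<one> (Dom C f)) g)
      (ihom_mor C M f (\<one> (Cod C g))) (hom_pullback C M f g)"
    unfolding hom_pullback_def pullback_def .
  then show ?thesis
    by (cases "hom_pullback C M f g") (simp add: hom_tensor_def square_obj_def)
qed

lemma hom_pullback_simps:
  assumes "f \<in> Mor C" "g \<in> Mor C"
  shows "fst (snd (hom_pullback C M f g)) \<in> Mor C"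
    "Dom C (fst (snd (hom_pullback C M f g))) = square_obj f g"
    "Cod C (fst (snd (hom_pullback C M f g))) = ihom M (Dom C f) (Dom C g)"
    "hom_tensor C M f g \<in> Mor C"
    "Dom C (hom_tensor C M f g) = square_obj f g"
    "Cod C (hom_tensor C M f g) = ihom M (Cod C f) (Cod C g)"
    "square_obj f g \<in> Obj C"
proof -
  show *: "fst (snd (hom_pullback C M f g)) \<in> Mor C"
    "Dom C (fst (snd (hom_pullback C M f g))) = square_obj f g"
    "Cod C (fst (snd (hom_pullback C M f g))) = ihom M (Dom C f) (Dom C g)"
    "hom_tensor C M f g \<in> Mor C"
    "Dom C (hom_tensor C M f g) = square_obj f g"
    "Cod C (hom_tensor C M f g) = ihom M (Cod C f) (Cod C g)"
    using hom_pullback[OF assms] assms by (simp_all add: hom_def ihom_mor)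
  show "square_obj f g \<in> Obj C" using vertex_in_Obj(1)[OF *(1)] *(2) by simp
qed

declare hom_pullback_simps(4-7) [simp]

lemma eval_simps [simp]:
  assumes "f \<in> Mor C" "g \<in> Mor C"
  shows "eval0 f g \<in> Mor C" "Dom C (eval0 f g) = square_obj f g \<star>\<^sub>o Dom C f"
    "Cod C (eval0 f g) = Dom C g"
    "eval1 f g \<in> Mor C" "Dom C (eval1 f g) = square_obj f g \<star>\<^sub>o Cod C f"
    "Cod C (eval1 f g) = Cod C g"
  using assms by (simp_all add: eval0_def eval1_def hom_pullback_simps)

text \<open>The pullback condition on two maps into internal homs, translated by the adjunction, says that
  the uncurried maps form a square.\<close>

lemma compatible_iff:
  assumes "f \<in> Mor C" "g \<in> Mor C"
    and "u \<in> Mor C" "Dom C u = W" "Cod C u = ihom M (Dom C f) (Dom C g)"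
    and "v \<in> Mor C" "Dom C v = W" "Cod C v = ihom M (Cod C f) (Cod C g)"
  shows "ihom_mor C M (\<one> (Dom C f)) g \<bullet> u = ihom_mor C M f (\<one> (Cod C g)) \<bullet> v \<longleftrightarrow>
    g \<bullet> uncurry (Dom C f) (Dom C g) u = uncurry (Cod C f) (Cod C g) v \<bullet> (\<one> W \<star> f)"
    (is "?L = ?R \<longleftrightarrow> _")
proof -
  have W: "W \<in> Obj C" using vertex_in_Obj(1)[OF assms(3)] assms(4) by simp
  have u: "uncurry (Dom C f) (Cod C g) ?L = g \<bullet> uncurry (Dom C f) (Dom C g) u"
    using uncurry_ihom_mor_comp[of "\<one> (Dom C f)" g u] assms W by simp
  have v: "uncurry (Dom C f) (Cod C g) ?R = uncurry (Cod C f) (Cod C g) v \<bullet> (\<one> W \<star> f)"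
    using uncurry_ihom_mor_comp[of f "\<one> (Cod C g)" v] assms W by simp
  show ?thesis
    unfolding u[symmetric] v[symmetric]
  proof
    assume "uncurry (Dom C f) (Cod C g) ?L = uncurry (Dom C f) (Cod C g) ?R"
    then show "?L = ?R" by (rule uncurry_inject) (use assms in \<open>simp_all add: ihom_mor\<close>)
  qed simp
qed

lemma eval_square:
  assumes "f \<in> Mor C" "g \<in> Mor C"
  shows "g \<bullet> eval0 f g = eval1 f g \<bullet> (\<one> (square_obj f g) \<star> f)"
  unfolding eval0_def eval1_def
  using compatible_iff[of f g "fst (snd (hom_pullback C M f g))" "square_obj f g" "hom_tensor C M f g"]
    hom_pullback[OF assms] hom_pullback_simps[OF assms] assms by simp

text \<open>The universal property of the pullback in uncurried form: \<open>square_obj f g\<close> represents the functor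
  that sends \<open>W\<close> to the set of squares from \<open>W \<otimes> f\<close> to \<open>g\<close>. Both internal homs rest on
  it.\<close>

lemma ex1_into_square_obj:
  assumes f: "f \<in> Mor C" and g: "g \<in> Mor C" and W: "W \<in> Obj C"
    and a: "a \<in> Mor C" "Dom C a = W \<star>\<^sub>o Dom C f" "Cod C a = Dom C g"
    and b: "b \<in> Mor C" "Dom C b = W \<star>\<^sub>o Cod C f" "Cod C b = Cod C g"
    and ab: "g \<bullet> a = b \<bullet> (\<one> W \<star> f)"
  shows "\<exists>!h. h \<in> hom C W (square_obj f g) \<and>
    eval0 f g \<bullet> (h \<star> \<one> (Dom C f)) = a \<and> eval1 f g \<bullet> (h \<star> \<one> (Cod C f)) = b"
proof -
  let ?p = "fst (snd (hom_pullback C M f g))" and ?q = "hom_tensor C M f g"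
  note [simp] = hom_pullback_simps(1-3)
  obtain u where u: "u \<in> Mor C" "Dom C u = W" "Cod C u = ihom M (Dom C f) (Dom C g)"
    "uncurry (Dom C f) (Dom C g) u = a"
    using curry_exists[of W "Dom C f" a] f W a by auto
  obtain v where v: "v \<in> Mor C" "Dom C v = W" "Cod C v = ihom M (Cod C f) (Cod C g)"
    "uncurry (Cod C f) (Cod C g) v = b"
    using curry_exists[of W "Cod C f" b] f W b by auto
  have "ihom_mor C M (\<one> (Dom C f)) g \<bullet> u = ihom_mor C M f (\<one> (Cod C g)) \<bullet> v"
    using compatible_iff[of f g u W v] f g u v ab by simp
  then have "\<exists>!h. h \<in> hom C W (square_obj f g) \<and> ?p \<bullet> h = u \<and> ?q \<bullet> h = v"
    using f g u v by (intro pullback_universal[OF hom_pullback]) (simp_all add: ihom_mor)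
  moreover have "(h \<in> hom C W (square_obj f g) \<and> ?p \<bullet> h = u \<and> ?q \<bullet> h = v) \<longleftrightarrow>
     (h \<in> hom C W (square_obj f g) \<and>
    eval0 f g \<bullet> (h \<star> \<one> (Dom C f)) = a \<and> eval1 f g \<bullet> (h \<star> \<one> (Cod C f)) = b)" for h
  proof (intro conj_cong refl)
    assume h: "h \<in> hom C W (square_obj f g)"
    have "eval0 f g \<bullet> (h \<star> \<one> (Dom C f)) = uncurry (Dom C f) (Dom C g) (?p \<bullet> h)"
      using f g h unfolding eval0_def by (subst uncurry_comp) (auto simp: hom_def)
    moreover have "?p \<bullet> h = u" if "uncurry (Dom C f) (Dom C g) (?p \<bullet> h) = uncurry (Dom C f) (Dom C g) u"
      using that by (rule uncurry_inject) (use f g u h in \<open>auto simp: hom_def\<close>)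
    ultimately show "?p \<bullet> h = u \<longleftrightarrow> eval0 f g \<bullet> (h \<star> \<one> (Dom C f)) = a"
      using u(4) by metis
    have "eval1 f g \<bullet> (h \<star> \<one> (Cod C f)) = uncurry (Cod C f) (Cod C g) (?q \<bullet> h)"
      using f g h unfolding eval1_def by (subst uncurry_comp) (auto simp: hom_def)
    moreover have "?q \<bullet> h = v" if "uncurry (Cod C f) (Cod C g) (?q \<bullet> h) = uncurry (Cod C f) (Cod C g) v"
      using that by (rule uncurry_inject) (use f g v h in \<open>auto simp: hom_def\<close>)
    ultimately show "?q \<bullet> h = v \<longleftrightarrow> eval1 f g \<bullet> (h \<star> \<one> (Cod C f)) = b"
      using v(4) by metis
  qed
  ultimately show ?thesis by (simp only:)
qed

lemma into_square_obj_eqI: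
  assumes f: "f \<in> Mor C" and g: "g \<in> Mor C"
    and h: "h \<in> hom C W (square_obj f g)" and h': "h' \<in> hom C W (square_obj f g)"
    and e0: "eval0 f g \<bullet> (h \<star> \<one> (Dom C f)) = eval0 f g \<bullet> (h' \<star> \<one> (Dom C f))"
    and e1: "eval1 f g \<bullet> (h \<star> \<one> (Cod C f)) = eval1 f g \<bullet> (h' \<star> \<one> (Cod C f))"
  shows "h = h'"
proof -
  have hm: "h \<in> Mor C" "Dom C h = W" "Cod C h = square_obj f g"
    and hm': "h' \<in> Mor C" "Dom C h' = W" "Cod C h' = square_obj f g" using h h' by (auto simp: hom_def)
  have W: "W \<in> Obj C" using hm by auto
  have "g \<bullet> eval0 f g \<bullet> (h \<star> \<one> (Dom C f)) = (g \<bullet> eval0 f g) \<bullet> (h \<star> \<one> (Dom C f))"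
    using f g hm by simp
  also have "\<dots> = (eval1 f g \<bullet> (h \<star> \<one> (Cod C f))) \<bullet> (\<one> W \<star> f)"
    using f g hm W by (simp add: eval_square interchange)
  finally have "\<exists>!k. k \<in> hom C W (square_obj f g) \<and> eval0 f g \<bullet> (k \<star> \<one> (Dom C f)) = eval0 f g \<bullet> (h \<star> \<one> (Dom C f))
      \<and> eval1 f g \<bullet> (k \<star> \<one> (Cod C f)) = eval1 f g \<bullet> (h \<star> \<one> (Cod C f))"
    using f g W hm by (intro ex1_into_square_obj) simp_all
  then show ?thesis using h h' e0 e1 by metis
qed

section \<open>The tensor product structure\<close>

lemma vertex_one [simp]: "X \<in> Obj C \<Longrightarrow> vtx (\<one> X) e = X"
  by (simp add: vertex_def)

lemma vertex_tens [simp]: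
  "f \<in> Mor C \<Longrightarrow> g \<in> Mor C \<Longrightarrow> vtx (f \<star> g) e = vtx f e \<star>\<^sub>o vtx g e"
  by (simp add: vertex_def)

text \<open>The evaluation is \<open>eval0\<close> at the vertex \<open>0\<close>. At \<open>1\<close> it is the evaluation of \<open>C\<close>, since the
  codomain of \<open>hom_tensor\<close> is itself an internal hom.\<close>

definition arrow_tensor :: "('m, 'm square) csm_structure" where
  "arrow_tensor =
     \<lparr> tensor_obj = (\<lambda>f g. f \<star> g),
       tensor_mor = tensor_square M,
       unit_obj = L0 C \<I>,
       assoc = (\<lambda>f g h. Square ((f \<star> g) \<star> h) (f \<star> (g \<star> h))
         (assoc M (Dom C f) (Dom C g) (Dom C h)) (assoc M (Cod C f) (Cod C g) (Cod C h))),
       lunit = (\<lambda>f. Square (\<one> \<I> \<star> f) f (lunit M (Dom C f)) (lunit M (Cod C f))),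
       runit = (\<lambda>f. Square (f \<star> \<one> \<I>) f (runit M (Dom C f)) (runit M (Cod C f))),
       symm = (\<lambda>f g. Square (f \<star> g) (g \<star> f)
         (symm M (Dom C f) (Dom C g)) (symm M (Cod C f) (Cod C g))),
       ihom = hom_tensor C M,
       ev = (\<lambda>f g. Square (hom_tensor C M f g \<star> f) g (eval0 f g) (ev M (Cod C f) (Cod C g))) \<rparr>"

lemma arrow_tensor_simps [simp]:
  "tensor_obj arrow_tensor f g = f \<star> g"
  "tensor_mor arrow_tensor s t = tensor_square M s t"
  "unit_obj arrow_tensor = \<one> \<I>"
  "ihom arrow_tensor f g = hom_tensor C M f g"
  by (simp_all add: arrow_tensor_def L0_def)

lemma component_tensor_square [simp]:
  "component (tensor_square M s t) e = component s e \<star> component t e"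
  "sq_dom (tensor_square M s t) = sq_dom s \<star> sq_dom t"
  "sq_cod (tensor_square M s t) = sq_cod s \<star> sq_cod t"
  by (simp_all add: tensor_square_def component_def)

lemma component_arrow_tensor [simp]:
  "component (assoc arrow_tensor f g h) e = assoc M (vtx f e) (vtx g e) (vtx h e)"
  "component (lunit arrow_tensor f) e = lunit M (vtx f e)"
  "component (runit arrow_tensor f) e = runit M (vtx f e)"
  "component (symm arrow_tensor f g) e = symm M (vtx f e) (vtx g e)"
  "sq_dom (assoc arrow_tensor f g h) = (f \<star> g) \<star> h"
  "sq_cod (assoc arrow_tensor f g h) = f \<star> (g \<star> h)"
  "sq_dom (lunit arrow_tensor f) = \<one> \<I> \<star> f" "sq_cod (lunit arrow_tensor f) = f"
  "sq_dom (runit arrow_tensor f) = f \<star> \<one> \<I>" "sq_cod (runit arrow_tensor f) = f"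
  "sq_dom (symm arrow_tensor f g) = f \<star> g" "sq_cod (symm arrow_tensor f g) = g \<star> f"
  by (simp_all add: arrow_tensor_def vertex_def)

lemma tensor_square_in_hom:
  assumes s: "s \<in> Mor (Arr C)" and t: "t \<in> Mor (Arr C)"
  shows "tensor_square M s t \<in> hom (Arr C) (sq_dom s \<star> sq_dom t) (sq_cod s \<star> sq_cod t)"
  using assms square_commutes[OF s, of True] square_commutes[OF t, of True]
  by (intro Arr_homI) (simp_all add: interchange)

lemma tensor_square_Mor [simp]:
  "s \<in> Mor (Arr C) \<Longrightarrow> t \<in> Mor (Arr C) \<Longrightarrow> tensor_square M s t \<in> Mor (Arr C)"
  using tensor_square_in_hom by (auto simp: hom_def)

lemma arrow_tensor_structure_maps:
  assumes "f \<in> Mor C"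
  shows "g \<in> Mor C \<Longrightarrow> h \<in> Mor C \<Longrightarrow>
      assoc arrow_tensor f g h \<in> hom (Arr C) ((f \<star> g) \<star> h) (f \<star> (g \<star> h))"
    "lunit arrow_tensor f \<in> hom (Arr C) (\<one> \<I> \<star> f) f"
    "runit arrow_tensor f \<in> hom (Arr C) (f \<star> \<one> \<I>) f"
    "g \<in> Mor C \<Longrightarrow> symm arrow_tensor f g \<in> hom (Arr C) (f \<star> g) (g \<star> f)"
  using assms
  by (auto intro!: Arr_homI simp: assoc_nat lunit_nat runit_nat symm_nat)

lemmas arrow_tensor_structure_Mor [simp] = arrow_tensor_structure_maps[THEN Arr_homD(1)]

text \<open>Two squares with the same ends agree if they agree at both vertices, and at a vertex each axiom
  is the corresponding axiom of \<open>C\<close>.\<close>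

lemma symmetric_monoidal_arrow_tensor: "symmetric_monoidal (Arr C) arrow_tensor"
proof (unfold_locales, goal_cases)
  case 1
  show ?case
    by (rule bifunctorI)
      (simp_all add: tensor_square_in_hom, (rule square_eqI, simp_all add: interchange)+)
qed (auto intro!: arrow_tensor_structure_maps is_iso_Arr square_eqI
   simp: hom_def assoc_nat lunit_nat runit_nat symm_nat pentagon triangle hexagon)

lemma eval1_eq: "f \<in> Mor C \<Longrightarrow> g \<in> Mor C \<Longrightarrow>
    eval1 f g = ev M (Cod C f) (Cod C g) \<bullet> (hom_tensor C M f g \<star> \<one> (Cod C f))"
  by (simp add: eval1_def uncurry_def)

lemma ev_arrow_tensor [simp]:
  "component (ev arrow_tensor f g) e = (if e then ev M (Cod C f) (Cod C g) else eval0 f g)"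
  "sq_dom (ev arrow_tensor f g) = hom_tensor C M f g \<star> f" "sq_cod (ev arrow_tensor f g) = g"
  by (simp_all add: arrow_tensor_def)

lemma ev_arrow_tensor_in_hom:
  assumes "f \<in> Mor C" "g \<in> Mor C"
  shows "ev arrow_tensor f g \<in> hom (Arr C) (hom_tensor C M f g \<star> f) g"
proof (rule Arr_homI)
  show "g \<bullet> component (ev arrow_tensor f g) False
      = component (ev arrow_tensor f g) True \<bullet> (hom_tensor C M f g \<star> f)"
    using assms by (simp add: eval_square eval1_eq interchange)
qed (use assms in \<open>simp_all add: vertex_def\<close>)

text \<open>At \<open>1\<close> the component of the required square has to be the curried component of \<open>s\<close>.
  Commutativity then prescribes the second coordinate, in the pullback, of the component at \<open>0\<close>,
  and evaluation prescribes the first.\<close>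

lemma arrow_tensor_closed:
  assumes k: "k \<in> Mor C" and f: "f \<in> Mor C" and g: "g \<in> Mor C"
    and s: "s \<in> hom (Arr C) (k \<star> f) g"
  shows "\<exists>!t. t \<in> hom (Arr C) k (hom_tensor C M f g) \<and>
    ev arrow_tensor f g \<odot> tensor_square M t (\<one>\<^sub>A f) = s"
proof -
  let ?h = "hom_tensor C M f g"
  define s0 where "s0 = component s False"
  define s1 where "s1 = component s True"
  note sD = Arr_homD[OF s]
  have s0: "s0 \<in> Mor C" "Dom C s0 = Dom C k \<star>\<^sub>o Dom C f" "Cod C s0 = Dom C g"
    and s1: "s1 \<in> Mor C" "Dom C s1 = Cod C k \<star>\<^sub>o Cod C f" "Cod C s1 = Cod C g"
    using sD k f by (simp_all add: s0_def s1_def)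
  have sq: "g \<bullet> s0 = s1 \<bullet> (k \<star> f)"
    using square_commutes[OF sD(1), of True] sD by (simp add: s0_def s1_def)
  have ex0: "\<exists>!a. a \<in> hom C (Dom C k) (square_obj f g) \<and>
      eval0 f g \<bullet> (a \<star> \<one> (Dom C f)) = s0 \<and> eval1 f g \<bullet> (a \<star> \<one> (Cod C f)) = s1 \<bullet> (k \<star> \<one> (Cod C f))"
    using k f g s0 s1 sq by (intro ex1_into_square_obj) (simp_all add: interchange)
  have ex1: "\<exists>!b. b \<in> hom C (Cod C k) (ihom M (Cod C f) (Cod C g)) \<and> uncurry (Cod C f) (Cod C g) b = s1"
    using ex1_uncurry[of "Cod C k" "Cod C f" s1] k f s1 by simp
  \<comment> \<open>The square condition and the prescription for the second coordinate of \<open>a\<close> are the same.\<close>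
  have square_iff: "?h \<bullet> a = b \<bullet> k \<longleftrightarrow> eval1 f g \<bullet> (a \<star> \<one> (Cod C f)) = s1 \<bullet> (k \<star> \<one> (Cod C f))"
    if a: "a \<in> hom C (Dom C k) (square_obj f g)"
      and b: "b \<in> hom C (Cod C k) (ihom M (Cod C f) (Cod C g))" "uncurry (Cod C f) (Cod C g) b = s1"
    for a b
  proof -
    have "uncurry (Cod C f) (Cod C g) (?h \<bullet> a) = eval1 f g \<bullet> (a \<star> \<one> (Cod C f))"
      using a f g unfolding eval1_def by (subst uncurry_comp) (auto simp: hom_def)
    moreover have "uncurry (Cod C f) (Cod C g) (b \<bullet> k) = s1 \<bullet> (k \<star> \<one> (Cod C f))"
      using b k f g by (subst uncurry_comp) (auto simp: hom_def)
    moreover have "?h \<bullet> a = b \<bullet> k"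
      if "uncurry (Cod C f) (Cod C g) (?h \<bullet> a) = uncurry (Cod C f) (Cod C g) (b \<bullet> k)"
      using that by (rule uncurry_inject) (use a b k f g in \<open>auto simp: hom_def\<close>)
    ultimately show ?thesis by metis
  qed
  have ev_iff: "ev arrow_tensor f g \<odot> tensor_square M t (\<one>\<^sub>A f) = s \<longleftrightarrow>
      eval0 f g \<bullet> (component t False \<star> \<one> (Dom C f)) = s0 \<and>
      uncurry (Cod C f) (Cod C g) (component t True) = s1"
    if t: "t \<in> hom (Arr C) k ?h" for t
  proof -
    let ?r = "ev arrow_tensor f g \<odot> tensor_square M t (\<one>\<^sub>A f)"
    have r: "sq_dom ?r = sq_dom s" "sq_cod ?r = sq_cod s"
      using Arr_homD[OF t] sD by simp_all
    have "component ?r False = eval0 f g \<bullet> (component t False \<star> \<one> (Dom C f))"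
      "component ?r True = uncurry (Cod C f) (Cod C g) (component t True)"
      by (simp_all add: uncurry_def)
    moreover have "?r = s \<longleftrightarrow> component ?r False = s0 \<and> component ?r True = s1"
      unfolding s0_def s1_def by (simp only: square_eq_iff r simp_thms)
    ultimately show ?thesis by simp
  qed
  obtain a where a: "a \<in> hom C (Dom C k) (square_obj f g)"
    "eval0 f g \<bullet> (a \<star> \<one> (Dom C f)) = s0" "eval1 f g \<bullet> (a \<star> \<one> (Cod C f)) = s1 \<bullet> (k \<star> \<one> (Cod C f))"
    using ex0 by blast
  obtain b where b: "b \<in> hom C (Cod C k) (ihom M (Cod C f) (Cod C g))" "uncurry (Cod C f) (Cod C g) b = s1"
    using ex1 by blast
  show ?thesis
  proof (rule ex1I)
    have "Square k ?h a b \<in> hom (Arr C) k ?h"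
      using a b k f g square_iff[OF a(1) b] by (intro Arr_homI) (auto simp: hom_def vertex_def)
    then show "Square k ?h a b \<in> hom (Arr C) k ?h \<and>
        ev arrow_tensor f g \<odot> tensor_square M (Square k ?h a b) (\<one>\<^sub>A f) = s"
      using ev_iff a b by simp
  next
    fix t assume *: "t \<in> hom (Arr C) k ?h \<and>
      ev arrow_tensor f g \<odot> tensor_square M t (\<one>\<^sub>A f) = s"
    then have t: "t \<in> hom (Arr C) k ?h" by simp
    note tD = Arr_homD[OF t]
    have c: "component t False \<in> hom C (Dom C k) (square_obj f g)"
      "component t True \<in> hom C (Cod C k) (ihom M (Cod C f) (Cod C g))"
      using tD f g by (simp_all add: hom_def)
    have e: "eval0 f g \<bullet> (component t False \<star> \<one> (Dom C f)) = s0"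
      "uncurry (Cod C f) (Cod C g) (component t True) = s1"
      using * ev_iff[OF t] by simp_all
    have "?h \<bullet> component t False = component t True \<bullet> k"
      using square_commutes[OF tD(1), of True] tD by simp
    then have "component t False = a"
      using ex0 a c(1) e(1) square_iff[OF c e(2)] by blast
    moreover have "component t True = b" using ex1 b c(2) e(2) by blast
    ultimately show "t = Square k ?h a b"
      using tD by (cases t) (simp add: component_def)
  qed
qed

lemma closed_symmetric_monoidal_arrow_tensor: "closed_symmetric_monoidal (Arr C) arrow_tensor"
proof -
  interpret T: symmetric_monoidal "Arr C" arrow_tensor
    by (rule symmetric_monoidal_arrow_tensor)
  show ?thesis
    by unfold_locales (use ev_arrow_tensor_in_hom arrow_tensor_closed in simp_all)
qed

section \<open>The pushout product and its universal property\<close>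

lemma box_pushout:
  assumes "f \<in> Mor C" "g \<in> Mor C"
  shows "is_pushout C (\<one> (Dom C f) \<star> g) (f \<star> \<one> (Dom C g)) (box_pushout C M f g)"
proof -
  have "\<exists>t. is_pushout C (\<one> (Dom C f) \<star> g) (f \<star> \<one> (Dom C g)) t"
    using assms by (intro ex_pushout) simp_all
  from someI_ex[OF this] show ?thesis unfolding box_pushout_def pushout_def .
qed

text \<open>The value at \<open>(a, b)\<close> of the universal family from \<open>f(a) \<otimes> g(b)\<close> to \<open>(f \<box> g)(a \<and> b)\<close>. The corners
  \<open>(0,1)\<close> and \<open>(1,0)\<close> are the coprojections of the pushout, and \<open>(0,0)\<close> is their common restriction. Including
  it makes the later computations independent of the truth values.\<close>

definition corner :: "'m \<Rightarrow> 'm \<Rightarrow> bool \<Rightarrow> bool \<Rightarrow> 'm" where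
  "corner f g a b = (case box_pushout C M f g of (P, i, j) \<Rightarrow>
     if a then if b then \<one> (Cod C f \<star>\<^sub>o Cod C g) else j
     else if b then i else i \<bullet> (\<one> (Dom C f) \<star> g))"

lemma box_facts:
  assumes f: "f \<in> Mor C" and g: "g \<in> Mor C"
  defines "P \<equiv> fst (box_pushout C M f g)"
  shows "is_pushout C (\<one> (Dom C f) \<star> g) (f \<star> \<one> (Dom C g)) (P, corner f g False True, corner f g True False)"
    and "box_pushout C M f g = (P, corner f g False True, corner f g True False)"
    and "box C M f g \<in> hom C P (Cod C f \<star>\<^sub>o Cod C g)"
    and "box C M f g \<bullet> corner f g False True = f \<star> \<one> (Cod C g)"
    and "box C M f g \<bullet> corner f g True False = \<one> (Cod C f) \<star> g"
proof -
  show e: "box_pushout C M f g = (P, corner f g False True, corner f g True False)"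
    by (cases "box_pushout C M f g") (simp add: corner_def P_def)
  then show p: "is_pushout C (\<one> (Dom C f) \<star> g) (f \<star> \<one> (Dom C g)) (P, corner f g False True, corner f g True False)"
    using box_pushout[OF f g] by simp
  have "box C M f g \<in> hom C P (Cod C f \<star>\<^sub>o Cod C g) \<and> box C M f g \<bullet> corner f g False True = f \<star> \<one> (Cod C g)
     \<and> box C M f g \<bullet> corner f g True False = \<one> (Cod C f) \<star> g"
    unfolding box_def e using f g by (intro from_pushout[OF p]) (simp_all add: interchange del: tens_ident)
  then show "box C M f g \<in> hom C P (Cod C f \<star>\<^sub>o Cod C g)"
    "box C M f g \<bullet> corner f g False True = f \<star> \<one> (Cod C g)"
    "box C M f g \<bullet> corner f g True False = \<one> (Cod C f) \<star> g" by blast+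
qed

lemma box_simps [simp]:
  assumes "f \<in> Mor C" "g \<in> Mor C"
  shows "box C M f g \<in> Mor C" "Cod C (box C M f g) = Cod C f \<star>\<^sub>o Cod C g"
  using box_facts(3)[OF assms] by (simp_all add: hom_def)

lemma box_pushout_corners:
  assumes "f \<in> Mor C" "g \<in> Mor C"
  shows "is_pushout C (\<one> (Dom C f) \<star> g) (f \<star> \<one> (Dom C g))
      (Dom C (box C M f g), corner f g False True, corner f g True False)"
    "box_pushout C M f g = (Dom C (box C M f g), corner f g False True, corner f g True False)"
  using box_facts[OF assms] by (simp_all add: hom_def)

lemma corner_True_True: "corner f g True True = \<one> (Cod C f \<star>\<^sub>o Cod C g)"
  by (simp add: corner_def split: prod.split)

lemma corner_False_False:
  "corner f g False False = corner f g False True \<bullet> (\<one> (Dom C f) \<star> g)"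
  by (simp add: corner_def split: prod.split)

lemma corner_simps [simp]:
  assumes "f \<in> Mor C" "g \<in> Mor C"
  shows "corner f g a b \<in> Mor C" "Dom C (corner f g a b) = vtx f a \<star>\<^sub>o vtx g b"
    "Cod C (corner f g a b) = vtx (box C M f g) (a \<and> b)"
proof -
  have "corner f g a b \<in> hom C (vtx f a \<star>\<^sub>o vtx g b) (vtx (box C M f g) (a \<and> b))"
    using box_pushout_corners(1)[OF assms] assms
    by (cases a; cases b) (auto simp: hom_def corner_True_True corner_False_False)
  then show "corner f g a b \<in> Mor C" "Dom C (corner f g a b) = vtx f a \<star>\<^sub>o vtx g b"
    "Cod C (corner f g a b) = vtx (box C M f g) (a \<and> b)" by (simp_all add: hom_def)
qed

text \<open>The natural transformations from \<open>f(a) \<otimes> g(b)\<close> to \<open>h(a \<and> b)\<close>; naturality is required in each variable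
  along \<open>0 \<rightarrow> 1\<close>.\<close>

definition bimorphism :: "'m \<Rightarrow> 'm \<Rightarrow> 'm \<Rightarrow> (bool \<Rightarrow> bool \<Rightarrow> 'm) \<Rightarrow> bool" where
  "bimorphism f g h k \<longleftrightarrow>
     (\<forall>a b. k a b \<in> hom C (vtx f a \<star>\<^sub>o vtx g b) (vtx h (a \<and> b))) \<and>
     (\<forall>b. k True b \<bullet> (f \<star> \<one> (vtx g b)) = edg h b \<bullet> k False b) \<and>
     (\<forall>a. k a True \<bullet> (\<one> (vtx f a) \<star> g) = edg h a \<bullet> k a False)"

lemma bimorphism_corner:
  assumes f: "f \<in> Mor C" and g: "g \<in> Mor C"
  shows "bimorphism f g (box C M f g) (corner f g)"
proof -
  have "corner f g True b \<bullet> (f \<star> \<one> (vtx g b)) = edg (box C M f g) b \<bullet> corner f g False b" for b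
    using box_pushout_corners(1)[OF f g] box_facts(4)[OF f g] f g
    by (cases b) (simp_all add: corner_True_True corner_False_False)
  moreover have "corner f g a True \<bullet> (\<one> (vtx f a) \<star> g) = edg (box C M f g) a \<bullet> corner f g a False" for a
    using box_facts(5)[OF f g] f g
    by (cases a) (simp_all add: corner_True_True corner_False_False)
  ultimately show ?thesis
    using f g by (simp add: bimorphism_def hom_def)
qed

lemma bimorphism_square:
  assumes k: "bimorphism f g h k" and s: "s \<in> hom (Arr C) h h'" and f: "f \<in> Mor C" and g: "g \<in> Mor C"
  shows "bimorphism f g h' (\<lambda>a b. component s (a \<and> b) \<bullet> k a b)"
proof -
  note sD = Arr_homD[OF s]
  have k1: "k a b \<in> Mor C" "Dom C (k a b) = vtx f a \<star>\<^sub>o vtx g b"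
    "Cod C (k a b) = vtx h (a \<and> b)" for a b
    using k by (auto simp: bimorphism_def hom_def)
  have k2: "k True b \<bullet> (f \<star> \<one> (vtx g b)) = edg h b \<bullet> k False b" for b
    using k by (auto simp: bimorphism_def)
  have k3: "k a True \<bullet> (\<one> (vtx f a) \<star> g) = edg h a \<bullet> k a False" for a
    using k by (auto simp: bimorphism_def)
  have sq: "component s b \<bullet> edg h b \<bullet> z = edg h' b \<bullet> component s False \<bullet> z"
    if "z \<in> Mor C" "Cod C z = Dom C h" for b z
    using square_commutes[OF sD(1), of b] sD that by (intro comp_reassoc) auto
  have "(component s (True \<and> b) \<bullet> k True b) \<bullet> (f \<star> \<one> (vtx g b))
      = edg h' b \<bullet> component s (False \<and> b) \<bullet> k False b" for b
    using sD k1 f g by (simp add: k2 sq)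
  moreover have "(component s (a \<and> True) \<bullet> k a True) \<bullet> (\<one> (vtx f a) \<star> g)
      = edg h' a \<bullet> component s (a \<and> False) \<bullet> k a False" for a
    using sD k1 f g by (simp add: k3 sq)
  ultimately show ?thesis
    using k1 sD by (simp add: bimorphism_def hom_def)
qed

text \<open>Day convolution by its universal property. The values at \<open>(0,1)\<close> and \<open>(1,0)\<close> induce the
  component at \<open>0\<close> out of the pushout, the value at \<open>(1,1)\<close> is the component at \<open>1\<close>, and naturality
  along the edges into \<open>(1,1)\<close> makes the square commute.\<close>

lemma box_lift:
  assumes k: "bimorphism f g h k" and f: "f \<in> Mor C" and g: "g \<in> Mor C" and h: "h \<in> Mor C"
  shows "\<exists>!s. s \<in> hom (Arr C) (box C M f g) h \<and> (\<forall>a b. component s (a \<and> b) \<bullet> corner f g a b = k a b)"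
proof -
  have k1: "k a b \<in> Mor C" "Dom C (k a b) = vtx f a \<star>\<^sub>o vtx g b"
    "Cod C (k a b) = vtx h (a \<and> b)" for a b
    using k by (auto simp: bimorphism_def hom_def)
  have k2: "k True b \<bullet> (f \<star> \<one> (vtx g b)) = edg h b \<bullet> k False b" for b
    using k by (auto simp: bimorphism_def)
  have k3: "k a True \<bullet> (\<one> (vtx f a) \<star> g) = edg h a \<bullet> k a False" for a
    using k by (auto simp: bimorphism_def)
  let ?i = "corner f g False True" and ?j = "corner f g True False" and ?P = "Dom C (box C M f g)"
  have ff: "k False True \<bullet> (\<one> (Dom C f) \<star> g) = k False False"
    "k True False \<bullet> (f \<star> \<one> (Dom C g)) = k False False"
    using k2[of False] k3[of False] k1 h by simp_all
  have ex: "\<exists>!u. u \<in> hom C ?P (Dom C h) \<and> u \<bullet> ?i = k False True \<and> u \<bullet> ?j = k True False"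
    using f g k1 ff by (intro pushout_universal[OF box_pushout_corners(1)[OF f g]]) auto
  then obtain u where u: "u \<in> hom C ?P (Dom C h)" "u \<bullet> ?i = k False True" "u \<bullet> ?j = k True False"
    by blast
  let ?s = "Square (box C M f g) h u (k True True)"
  have "h \<bullet> u = k True True \<bullet> box C M f g"
  proof (rule joint_epiD[OF pushout_joint_epi[OF box_pushout_corners(1)[OF f g]]])
    fix m assume "m \<in> {?i, ?j}"
    then show "(h \<bullet> u) \<bullet> m = (k True True \<bullet> box C M f g) \<bullet> m"
      using k1 k2[of True] k3[of True] f g h u box_facts(4,5)[OF f g] by (auto simp: hom_def)
  qed (use u k1 f g h in \<open>auto simp: hom_def\<close>)
  then have s: "?s \<in> hom (Arr C) (box C M f g) h"
    using u k1 f g h by (intro Arr_homI) (auto simp: hom_def vertex_def)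
  have c: "component ?s (a \<and> b) \<bullet> corner f g a b = k a b" for a b
  proof -
    have "u \<bullet> ?i \<bullet> (\<one> (Dom C f) \<star> g) = (u \<bullet> ?i) \<bullet> (\<one> (Dom C f) \<star> g)"
      using u(1) f g by (simp add: hom_def)
    then show ?thesis
      using u k1 f g ff by (cases a; cases b) (simp_all add: corner_True_True corner_False_False)
  qed
  show ?thesis
  proof (rule ex1I)
    show "?s \<in> hom (Arr C) (box C M f g) h \<and> (\<forall>a b. component ?s (a \<and> b) \<bullet> corner f g a b = k a b)"
      using s c by blast
  next
    fix t assume *: "t \<in> hom (Arr C) (box C M f g) h \<and> (\<forall>a b. component t (a \<and> b) \<bullet> corner f g a b = k a b)"
    then have t: "t \<in> hom (Arr C) (box C M f g) h" and
      tc: "component t (a \<and> b) \<bullet> corner f g a b = k a b" for a b by blast+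
    note tD = Arr_homD[OF t]
    have "component t False \<in> hom C ?P (Dom C h)" using tD f g by (simp add: hom_def)
    then have "component t False = u"
      using ex u tc[of False True] tc[of True False] by auto
    moreover have "component t True = k True True"
      using tc[of True True] tD f g by (simp add: corner_True_True)
    ultimately show "t = ?s" using tD by (cases t) (simp add: component_def)
  qed
qed

abbreviation pushout_product (infixr "\<box>" 80) where "f \<box> g \<equiv> box C M f g"

text \<open>Naturality along all edges \<open>0 \<rightarrow> a\<close>, including the identity for \<open>a = 0\<close>, needs no case
  distinction when it is applied.\<close>

lemma bimorphismD:
  assumes "bimorphism f g h k" "f \<in> Mor C" "g \<in> Mor C" "h \<in> Mor C"
  shows "k a b \<in> Mor C" "Dom C (k a b) = vtx f a \<star>\<^sub>o vtx g b"
    "Cod C (k a b) = vtx h (a \<and> b)"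
    "k a b \<bullet> (edg f a \<star> \<one> (vtx g b)) = edg h (a \<and> b) \<bullet> k False b"
    "k a b \<bullet> (\<one> (vtx f a) \<star> edg g b) = edg h (a \<and> b) \<bullet> k a False"
proof -
  show *: "k a b \<in> Mor C" "Dom C (k a b) = vtx f a \<star>\<^sub>o vtx g b"
    "Cod C (k a b) = vtx h (a \<and> b)" for a b
    using assms(1) by (auto simp: bimorphism_def hom_def)
  show "k a b \<bullet> (edg f a \<star> \<one> (vtx g b)) = edg h (a \<and> b) \<bullet> k False b"
    using assms * by (cases a) (auto simp: bimorphism_def)
  show "k a b \<bullet> (\<one> (vtx f a) \<star> edg g b) = edg h (a \<and> b) \<bullet> k a False"
    using assms * by (cases b) (auto simp: bimorphism_def)
qed

lemma bimorphismI:
  assumes "\<And>a b. k a b \<in> Mor C" "\<And>a b. Dom C (k a b) = vtx f a \<star>\<^sub>o vtx g b"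
    "\<And>a b. Cod C (k a b) = vtx h (a \<and> b)"
    "\<And>a b. k a b \<bullet> (edg f a \<star> \<one> (vtx g b)) = edg h (a \<and> b) \<bullet> k False b"
    "\<And>a b. k a b \<bullet> (\<one> (vtx f a) \<star> edg g b) = edg h (a \<and> b) \<bullet> k a False"
  shows "bimorphism f g h k"
  using assms(1-3) assms(4)[of True] assms(5)[of _ True] by (simp add: bimorphism_def hom_def)

lemmas corner_edge = bimorphismD(4,5)[OF bimorphism_corner _ _ box_simps(1)]

section \<open>Joint epimorphy of the corners\<close>

lemma corner_joint_epi:
  assumes f: "f \<in> Mor C" and g: "g \<in> Mor C"
  shows "joint_epi (vtx (f \<box> g) e) {corner f g a b | a b. (a \<and> b) = e}"
proof (rule joint_epiI)
  fix k k'
  assume k: "k \<in> Mor C" "k' \<in> Mor C" "Dom C k = vtx (f \<box> g) e" "Dom C k' = vtx (f \<box> g) e"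
      "Cod C k = Cod C k'"
    and "\<And>m. m \<in> {corner f g a b | a b. (a \<and> b) = e} \<Longrightarrow> k \<bullet> m = k' \<bullet> m"
  then have eq: "k \<bullet> corner f g a b = k' \<bullet> corner f g a b" if "(a \<and> b) = e" for a b
    using that by blast
  show "k = k'"
  proof (cases e)
    case True
    then show ?thesis using eq[of True True] k f g by (simp add: corner_True_True)
  next
    case False
    show ?thesis
    proof (rule joint_epiD[OF pushout_joint_epi[OF box_pushout_corners(1)[OF f g]]])
      show "k \<bullet> m = k' \<bullet> m" if "m \<in> {corner f g False True, corner f g True False}" for m
        using that eq[of False True] eq[of True False] False by auto
    qed (use k False in simp_all)
  qed
qed (use f g in auto)

text \<open>The corners of \<open>(f \<box> g) \<box> h\<close>, each restricted along the corners of \<open>f \<box> g\<close> tensored with a vertex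
  of \<open>h\<close>. The same pattern yields the other bracketing and four factors.\<close>

lemma corner3_joint_epi:
  assumes f: "f \<in> Mor C" and g: "g \<in> Mor C" and h: "h \<in> Mor C"
  shows "joint_epi (vtx ((f \<box> g) \<box> h) e)
    {corner (f \<box> g) h (a \<and> b) c \<bullet> (corner f g a b \<star> \<one> (vtx h c)) | a b c. (a \<and> b \<and> c) = e}"
    (is "joint_epi _ ?T")
proof (rule joint_epi_trans[OF corner_joint_epi])
  fix m assume "m \<in> {corner (f \<box> g) h d c | d c. (d \<and> c) = e}"
  then obtain d c where m: "m = corner (f \<box> g) h d c" "(d \<and> c) = e" by blast
  let ?R = "(\<lambda>m. m \<star> \<one> (vtx h c)) ` {corner f g a b | a b. (a \<and> b) = d}"
  have "joint_epi (Dom C m) ?R"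
    using joint_epi_tens_right[OF corner_joint_epi[OF f g, of d], of "vtx h c"] f g h
    by (simp add: m)
  moreover have "\<forall>r \<in> ?R. m \<bullet> r \<in> ?T" unfolding m(1) using m(2) by blast
  ultimately show "\<exists>R. joint_epi (Dom C m) R \<and> (\<forall>r \<in> R. m \<bullet> r \<in> ?T)" by blast
qed (use f g h in auto)

lemma corner3_right_joint_epi:
  assumes f: "f \<in> Mor C" and g: "g \<in> Mor C" and h: "h \<in> Mor C"
  shows "joint_epi (vtx (f \<box> (g \<box> h)) e)
    {corner f (g \<box> h) a (b \<and> c) \<bullet> (\<one> (vtx f a) \<star> corner g h b c) | a b c. (a \<and> b \<and> c) = e}"
    (is "joint_epi _ ?T")
proof (rule joint_epi_trans[OF corner_joint_epi])
  fix m assume "m \<in> {corner f (g \<box> h) a d | a d. (a \<and> d) = e}"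
  then obtain a d where m: "m = corner f (g \<box> h) a d" "(a \<and> d) = e" by blast
  let ?R = "(\<lambda>m. \<one> (vtx f a) \<star> m) ` {corner g h b c | b c. (b \<and> c) = d}"
  have "joint_epi (Dom C m) ?R"
    using joint_epi_tens_left[OF corner_joint_epi[OF g h, of d], of "vtx f a"] f g h
    by (simp add: m)
  moreover have "\<forall>r \<in> ?R. m \<bullet> r \<in> ?T" unfolding m(1) using m(2) by blast
  ultimately show "\<exists>R. joint_epi (Dom C m) R \<and> (\<forall>r \<in> R. m \<bullet> r \<in> ?T)" by blast
qed (use f g h in auto)

lemma corner4_joint_epi:
  assumes f: "f \<in> Mor C" and g: "g \<in> Mor C" and h: "h \<in> Mor C" and k: "k \<in> Mor C"
  shows "joint_epi (vtx (((f \<box> g) \<box> h) \<box> k) e)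
    {corner ((f \<box> g) \<box> h) k (a \<and> b \<and> c) d \<bullet>
       ((corner (f \<box> g) h (a \<and> b) c \<bullet> (corner f g a b \<star> \<one> (vtx h c))) \<star> \<one> (vtx k d))
     | a b c d. (a \<and> b \<and> c \<and> d) = e}"
    (is "joint_epi _ ?T")
proof (rule joint_epi_trans[OF corner_joint_epi])
  fix m assume "m \<in> {corner ((f \<box> g) \<box> h) k x d | x d. (x \<and> d) = e}"
  then obtain x d where m: "m = corner ((f \<box> g) \<box> h) k x d" "(x \<and> d) = e" by blast
  let ?R = "(\<lambda>m. m \<star> \<one> (vtx k d)) `
    {corner (f \<box> g) h (a \<and> b) c \<bullet> (corner f g a b \<star> \<one> (vtx h c)) | a b c. (a \<and> b \<and> c) = x}"
  have "joint_epi (Dom C m) ?R"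
    using joint_epi_tens_right[OF corner3_joint_epi[OF f g h, of x], of "vtx k d"] f g h k
    by (simp add: m)
  moreover have "\<forall>r \<in> ?R. m \<bullet> r \<in> ?T" unfolding m(1) using m(2) by blast
  ultimately show "\<exists>R. joint_epi (Dom C m) R \<and> (\<forall>r \<in> R. m \<bullet> r \<in> ?T)" by blast
qed (use f g h k in auto)

text \<open>The extensionality principles used for all equations between squares out of pushout
  products.\<close>

lemma box_hom_eqI:
  assumes s: "s \<in> hom (Arr C) (f \<box> g) q" and t: "t \<in> hom (Arr C) (f \<box> g) q"
    and f: "f \<in> Mor C" and g: "g \<in> Mor C"
    and eq: "\<And>a b. component s (a \<and> b) \<bullet> corner f g a b = component t (a \<and> b) \<bullet> corner f g a b"
  shows "s = t"
proof (rule Arr_hom_eqI[OF s t], rule joint_epiD[OF corner_joint_epi[OF f g]])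
  fix e m assume "m \<in> {corner f g a b | a b. (a \<and> b) = e}"
  then show "component s e \<bullet> m = component t e \<bullet> m" using eq by blast
qed (use Arr_homD[OF s] Arr_homD[OF t] in simp_all)

lemma box3_hom_eqI:
  assumes s: "s \<in> hom (Arr C) ((f \<box> g) \<box> h) q" and t: "t \<in> hom (Arr C) ((f \<box> g) \<box> h) q"
    and f: "f \<in> Mor C" and g: "g \<in> Mor C" and h: "h \<in> Mor C"
    and eq: "\<And>a b c. component s (a \<and> b \<and> c) \<bullet> corner (f \<box> g) h (a \<and> b) c \<bullet> (corner f g a b \<star> \<one> (vtx h c))
      = component t (a \<and> b \<and> c) \<bullet> corner (f \<box> g) h (a \<and> b) c \<bullet> (corner f g a b \<star> \<one> (vtx h c))"
  shows "s = t"
  by (rule Arr_hom_eqI[OF s t], rule joint_epiD[OF corner3_joint_epi[OF f g h]])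
    (use eq Arr_homD[OF s] Arr_homD[OF t] in auto)

lemma box3_right_hom_eqI:
  assumes s: "s \<in> hom (Arr C) (f \<box> (g \<box> h)) q" and t: "t \<in> hom (Arr C) (f \<box> (g \<box> h)) q"
    and f: "f \<in> Mor C" and g: "g \<in> Mor C" and h: "h \<in> Mor C"
    and eq: "\<And>a b c. component s (a \<and> b \<and> c) \<bullet> corner f (g \<box> h) a (b \<and> c) \<bullet> (\<one> (vtx f a) \<star> corner g h b c)
      = component t (a \<and> b \<and> c) \<bullet> corner f (g \<box> h) a (b \<and> c) \<bullet> (\<one> (vtx f a) \<star> corner g h b c)"
  shows "s = t"
  by (rule Arr_hom_eqI[OF s t], rule joint_epiD[OF corner3_right_joint_epi[OF f g h]])
    (use eq Arr_homD[OF s] Arr_homD[OF t] in auto)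

lemma box4_hom_eqI:
  assumes s: "s \<in> hom (Arr C) (((f \<box> g) \<box> h) \<box> k) q" and t: "t \<in> hom (Arr C) (((f \<box> g) \<box> h) \<box> k) q"
    and f: "f \<in> Mor C" and g: "g \<in> Mor C" and h: "h \<in> Mor C" and k: "k \<in> Mor C"
    and eq: "\<And>a b c d. component s (a \<and> b \<and> c \<and> d) \<bullet> corner ((f \<box> g) \<box> h) k (a \<and> b \<and> c) d \<bullet>
       ((corner (f \<box> g) h (a \<and> b) c \<bullet> (corner f g a b \<star> \<one> (vtx h c))) \<star> \<one> (vtx k d))
      = component t (a \<and> b \<and> c \<and> d) \<bullet> corner ((f \<box> g) \<box> h) k (a \<and> b \<and> c) d \<bullet>
       ((corner (f \<box> g) h (a \<and> b) c \<bullet> (corner f g a b \<star> \<one> (vtx h c))) \<star> \<one> (vtx k d))"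
  shows "s = t"
  by (rule Arr_hom_eqI[OF s t], rule joint_epiD[OF corner4_joint_epi[OF f g h k]])
    (use eq Arr_homD[OF s] Arr_homD[OF t] in auto)

section \<open>Threefold pushout products\<close>

text \<open>The analogue of \<open>bimorphism\<close> for families from \<open>(f(a) \<otimes> g(b)) \<otimes> h(c)\<close> to \<open>q(a \<and> b \<and> c)\<close>.\<close>

definition trimorphism :: "'m \<Rightarrow> 'm \<Rightarrow> 'm \<Rightarrow> 'm \<Rightarrow> (bool \<Rightarrow> bool \<Rightarrow> bool \<Rightarrow> 'm) \<Rightarrow> bool" where
  "trimorphism f g h q T \<longleftrightarrow>
     (\<forall>a b c. T a b c \<in> hom C ((vtx f a \<star>\<^sub>o vtx g b) \<star>\<^sub>o vtx h c) (vtx q (a \<and> b \<and> c)) \<and>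
       T a b c \<bullet> ((edg f a \<star> \<one> (vtx g b)) \<star> \<one> (vtx h c)) = edg q (a \<and> b \<and> c) \<bullet> T False b c \<and>
       T a b c \<bullet> ((\<one> (vtx f a) \<star> edg g b) \<star> \<one> (vtx h c)) = edg q (a \<and> b \<and> c) \<bullet> T a False c \<and>
       T a b c \<bullet> (\<one> (vtx f a \<star>\<^sub>o vtx g b) \<star> edg h c) = edg q (a \<and> b \<and> c) \<bullet> T a b False)"

text \<open>For fixed \<open>c\<close> the family extends over \<open>(f \<box> g)(d) \<otimes> h(c)\<close>, because tensoring with \<open>h(c)\<close>
  preserves the pushout that defines \<open>f \<box> g\<close>. The extensions form a bimorphism on \<open>f \<box> g\<close> and \<open>h\<close>, to
  which the twofold universal property applies.\<close>

lemma box3_lift: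
  assumes T: "trimorphism f g h q T"
    and f: "f \<in> Mor C" and g: "g \<in> Mor C" and h: "h \<in> Mor C" and q: "q \<in> Mor C"
  shows "\<exists>!s. s \<in> hom (Arr C) ((f \<box> g) \<box> h) q \<and> (\<forall>a b c. component s (a \<and> b \<and> c) \<bullet>
     corner (f \<box> g) h (a \<and> b) c \<bullet> (corner f g a b \<star> \<one> (vtx h c)) = T a b c)"
proof -
  have T1: "T a b c \<in> Mor C" "Dom C (T a b c) = (vtx f a \<star>\<^sub>o vtx g b) \<star>\<^sub>o vtx h c"
    "Cod C (T a b c) = vtx q (a \<and> b \<and> c)" for a b c
    using T by (auto simp: trimorphism_def hom_def)
  have T2: "T a b c \<bullet> ((edg f a \<star> \<one> (vtx g b)) \<star> \<one> (vtx h c))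
      = edg q (a \<and> b \<and> c) \<bullet> T False b c"
    "T a b c \<bullet> ((\<one> (vtx f a) \<star> edg g b) \<star> \<one> (vtx h c))
      = edg q (a \<and> b \<and> c) \<bullet> T a False c"
    "T a b c \<bullet> (\<one> (vtx f a \<star>\<^sub>o vtx g b) \<star> edg h c)
      = edg q (a \<and> b \<and> c) \<bullet> T a b False" for a b c
    using T by (auto simp: trimorphism_def)
  let ?i = "corner f g False True" and ?j = "corner f g True False" and ?P = "Dom C (f \<box> g)"
  have "\<exists>u. u \<in> hom C (?P \<star>\<^sub>o vtx h c) (Dom C q) \<and>
     u \<bullet> (?i \<star> \<one> (vtx h c)) = T False True c \<and> u \<bullet> (?j \<star> \<one> (vtx h c)) = T True False c" for c
  proof -
    let ?Z = "vtx h c"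
    have "T False True c \<bullet> ((\<one> (Dom C f) \<star> g) \<star> \<one> ?Z) = T False False c"
      "T True False c \<bullet> ((f \<star> \<one> (Dom C g)) \<star> \<one> ?Z) = T False False c"
      using T2(2)[of False True c] T2(1)[of True False c] T1 q by simp_all
    then have "\<exists>!u. u \<in> hom C (?P \<star>\<^sub>o ?Z) (Dom C q) \<and>
       u \<bullet> (?i \<star> \<one> ?Z) = T False True c \<and> u \<bullet> (?j \<star> \<one> ?Z) = T True False c"
      using f g h T1
      by (intro pushout_universal[OF pushout_tens_right[OF box_pushout_corners(1)]]) auto
    then show ?thesis by blast
  qed
  then obtain U where U: "\<And>c. U c \<in> hom C (?P \<star>\<^sub>o vtx h c) (Dom C q)"
    "\<And>c. U c \<bullet> (?i \<star> \<one> (vtx h c)) = T False True c"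
    "\<And>c. U c \<bullet> (?j \<star> \<one> (vtx h c)) = T True False c"
    by metis
  \<comment> \<open>The extension over \<open>(f \<box> g)(d) \<otimes> h(c)\<close>; for \<open>d = 1\<close> there is nothing to extend.\<close>
  define K where "K d c = (if d then T True True c else U c)" for d c
  have K1: "K d c \<in> Mor C" "Dom C (K d c) = vtx (f \<box> g) d \<star>\<^sub>o vtx h c"
    "Cod C (K d c) = vtx q (d \<and> c)" for d c
    using U(1)[of c] T1 f g by (simp_all add: K_def hom_def)
  have K2: "K (a \<and> b) c \<bullet> (corner f g a b \<star> \<one> (vtx h c)) = T a b c" for a b c
  proof -
    let ?Z = "vtx h c"
    have "U c \<bullet> (corner f g False False \<star> \<one> ?Z) = U c \<bullet> (?i \<star> \<one> ?Z) \<bullet> ((\<one> (Dom C f) \<star> g) \<star> \<one> ?Z)"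
      using f g h by (simp add: corner_False_False interchange)
    also have "\<dots> = (U c \<bullet> (?i \<star> \<one> ?Z)) \<bullet> ((\<one> (Dom C f) \<star> g) \<star> \<one> ?Z)"
      using f g h U(1)[of c] by (simp add: hom_def)
    also have "\<dots> = T False False c"
      using T2(2)[of False True c] T1 q by (simp add: U(2))
    finally show ?thesis
      using f g h T1 U(2,3)[of c] by (cases a; cases b) (simp_all add: K_def corner_True_True)
  qed
  have K: "bimorphism (f \<box> g) h q K"
  proof (rule bimorphismI)
    fix d c
    let ?Z = "vtx h c"
    show "K d c \<bullet> (edg (f \<box> g) d \<star> \<one> ?Z) = edg q (d \<and> c) \<bullet> K False c"
    proof (cases d)
      case False
      then show ?thesis using K1 f g h q by simp
    next
      case True
      have "K True c \<bullet> ((f \<box> g) \<star> \<one> ?Z) = edg q c \<bullet> K False c"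
      proof (rule joint_epiD[OF joint_epi_tens_right[OF pushout_joint_epi[OF box_pushout_corners(1)[OF f g]], of ?Z]])
        fix m assume "m \<in> (\<lambda>m. m \<star> \<one> ?Z) ` {?i, ?j}"
        then consider "m = ?i \<star> \<one> ?Z" | "m = ?j \<star> \<one> ?Z" by blast
        then show "(K True c \<bullet> ((f \<box> g) \<star> \<one> ?Z)) \<bullet> m = (edg q c \<bullet> K False c) \<bullet> m"
        proof cases
          case 1
          have "(K True c \<bullet> ((f \<box> g) \<star> \<one> ?Z)) \<bullet> m = T True True c \<bullet> ((f \<star> \<one> (Cod C g)) \<star> \<one> ?Z)"
            using K1 f g h by (simp add: 1 interchange box_facts(4)) (simp add: K_def)
          also have "\<dots> = (edg q c \<bullet> K False c) \<bullet> m"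
            using K1 f g h q T2(1)[of True True c] K2[of False True c] by (simp add: 1)
          finally show ?thesis .
        next
          case 2
          have "(K True c \<bullet> ((f \<box> g) \<star> \<one> ?Z)) \<bullet> m = T True True c \<bullet> ((\<one> (Cod C f) \<star> g) \<star> \<one> ?Z)"
            using K1 f g h by (simp add: 2 interchange box_facts(5)) (simp add: K_def)
          also have "\<dots> = (edg q c \<bullet> K False c) \<bullet> m"
            using K1 f g h q T2(2)[of True True c] K2[of True False c] by (simp add: 2)
          finally show ?thesis .
        qed
      qed (use K1[of True c] K1[of False c] f g h q in simp_all)
      then show ?thesis using True by simp
    qed
    show "K d c \<bullet> (\<one> (vtx (f \<box> g) d) \<star> edg h c) = edg q (d \<and> c) \<bullet> K d False"
    proof (rule joint_epiD[OF joint_epi_tens_right[OF corner_joint_epi[OF f g, of d], of "Dom C h"]])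
      fix m assume "m \<in> (\<lambda>m. m \<star> \<one> (Dom C h)) ` {corner f g a b | a b. (a \<and> b) = d}"
      then obtain a b where ab: "d = (a \<and> b)" "m = corner f g a b \<star> \<one> (Dom C h)" by blast
      let ?l = "(K d c \<bullet> (\<one> (vtx (f \<box> g) d) \<star> edg h c)) \<bullet> m"
      let ?r = "(edg q (d \<and> c) \<bullet> K d False) \<bullet> m"
      have "?l = K d c \<bullet> (corner f g a b \<star> \<one> ?Z) \<bullet> (\<one> (vtx f a \<star>\<^sub>o vtx g b) \<star> edg h c)"
        using K1 f g h ab by (simp add: interchange)
      also have "\<dots> = (K (a \<and> b) c \<bullet> (corner f g a b \<star> \<one> ?Z)) \<bullet> (\<one> (vtx f a \<star>\<^sub>o vtx g b) \<star> edg h c)"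
        using K1 f g h ab by simp
      also have "\<dots> = edg q (a \<and> b \<and> c) \<bullet> T a b False"
        by (simp only: K2 T2)
      also have "\<dots> = ?r"
        using K1 f g h q ab K2[of a b False] by simp
      finally show "?l = ?r" .
    qed (use K1 f g h q in simp_all)
  qed (rule K1)+
  then obtain s where s: "s \<in> hom (Arr C) ((f \<box> g) \<box> h) q"
    "\<And>d c. component s (d \<and> c) \<bullet> corner (f \<box> g) h d c = K d c"
    using box_lift[OF K] f g h q by auto
  have "component s (a \<and> b \<and> c) \<bullet> corner (f \<box> g) h (a \<and> b) c \<bullet> (corner f g a b \<star> \<one> (vtx h c)) = T a b c"
    for a b c
  proof -
    have "component s (a \<and> b \<and> c) \<bullet> corner (f \<box> g) h (a \<and> b) c \<bullet> (corner f g a b \<star> \<one> (vtx h c))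
       = (component s ((a \<and> b) \<and> c) \<bullet> corner (f \<box> g) h (a \<and> b) c) \<bullet> (corner f g a b \<star> \<one> (vtx h c))"
      using Arr_homD[OF s(1)] f g h by simp
    then show ?thesis by (simp only: s(2) K2)
  qed
  with s(1) show ?thesis
    by (intro ex1I[of _ s]) (auto intro!: box3_hom_eqI[OF _ _ f g h])
qed

section \<open>Functoriality, associativity and symmetry of the pushout product\<close>

text \<open>The functor \<open>\<box>\<close> on squares is characterised by its effect on corners. All later arguments use
  this characterisation instead of the formula with \<open>from_pushout\<close>.\<close>

lemma box_square:
  assumes s: "s \<in> hom (Arr C) f f'" and t: "t \<in> hom (Arr C) g g'"
  shows "box_square C M s t \<in> hom (Arr C) (f \<box> g) (f' \<box> g')"
    and "component (box_square C M s t) (a \<and> b) \<bullet> corner f g a b = corner f' g' a b \<bullet> (component s a \<star> component t b)"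
proof -
  note sD = Arr_homD[OF s] and tD = Arr_homD[OF t]
  note [simp] = sD(2-) tD(2-)
  have sm: "component s a \<in> Mor C" "Dom C (component s a) = vtx f a" "Cod C (component s a) = vtx f' a"
    and tm: "component t a \<in> Mor C" "Dom C (component t a) = vtx g a" "Cod C (component t a) = vtx g' a" for a
    using sD(1) tD(1) by simp_all
  have sq: "component s a \<bullet> edg f a = edg f' a \<bullet> component s False"
    "component t a \<bullet> edg g a = edg g' a \<bullet> component t False" for a
    using square_commutes[OF sD(1), of a] square_commutes[OF tD(1), of a] by simp_all
  define k where "k a b = corner f' g' a b \<bullet> (component s a \<star> component t b)" for a b
  have "bimorphism f g (f' \<box> g') k"
  proof (rule bimorphismI)
    fix a b
    show "k a b \<in> Mor C" "Dom C (k a b) = vtx f a \<star>\<^sub>o vtx g b" "Cod C (k a b) = vtx (f' \<box> g') (a \<and> b)"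
      using sm tm by (simp_all add: k_def)
    let ?l = "k a b \<bullet> (edg f a \<star> \<one> (vtx g b))"
    let ?r = "edg (f' \<box> g') (a \<and> b) \<bullet> k False b"
    have "?l = (corner f' g' a b \<bullet> (edg f' a \<star> \<one> (vtx g' b))) \<bullet> (component s False \<star> component t b)"
      using sm tm by (simp add: k_def interchange sq)
    also have "\<dots> = ?r"
      using sm tm by (simp add: corner_edge k_def)
    finally show "?l = ?r" .
    let ?l = "k a b \<bullet> (\<one> (vtx f a) \<star> edg g b)"
    let ?r = "edg (f' \<box> g') (a \<and> b) \<bullet> k a False"
    have "?l = (corner f' g' a b \<bullet> (\<one> (vtx f' a) \<star> edg g' b)) \<bullet> (component s a \<star> component t False)"
      using sm tm by (simp add: k_def interchange sq)
    also have "\<dots> = ?r"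
      using sm tm by (simp add: corner_edge k_def)
    finally show "?l = ?r" .
  qed
  then obtain u where u: "u \<in> hom (Arr C) (f \<box> g) (f' \<box> g')"
    "\<And>a b. component u (a \<and> b) \<bullet> corner f g a b = k a b"
    using box_lift[of f g "f' \<box> g'" k] by auto
  note uD = Arr_homD[OF u(1)]
  have "component u True = component s True \<star> component t True"
    using u(2)[of True True] uD sm tm by (simp add: k_def corner_True_True)
  moreover have "component u False = from_pushout C (box_pushout C M f g) (k False True) (k True False)"
  proof -
    have "k False True = component u False \<bullet> corner f g False True"
      "k True False = component u False \<bullet> corner f g True False"
      using u(2)[of False True] u(2)[of True False] by simp_all
    then show ?thesis
      using uD by (simp add: box_pushout_corners(2) from_pushout_comp[OF box_pushout_corners(1)]
            del: from_pushout.simps)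
  qed
  ultimately have "box_square C M s t = u"
    using uD
    by (cases u) (simp add: box_square_def box_pushout_corners(2)[of f' g'] k_def component_def
        del: from_pushout.simps)
  then show "box_square C M s t \<in> hom (Arr C) (f \<box> g) (f' \<box> g')"
    "component (box_square C M s t) (a \<and> b) \<bullet> corner f g a b = corner f' g' a b \<bullet> (component s a \<star> component t b)"
    using u by (simp_all add: k_def)
qed

text \<open>The corner rules of the structure maps are also stated with a further map \<open>z\<close> composed on
  the right, to be applied inside longer composites.\<close>

lemma component_box_square_comp:
  assumes s: "s \<in> hom (Arr C) f f'" and t: "t \<in> hom (Arr C) g g'"
    and z: "z \<in> Mor C" "Cod C z = vtx f a \<star>\<^sub>o vtx g b"
  shows "component (box_square C M s t) (a \<and> b) \<bullet> corner f g a b \<bullet> z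
    = corner f' g' a b \<bullet> (component s a \<star> component t b) \<bullet> z"
  using Arr_homD[OF s] Arr_homD[OF t] Arr_homD[OF box_square(1)[OF s t]] z
  by (intro comp_reassoc[OF box_square(2)[OF s t], THEN trans]) simp_all

lemma trimorphism_assoc:
  assumes f: "f \<in> Mor C" and g: "g \<in> Mor C" and h: "h \<in> Mor C"
  shows "trimorphism f g h (f \<box> (g \<box> h)) (\<lambda>a b c. corner f (g \<box> h) a (b \<and> c) \<bullet>
    (\<one> (vtx f a) \<star> corner g h b c) \<bullet> assoc M (vtx f a) (vtx g b) (vtx h c))"
  unfolding trimorphism_def
proof (intro allI conjI)
  fix a b c
  let ?A = "vtx f a" and ?B = "vtx g b" and ?C = "vtx h c"
  let ?E = "edg (f \<box> (g \<box> h)) (a \<and> b \<and> c)"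
  show "corner f (g \<box> h) a (b \<and> c) \<bullet> (\<one> ?A \<star> corner g h b c) \<bullet> assoc M ?A ?B ?C
     \<in> hom C ((?A \<star>\<^sub>o ?B) \<star>\<^sub>o ?C) (vtx (f \<box> (g \<box> h)) (a \<and> b \<and> c))"
    using f g h by (simp add: hom_def)
  let ?l = "(corner f (g \<box> h) a (b \<and> c) \<bullet> (\<one> ?A \<star> corner g h b c) \<bullet> assoc M ?A ?B ?C) \<bullet> ((edg f a \<star> \<one> ?B) \<star> \<one> ?C)"
  let ?r = "?E \<bullet> corner f (g \<box> h) False (b \<and> c) \<bullet> (\<one> (vtx f False) \<star> corner g h b c) \<bullet> assoc M (vtx f False) ?B ?C"
  have "?l = (corner f (g \<box> h) a (b \<and> c) \<bullet> (edg f a \<star> \<one> (vtx (g \<box> h) (b \<and> c)))) \<bullet>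
        (\<one> (Dom C f) \<star> corner g h b c) \<bullet> assoc M (Dom C f) ?B ?C"
    using f g h by (simp add: assoc_nat interchange')
  also have "\<dots> = ?r"
    using f g h by (simp add: corner_edge)
  finally show "?l = ?r" .
  let ?l = "(corner f (g \<box> h) a (b \<and> c) \<bullet> (\<one> ?A \<star> corner g h b c) \<bullet> assoc M ?A ?B ?C) \<bullet> ((\<one> ?A \<star> edg g b) \<star> \<one> ?C)"
  let ?r = "?E \<bullet> corner f (g \<box> h) a (False \<and> c) \<bullet> (\<one> ?A \<star> corner g h False c) \<bullet> assoc M ?A (vtx g False) ?C"
  have "?l = corner f (g \<box> h) a (b \<and> c) \<bullet> (\<one> ?A \<star> (corner g h b c \<bullet> (edg g b \<star> \<one> ?C))) \<bullet> assoc M ?A (Dom C g) ?C"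
    using f g h by (simp add: assoc_nat interchange')
  also have "\<dots> = (corner f (g \<box> h) a (b \<and> c) \<bullet> (\<one> ?A \<star> edg (g \<box> h) (b \<and> c))) \<bullet>
      (\<one> ?A \<star> corner g h False c) \<bullet> assoc M ?A (Dom C g) ?C"
    using f g h by (simp add: corner_edge(1)[OF g h] interchange')
  also have "\<dots> = ?r"
    using f g h by (simp add: corner_edge(2))
  finally show "?l = ?r" .
  have n: "assoc M ?A ?B ?C \<bullet> (\<one> (?A \<star>\<^sub>o ?B) \<star> edg h c) = (\<one> ?A \<star> (\<one> ?B \<star> edg h c)) \<bullet> assoc M ?A ?B (Dom C h)"
    using f g h by (simp add: assoc_nat_ident)
  let ?l = "(corner f (g \<box> h) a (b \<and> c) \<bullet> (\<one> ?A \<star> corner g h b c) \<bullet> assoc M ?A ?B ?C) \<bullet> (\<one> (?A \<star>\<^sub>o ?B) \<star> edg h c)"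
  let ?r = "?E \<bullet> corner f (g \<box> h) a (b \<and> False) \<bullet> (\<one> ?A \<star> corner g h b False) \<bullet> assoc M ?A ?B (vtx h False)"
  have "?l = corner f (g \<box> h) a (b \<and> c) \<bullet> (\<one> ?A \<star> (corner g h b c \<bullet> (\<one> ?B \<star> edg h c))) \<bullet> assoc M ?A ?B (Dom C h)"
    using f g h by (simp add: n interchange')
  also have "\<dots> = (corner f (g \<box> h) a (b \<and> c) \<bullet> (\<one> ?A \<star> edg (g \<box> h) (b \<and> c))) \<bullet>
      (\<one> ?A \<star> corner g h b False) \<bullet> assoc M ?A ?B (Dom C h)"
    using f g h by (simp add: corner_edge(2)[OF g h] interchange')
  also have "\<dots> = ?r"
    using f g h by (simp add: corner_edge(2))
  finally show "?l = ?r" .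
qed

definition box_assoc :: "'m \<Rightarrow> 'm \<Rightarrow> 'm \<Rightarrow> 'm square" where
  "box_assoc f g h = (THE s. s \<in> hom (Arr C) ((f \<box> g) \<box> h) (f \<box> (g \<box> h)) \<and>
     (\<forall>a b c. component s (a \<and> b \<and> c) \<bullet> corner (f \<box> g) h (a \<and> b) c \<bullet> (corner f g a b \<star> \<one> (vtx h c))
       = corner f (g \<box> h) a (b \<and> c) \<bullet> (\<one> (vtx f a) \<star> corner g h b c) \<bullet>
           assoc M (vtx f a) (vtx g b) (vtx h c)))"

lemma box_assoc:
  assumes f: "f \<in> Mor C" and g: "g \<in> Mor C" and h: "h \<in> Mor C"
  shows "box_assoc f g h \<in> hom (Arr C) ((f \<box> g) \<box> h) (f \<box> (g \<box> h))"
    and "component (box_assoc f g h) (a \<and> b \<and> c) \<bullet> corner (f \<box> g) h (a \<and> b) c \<bullet> (corner f g a b \<star> \<one> (vtx h c))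
       = corner f (g \<box> h) a (b \<and> c) \<bullet> (\<one> (vtx f a) \<star> corner g h b c) \<bullet>
           assoc M (vtx f a) (vtx g b) (vtx h c)"
  using theI'[OF box3_lift[OF trimorphism_assoc[OF f g h]], folded box_assoc_def] f g h by auto

lemma component_box_assoc_comp:
  assumes f: "f \<in> Mor C" and g: "g \<in> Mor C" and h: "h \<in> Mor C"
    and z: "z \<in> Mor C" "Cod C z = (vtx f a \<star>\<^sub>o vtx g b) \<star>\<^sub>o vtx h c"
  shows "component (box_assoc f g h) (a \<and> b \<and> c) \<bullet> corner (f \<box> g) h (a \<and> b) c \<bullet> (corner f g a b \<star> \<one> (vtx h c)) \<bullet> z
       = corner f (g \<box> h) a (b \<and> c) \<bullet> (\<one> (vtx f a) \<star> corner g h b c) \<bullet>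
           assoc M (vtx f a) (vtx g b) (vtx h c) \<bullet> z"
proof -
  note D = Arr_homD[OF box_assoc(1)[OF f g h]]
  have "(component (box_assoc f g h) (a \<and> b \<and> c) \<bullet> corner (f \<box> g) h (a \<and> b) c \<bullet> (corner f g a b \<star> \<one> (vtx h c))) \<bullet> z
       = (corner f (g \<box> h) a (b \<and> c) \<bullet> (\<one> (vtx f a) \<star> corner g h b c) \<bullet>
           assoc M (vtx f a) (vtx g b) (vtx h c)) \<bullet> z"
    by (simp only: box_assoc(2)[OF f g h])
  then show ?thesis using D f g h z by simp
qed

definition box_symm :: "'m \<Rightarrow> 'm \<Rightarrow> 'm square" where
  "box_symm f g = (THE s. s \<in> hom (Arr C) (f \<box> g) (g \<box> f) \<and>
     (\<forall>a b. component s (a \<and> b) \<bullet> corner f g a b = corner g f b a \<bullet> symm M (vtx f a) (vtx g b)))"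

lemma bimorphism_symm:
  assumes f: "f \<in> Mor C" and g: "g \<in> Mor C"
  shows "bimorphism f g (g \<box> f) (\<lambda>a b. corner g f b a \<bullet> symm M (vtx f a) (vtx g b))"
proof (rule bimorphismI)
  fix a b
  show "corner g f b a \<bullet> symm M (vtx f a) (vtx g b) \<in> Mor C"
    "Dom C (corner g f b a \<bullet> symm M (vtx f a) (vtx g b)) = vtx f a \<star>\<^sub>o vtx g b"
    "Cod C (corner g f b a \<bullet> symm M (vtx f a) (vtx g b)) = vtx (g \<box> f) (a \<and> b)"
    using f g by (simp_all add: conj_commute)
  let ?l = "(corner g f b a \<bullet> symm M (vtx f a) (vtx g b)) \<bullet> (edg f a \<star> \<one> (vtx g b))"
  let ?r = "edg (g \<box> f) (a \<and> b) \<bullet> corner g f b False \<bullet> symm M (vtx f False) (vtx g b)"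
  have "?l = (corner g f b a \<bullet> (\<one> (vtx g b) \<star> edg f a)) \<bullet> symm M (Dom C f) (vtx g b)"
    using f g by (simp add: symm_nat)
  also have "\<dots> = ?r"
    using f g by (simp add: corner_edge conj_commute)
  finally show "?l = ?r" .
  let ?l = "(corner g f b a \<bullet> symm M (vtx f a) (vtx g b)) \<bullet> (\<one> (vtx f a) \<star> edg g b)"
  let ?r = "edg (g \<box> f) (a \<and> b) \<bullet> corner g f False a \<bullet> symm M (vtx f a) (vtx g False)"
  have "?l = (corner g f b a \<bullet> (edg g b \<star> \<one> (vtx f a))) \<bullet> symm M (vtx f a) (Dom C g)"
    using f g by (simp add: symm_nat)
  also have "\<dots> = ?r"
    using f g by (simp add: corner_edge conj_commute)
  finally show "?l = ?r" .
qed

lemma box_symm: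
  assumes f: "f \<in> Mor C" and g: "g \<in> Mor C"
  shows "box_symm f g \<in> hom (Arr C) (f \<box> g) (g \<box> f)"
    and "component (box_symm f g) (a \<and> b) \<bullet> corner f g a b = corner g f b a \<bullet> symm M (vtx f a) (vtx g b)"
  using theI'[OF box_lift[OF bimorphism_symm[OF f g]], folded box_symm_def] f g by auto

lemma component_box_symm_comp:
  assumes f: "f \<in> Mor C" and g: "g \<in> Mor C"
    and z: "z \<in> Mor C" "Cod C z = vtx f a \<star>\<^sub>o vtx g b"
  shows "component (box_symm f g) (a \<and> b) \<bullet> corner f g a b \<bullet> z
     = corner g f b a \<bullet> symm M (vtx f a) (vtx g b) \<bullet> z"
  using Arr_homD[OF box_symm(1)[OF f g]] f g z
  by (intro comp_reassoc[OF box_symm(2)[OF f g], THEN trans]) (simp_all add: conj_commute)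

text \<open>The inverse of the associator starts from \<open>f \<box> (g \<box> h)\<close>, but the lifting property is available for the
  other bracketing only. It is therefore applied to \<open>(g \<box> h) \<box> f\<close>, with the symmetry of \<open>C\<close> built
  into the family.\<close>

lemma trimorphism_assoc_inv:
  assumes f: "f \<in> Mor C" and g: "g \<in> Mor C" and h: "h \<in> Mor C"
  shows "trimorphism g h f ((f \<box> g) \<box> h) (\<lambda>b c a. corner (f \<box> g) h (a \<and> b) c \<bullet>
    (corner f g a b \<star> \<one> (vtx h c)) \<bullet> assoc_inv (vtx f a) (vtx g b) (vtx h c) \<bullet>
    symm M (vtx g b \<star>\<^sub>o vtx h c) (vtx f a))"
  unfolding trimorphism_def
proof (intro allI conjI)
  fix b c a
  let ?A = "vtx f a" and ?B = "vtx g b" and ?C = "vtx h c"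
  let ?E = "edg ((f \<box> g) \<box> h) (b \<and> c \<and> a)"
  let ?T = "\<lambda>b c a. corner (f \<box> g) h (a \<and> b) c \<bullet>
    (corner f g a b \<star> \<one> (vtx h c)) \<bullet> assoc_inv (vtx f a) (vtx g b) (vtx h c) \<bullet>
    symm M (vtx g b \<star>\<^sub>o vtx h c) (vtx f a)"
  have idx: "((a \<and> b) \<and> c) = (b \<and> c \<and> a)" by blast
  note [simp] = f g h
  show "?T b c a \<in> hom C ((?B \<star>\<^sub>o ?C) \<star>\<^sub>o ?A) (vtx ((f \<box> g) \<box> h) (b \<and> c \<and> a))"
    using idx by (simp add: hom_def)
  have "?T b c a \<bullet> ((edg g b \<star> \<one> ?C) \<star> \<one> ?A)
     = corner (f \<box> g) h (a \<and> b) c \<bullet> ((corner f g a b \<bullet> (\<one> ?A \<star> edg g b)) \<star> \<one> ?C) \<bullet>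
         assoc_inv ?A (Dom C g) ?C \<bullet> symm M (Dom C g \<star>\<^sub>o ?C) ?A"
    by (simp add: symm_nat assoc_inv_nat[THEN comp_reassoc] interchange')
  also have "\<dots> = (corner (f \<box> g) h (a \<and> b) c \<bullet> (edg (f \<box> g) (a \<and> b) \<star> \<one> ?C)) \<bullet>
      (corner f g a False \<star> \<one> ?C) \<bullet> assoc_inv ?A (Dom C g) ?C \<bullet> symm M (Dom C g \<star>\<^sub>o ?C) ?A"
    by (simp add: corner_edge(2)[OF f g] interchange')
  also have "\<dots> = ?E \<bullet> ?T False c a"
    using idx by (simp add: corner_edge(1))
  finally show "?T b c a \<bullet> ((edg g b \<star> \<one> ?C) \<star> \<one> ?A) = ?E \<bullet> ?T False c a" .
  have "?T b c a \<bullet> ((\<one> ?B \<star> edg h c) \<star> \<one> ?A)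
     = (corner (f \<box> g) h (a \<and> b) c \<bullet> (\<one> (vtx (f \<box> g) (a \<and> b)) \<star> edg h c)) \<bullet>
         (corner f g a b \<star> \<one> (Dom C h)) \<bullet> assoc_inv ?A ?B (Dom C h) \<bullet> symm M (?B \<star>\<^sub>o Dom C h) ?A"
    by (simp add: symm_nat assoc_inv_nat[THEN comp_reassoc] interchange')
  also have "\<dots> = ?E \<bullet> ?T b False a"
    using idx by (simp add: corner_edge(2))
  finally show "?T b c a \<bullet> ((\<one> ?B \<star> edg h c) \<star> \<one> ?A) = ?E \<bullet> ?T b False a" .
  have "?T b c a \<bullet> (\<one> (?B \<star>\<^sub>o ?C) \<star> edg f a)
     = corner (f \<box> g) h (a \<and> b) c \<bullet> ((corner f g a b \<bullet> (edg f a \<star> \<one> ?B)) \<star> \<one> ?C) \<bullet>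
         assoc_inv (Dom C f) ?B ?C \<bullet> symm M (?B \<star>\<^sub>o ?C) (Dom C f)"
    by (simp add: symm_nat assoc_inv_nat_ident[THEN comp_reassoc] interchange')
  also have "\<dots> = (corner (f \<box> g) h (a \<and> b) c \<bullet> (edg (f \<box> g) (a \<and> b) \<star> \<one> ?C)) \<bullet>
      (corner f g False b \<star> \<one> ?C) \<bullet> assoc_inv (Dom C f) ?B ?C \<bullet> symm M (?B \<star>\<^sub>o ?C) (Dom C f)"
    by (simp add: corner_edge(1)[OF f g] interchange')
  also have "\<dots> = ?E \<bullet> ?T b c False"
    using idx by (simp add: corner_edge(1))
  finally show "?T b c a \<bullet> (\<one> (?B \<star>\<^sub>o ?C) \<star> edg f a) = ?E \<bullet> ?T b c False" .
qed

text \<open>The lift from \<open>(g \<box> h) \<box> f\<close>, preceded by the symmetry, restricts on corners to the inverse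
  associator of \<open>C\<close>. Both composites are then identities on corners.\<close>

lemma box_assoc_iso:
  assumes f: "f \<in> Mor C" and g: "g \<in> Mor C" and h: "h \<in> Mor C"
  shows "is_iso (Arr C) (box_assoc f g h)"
proof -
  note [simp] = f g h
  obtain r where r: "r \<in> hom (Arr C) ((g \<box> h) \<box> f) ((f \<box> g) \<box> h)"
    and rc: "\<And>b c a. component r (b \<and> c \<and> a) \<bullet> corner (g \<box> h) f (b \<and> c) a \<bullet> (corner g h b c \<star> \<one> (vtx f a))
      = corner (f \<box> g) h (a \<and> b) c \<bullet> (corner f g a b \<star> \<one> (vtx h c)) \<bullet>
        assoc_inv (vtx f a) (vtx g b) (vtx h c) \<bullet>
        symm M (vtx g b \<star>\<^sub>o vtx h c) (vtx f a)"
    using box3_lift[OF trimorphism_assoc_inv[OF f g h]] by auto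
  let ?S = "box_symm f (g \<box> h)" and ?A = "box_assoc f g h"
  have S: "?S \<in> hom (Arr C) (f \<box> (g \<box> h)) ((g \<box> h) \<box> f)" by (simp add: box_symm)
  have A: "?A \<in> hom (Arr C) ((f \<box> g) \<box> h) (f \<box> (g \<box> h))" by (simp add: box_assoc)
  note D = Arr_homD[OF r] Arr_homD[OF S] Arr_homD[OF A]
  define t where "t = r \<odot> ?S"
  have t: "t \<in> hom (Arr C) (f \<box> (g \<box> h)) ((f \<box> g) \<box> h)"
    unfolding t_def by (rule Arr.Comp_in_hom[OF S r])
  note tD = Arr_homD[OF t]
  have tc: "component t (a \<and> b \<and> c) \<bullet> corner f (g \<box> h) a (b \<and> c) \<bullet> (\<one> (vtx f a) \<star> corner g h b c)
    = corner (f \<box> g) h (a \<and> b) c \<bullet> (corner f g a b \<star> \<one> (vtx h c)) \<bullet>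
        assoc_inv (vtx f a) (vtx g b) (vtx h c)" (is "?l a b c = _") for a b c
  proof -
    have idx: "(b \<and> c \<and> a) = (a \<and> b \<and> c)" by blast
    have "?l a b c = component r (a \<and> b \<and> c) \<bullet> component ?S (a \<and> b \<and> c) \<bullet> corner f (g \<box> h) a (b \<and> c) \<bullet>
        (\<one> (vtx f a) \<star> corner g h b c)"
      using D by (simp add: t_def)
    also have "\<dots> = component r (a \<and> b \<and> c) \<bullet> corner (g \<box> h) f (b \<and> c) a \<bullet>
        symm M (vtx f a) (vtx (g \<box> h) (b \<and> c)) \<bullet> (\<one> (vtx f a) \<star> corner g h b c)"
      by (simp add: component_box_symm_comp)
    also have "\<dots> = (component r (b \<and> c \<and> a) \<bullet> corner (g \<box> h) f (b \<and> c) a \<bullet> (corner g h b c \<star> \<one> (vtx f a))) \<bullet>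
        symm M (vtx f a) (vtx g b \<star>\<^sub>o vtx h c)"
      using D idx by (simp add: symm_nat)
    also have "\<dots> = corner (f \<box> g) h (a \<and> b) c \<bullet> (corner f g a b \<star> \<one> (vtx h c)) \<bullet>
        assoc_inv (vtx f a) (vtx g b) (vtx h c)"
      unfolding rc by simp
    finally show ?thesis .
  qed
  have "t \<odot> ?A = \<one>\<^sub>A ((f \<box> g) \<box> h)"
  proof (rule box3_hom_eqI[OF Arr.Comp_in_hom[OF A t] Arr.Ident_in_hom f g h])
    fix a b c
    have "component (t \<odot> ?A) (a \<and> b \<and> c) \<bullet> corner (f \<box> g) h (a \<and> b) c \<bullet> (corner f g a b \<star> \<one> (vtx h c))
      = component t (a \<and> b \<and> c) \<bullet> corner f (g \<box> h) a (b \<and> c) \<bullet> (\<one> (vtx f a) \<star> corner g h b c) \<bullet>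
           assoc M (vtx f a) (vtx g b) (vtx h c)"
      using D tD by (simp add: box_assoc(2))
    also have "\<dots> = (component t (a \<and> b \<and> c) \<bullet> corner f (g \<box> h) a (b \<and> c) \<bullet> (\<one> (vtx f a) \<star> corner g h b c)) \<bullet>
           assoc M (vtx f a) (vtx g b) (vtx h c)"
      using tD by simp
    also have "\<dots> = corner (f \<box> g) h (a \<and> b) c \<bullet> (corner f g a b \<star> \<one> (vtx h c))"
      unfolding tc by simp
    finally show "component (t \<odot> ?A) (a \<and> b \<and> c) \<bullet> corner (f \<box> g) h (a \<and> b) c \<bullet> (corner f g a b \<star> \<one> (vtx h c))
      = component (\<one>\<^sub>A ((f \<box> g) \<box> h)) (a \<and> b \<and> c) \<bullet> corner (f \<box> g) h (a \<and> b) c \<bullet> (corner f g a b \<star> \<one> (vtx h c))"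
      by simp
  qed simp
  moreover have "?A \<odot> t = \<one>\<^sub>A (f \<box> (g \<box> h))"
  proof (rule box3_right_hom_eqI[OF Arr.Comp_in_hom[OF t A] Arr.Ident_in_hom f g h])
    fix a b c
    have "component (?A \<odot> t) (a \<and> b \<and> c) \<bullet> corner f (g \<box> h) a (b \<and> c) \<bullet> (\<one> (vtx f a) \<star> corner g h b c)
      = component ?A (a \<and> b \<and> c) \<bullet> corner (f \<box> g) h (a \<and> b) c \<bullet> (corner f g a b \<star> \<one> (vtx h c)) \<bullet>
        assoc_inv (vtx f a) (vtx g b) (vtx h c)"
      using D tD by (simp add: tc)
    also have "\<dots> = corner f (g \<box> h) a (b \<and> c) \<bullet> (\<one> (vtx f a) \<star> corner g h b c)"
      by (simp add: component_box_assoc_comp)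
    finally show "component (?A \<odot> t) (a \<and> b \<and> c) \<bullet> corner f (g \<box> h) a (b \<and> c) \<bullet> (\<one> (vtx f a) \<star> corner g h b c)
      = component (\<one>\<^sub>A (f \<box> (g \<box> h))) (a \<and> b \<and> c) \<bullet> corner f (g \<box> h) a (b \<and> c) \<bullet> (\<one> (vtx f a) \<star> corner g h b c)"
      by simp
  qed simp
  ultimately show ?thesis by (rule Arr.is_isoI[OF A t])
qed

section \<open>Units of the pushout product\<close>

lemma initial_obj: "is_initial C (initial_obj C)"
  unfolding initial_obj_def using ex_initial by (rule someI_ex)

lemma L1_simps [simp]:
  assumes "X \<in> Obj C"
  shows "L1 C X \<in> Mor C" "Dom C (L1 C X) = initial_obj C" "Cod C (L1 C X) = X"
proof -
  have "\<exists>!h. h \<in> hom C (initial_obj C) X" using initial_obj assms by (simp add: is_initial_def)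
  from theI'[OF this] show "L1 C X \<in> Mor C" "Dom C (L1 C X) = initial_obj C" "Cod C (L1 C X) = X"
    by (simp_all add: L1_def from_initial_def hom_def)
qed

lemma initial_hom: "is_initial C Z \<Longrightarrow> X \<in> Obj C \<Longrightarrow> \<exists>!h. h \<in> hom C Z X"
  by (simp add: is_initial_def)

lemma initial_obj_in_Obj [simp]: "initial_obj C \<in> Obj C"
  using initial_obj by (simp add: is_initial_def)

text \<open>Tensoring with an object is a left adjoint, so it preserves initial objects.\<close>

lemma initial_tens:
  assumes Z: "is_initial C Z" and X: "X \<in> Obj C"
  shows "is_initial C (Z \<star>\<^sub>o X)" "is_initial C (X \<star>\<^sub>o Z)"
proof -
  have Z0: "Z \<in> Obj C" using Z by (simp add: is_initial_def)
  have je: "joint_epi (Z \<star>\<^sub>o X) {}" "joint_epi (X \<star>\<^sub>o Z) {}"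
    using joint_epi_tens_right[OF initial_joint_epi[OF Z] X]
      joint_epi_tens_left[OF initial_joint_epi[OF Z] X] by simp_all
  have uniq: "k = k'" if "joint_epi A {}" "k \<in> hom C A W" "k' \<in> hom C A W" for A W k k'
    using joint_epiD[OF that(1)] that(2,3) by (auto simp: hom_def)
  have ex: "\<exists>h. h \<in> hom C (Z \<star>\<^sub>o X) W" "\<exists>h. h \<in> hom C (X \<star>\<^sub>o Z) W" if W: "W \<in> Obj C" for W
  proof -
    obtain l where "l \<in> hom C Z (ihom M X W)"
      using Z X W unfolding is_initial_def by (meson ihom_simps(1))
    then have "uncurry X W l \<in> hom C (Z \<star>\<^sub>o X) W" "uncurry X W l \<bullet> symm M X Z \<in> hom C (X \<star>\<^sub>o Z) W"
      using X W Z0 by (simp_all add: hom_def)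
    then show "\<exists>h. h \<in> hom C (Z \<star>\<^sub>o X) W" "\<exists>h. h \<in> hom C (X \<star>\<^sub>o Z) W" by blast+
  qed
  show "is_initial C (Z \<star>\<^sub>o X)" "is_initial C (X \<star>\<^sub>o Z)"
    unfolding is_initial_def using X Z0 ex uniq[OF je(1)] uniq[OF je(2)]
    by (simp_all, blast+)
qed

lemma initial_eqI:
  assumes "is_initial C Z" "k \<in> Mor C" "k' \<in> Mor C" "Dom C k = Z" "Dom C k' = Z" "Cod C k = Cod C k'"
  shows "k = k'"
  using joint_epiD[OF initial_joint_epi[OF assms(1)]] assms by blast

abbreviation box_unit ("\<J>") where "\<J> \<equiv> L1 C \<I>"

lemma initial_vertex_tens:
  assumes "f \<in> Mor C"
  shows "is_initial C (initial_obj C \<star>\<^sub>o vtx f b)" "is_initial C (vtx f b \<star>\<^sub>o initial_obj C)"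
  using assms by (simp_all add: initial_tens[OF initial_obj])

text \<open>Corners that involve the vertex \<open>0\<close> of the unit have an initial source. Hence maps out of
  \<open>\<J> \<box> f\<close> are determined by the corners \<open>(1, b)\<close>, whose sources are \<open>S \<otimes> f(b)\<close>.\<close>

lemma L1_box_eqI:
  assumes s: "s \<in> hom (Arr C) (\<J> \<box> f) q" and t: "t \<in> hom (Arr C) (\<J> \<box> f) q" and f: "f \<in> Mor C"
    and eq: "\<And>b. component s b \<bullet> corner \<J> f True b = component t b \<bullet> corner \<J> f True b"
  shows "s = t"
proof (rule box_hom_eqI[OF s t _ f])
  fix a b
  show "component s (a \<and> b) \<bullet> corner \<J> f a b = component t (a \<and> b) \<bullet> corner \<J> f a b"
  proof (cases a)
    case False
    then show ?thesis
      using f Arr_homD[OF s] Arr_homD[OF t]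
      by (intro initial_eqI[OF initial_vertex_tens(1)[OF f, of b]]) simp_all
  qed (use eq in simp)
qed simp

lemma box_L1_eqI:
  assumes s: "s \<in> hom (Arr C) (f \<box> \<J>) q" and t: "t \<in> hom (Arr C) (f \<box> \<J>) q" and f: "f \<in> Mor C"
    and eq: "\<And>a. component s a \<bullet> corner f \<J> a True = component t a \<bullet> corner f \<J> a True"
  shows "s = t"
proof (rule box_hom_eqI[OF s t f])
  fix a b
  show "component s (a \<and> b) \<bullet> corner f \<J> a b = component t (a \<and> b) \<bullet> corner f \<J> a b"
  proof (cases b)
    case False
    then show ?thesis
      using f Arr_homD[OF s] Arr_homD[OF t]
      by (intro initial_eqI[OF initial_vertex_tens(2)[OF f, of a]]) simp_all
  qed (use eq in simp)
qed simp

definition box_lunit :: "'m \<Rightarrow> 'm square" where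
  "box_lunit f = (THE s. s \<in> hom (Arr C) (\<J> \<box> f) f \<and>
     (\<forall>b. component s b \<bullet> corner \<J> f True b = lunit M (vtx f b)))"

definition box_runit :: "'m \<Rightarrow> 'm square" where
  "box_runit f = (THE s. s \<in> hom (Arr C) (f \<box> \<J>) f \<and>
     (\<forall>a. component s a \<bullet> corner f \<J> a True = runit M (vtx f a)))"

lemma box_lunit:
  assumes f: "f \<in> Mor C"
  shows "box_lunit f \<in> hom (Arr C) (\<J> \<box> f) f"
    and "component (box_lunit f) b \<bullet> corner \<J> f True b = lunit M (vtx f b)"
proof -
  \<comment> \<open>On the corners \<open>(0, b)\<close> the family has to be the unique map from an initial object.\<close>
  define z where "z b = (THE h. h \<in> hom C (initial_obj C \<star>\<^sub>o vtx f b) (Dom C f))" for b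
  have z: "z b \<in> hom C (initial_obj C \<star>\<^sub>o vtx f b) (Dom C f)" for b
    unfolding z_def by (rule theI', rule initial_hom) (simp_all add: f initial_vertex_tens)
  have z': "z b \<in> Mor C" "Dom C (z b) = initial_obj C \<star>\<^sub>o vtx f b" "Cod C (z b) = Dom C f" for b
    using z[of b] by (simp_all add: hom_def)
  define k where "k a b = (if a then lunit M (vtx f b) else z b)" for a b
  have "bimorphism \<J> f f k"
    unfolding bimorphism_def
  proof (intro conjI allI)
    fix a b
    show "k a b \<in> hom C (vtx \<J> a \<star>\<^sub>o vtx f b) (vtx f (a \<and> b))"
      using f z by (simp add: k_def hom_def z')
    show "k True b \<bullet> (\<J> \<star> \<one> (vtx f b)) = edg f b \<bullet> k False b"
      using f z' by (intro initial_eqI[OF initial_vertex_tens(1)[OF f, of b]]) (simp_all add: k_def)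
    show "k a True \<bullet> (\<one> (vtx \<J> a) \<star> f) = edg f a \<bullet> k a False"
    proof (cases a)
      case True
      then show ?thesis using f by (simp add: k_def lunit_nat)
    next
      case False
      then show ?thesis using f z'
        by (intro initial_eqI[OF initial_vertex_tens(1)[OF f, of False]]) (simp_all add: k_def)
    qed
  qed
  then obtain s where s: "s \<in> hom (Arr C) (\<J> \<box> f) f" "\<And>a b. component s (a \<and> b) \<bullet> corner \<J> f a b = k a b"
    using box_lift[of \<J> f f k] f by auto
  have "\<exists>!s. s \<in> hom (Arr C) (\<J> \<box> f) f \<and>
     (\<forall>b. component s b \<bullet> corner \<J> f True b = lunit M (vtx f b))"
    using s(1) s(2)[of True] by (intro ex1I[of _ s]) (auto simp: k_def intro!: L1_box_eqI[OF _ _ f])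
  from theI'[OF this, folded box_lunit_def]
  show "box_lunit f \<in> hom (Arr C) (\<J> \<box> f) f"
    "component (box_lunit f) b \<bullet> corner \<J> f True b = lunit M (vtx f b)" by blast+
qed

lemma box_runit:
  assumes f: "f \<in> Mor C"
  shows "box_runit f \<in> hom (Arr C) (f \<box> \<J>) f"
    and "component (box_runit f) a \<bullet> corner f \<J> a True = runit M (vtx f a)"
proof -
  define z where "z b = (THE h. h \<in> hom C (vtx f b \<star>\<^sub>o initial_obj C) (Dom C f))" for b
  have z: "z b \<in> hom C (vtx f b \<star>\<^sub>o initial_obj C) (Dom C f)" for b
    unfolding z_def by (rule theI', rule initial_hom) (simp_all add: f initial_vertex_tens)
  have z': "z b \<in> Mor C" "Dom C (z b) = vtx f b \<star>\<^sub>o initial_obj C" "Cod C (z b) = Dom C f" for b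
    using z[of b] by (simp_all add: hom_def)
  define k where "k a b = (if b then runit M (vtx f a) else z a)" for a b
  have "bimorphism f \<J> f k"
    unfolding bimorphism_def
  proof (intro conjI allI)
    fix a b
    show "k a b \<in> hom C (vtx f a \<star>\<^sub>o vtx \<J> b) (vtx f (a \<and> b))"
      using f z by (simp add: k_def hom_def z')
    show "k a True \<bullet> (\<one> (vtx f a) \<star> \<J>) = edg f a \<bullet> k a False"
      using f z' by (intro initial_eqI[OF initial_vertex_tens(2)[OF f, of a]]) (simp_all add: k_def)
    show "k True b \<bullet> (f \<star> \<one> (vtx \<J> b)) = edg f b \<bullet> k False b"
    proof (cases b)
      case True
      then show ?thesis using f by (simp add: k_def runit_nat)
    next
      case False
      then show ?thesis using f z'
        by (intro initial_eqI[OF initial_vertex_tens(2)[OF f, of False]]) (simp_all add: k_def)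
    qed
  qed
  then obtain s where s: "s \<in> hom (Arr C) (f \<box> \<J>) f" "\<And>a b. component s (a \<and> b) \<bullet> corner f \<J> a b = k a b"
    using box_lift[of f \<J> f k] f by auto
  have "\<exists>!s. s \<in> hom (Arr C) (f \<box> \<J>) f \<and>
     (\<forall>a. component s a \<bullet> corner f \<J> a True = runit M (vtx f a))"
    using s(1) s(2)[of _ True] by (intro ex1I[of _ s]) (auto simp: k_def intro!: box_L1_eqI[OF _ _ f])
  from theI'[OF this, folded box_runit_def]
  show "box_runit f \<in> hom (Arr C) (f \<box> \<J>) f"
    "component (box_runit f) a \<bullet> corner f \<J> a True = runit M (vtx f a)" by blast+
qed

text \<open>The inverse at the vertex \<open>b\<close> is the inverse unitor of \<open>C\<close> followed by the corner \<open>(1, b)\<close>.\<close>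

lemma box_lunit_iso:
  assumes f: "f \<in> Mor C"
  shows "is_iso (Arr C) (box_lunit f)"
proof -
  note l = box_lunit[OF f] note lD = Arr_homD[OF l(1)]
  define v where "v b = corner \<J> f True b \<bullet> inverse_mor (lunit M (vtx f b))" for b
  have v: "v b \<in> Mor C" "Dom C (v b) = vtx f b" "Cod C (v b) = vtx (\<J> \<box> f) b" for b
    using f by (simp_all add: v_def)
  let ?t = "Square f (\<J> \<box> f) (v False) (v True)"
  have tc: "component ?t b = v b" for b by (cases b) simp_all
  have "inverse_mor (lunit M (Cod C f)) \<bullet> f = (\<one> \<I> \<star> f) \<bullet> inverse_mor (lunit M (Dom C f))"
    using f by (intro inverse_natural) (simp_all add: lunit_nat)
  then have "v True \<bullet> f = (corner \<J> f True True \<bullet> (\<one> \<I> \<star> f)) \<bullet> inverse_mor (lunit M (Dom C f))"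
    using f by (simp add: v_def)
  also have "\<dots> = (\<J> \<box> f) \<bullet> v False"
    using f corner_edge(2)[of \<J> f True True] by (simp add: v_def)
  finally have t: "?t \<in> hom (Arr C) f (\<J> \<box> f)"
    using f v by (intro Arr_homI) (simp_all add: tc)
  have lv: "component (box_lunit f) b \<bullet> v b = \<one> (vtx f b)" for b
  proof -
    have "component (box_lunit f) b \<bullet> v b
      = (component (box_lunit f) b \<bullet> corner \<J> f True b) \<bullet> inverse_mor (lunit M (vtx f b))"
      using f lD by (simp add: v_def)
    then show ?thesis unfolding l(2) using f by simp
  qed
  have "box_lunit f \<odot> ?t = \<one>\<^sub>A f"
    using f by (intro Arr_hom_eqI[OF Arr.Comp_in_hom[OF t l(1)] Arr.Ident_in_hom]) (simp_all add: tc lv del: component_Square)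
  moreover have "?t \<odot> box_lunit f = \<one>\<^sub>A (\<J> \<box> f)"
  proof (rule L1_box_eqI[OF Arr.Comp_in_hom[OF l(1) t] Arr.Ident_in_hom f])
    fix b
    have "component (?t \<odot> box_lunit f) b \<bullet> corner \<J> f True b = v b \<bullet> lunit M (vtx f b)"
      using f lD v by (simp add: tc l(2) del: component_Square)
    then show "component (?t \<odot> box_lunit f) b \<bullet> corner \<J> f True b
        = component (\<one>\<^sub>A (\<J> \<box> f)) b \<bullet> corner \<J> f True b"
      using f by (simp add: v_def)
  qed (use f in simp)
  ultimately show ?thesis by (intro Arr.is_isoI[OF l(1) t])
qed

lemma box_runit_iso:
  assumes f: "f \<in> Mor C"
  shows "is_iso (Arr C) (box_runit f)"
proof -
  note l = box_runit[OF f] note lD = Arr_homD[OF l(1)]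
  define v where "v a = corner f \<J> a True \<bullet> inverse_mor (runit M (vtx f a))" for a
  have v: "v b \<in> Mor C" "Dom C (v b) = vtx f b" "Cod C (v b) = vtx (f \<box> \<J>) b" for b
    using f by (simp_all add: v_def)
  let ?t = "Square f (f \<box> \<J>) (v False) (v True)"
  have tc: "component ?t b = v b" for b by (cases b) simp_all
  have "inverse_mor (runit M (Cod C f)) \<bullet> f = (f \<star> \<one> \<I>) \<bullet> inverse_mor (runit M (Dom C f))"
    using f by (intro inverse_natural) (simp_all add: runit_nat)
  then have "v True \<bullet> f = (corner f \<J> True True \<bullet> (f \<star> \<one> \<I>)) \<bullet> inverse_mor (runit M (Dom C f))"
    using f by (simp add: v_def)
  also have "\<dots> = (f \<box> \<J>) \<bullet> v False"
    using f corner_edge(1)[of f \<J> True True] by (simp add: v_def)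
  finally have t: "?t \<in> hom (Arr C) f (f \<box> \<J>)"
    using f v by (intro Arr_homI) (simp_all add: tc)
  have lv: "component (box_runit f) b \<bullet> v b = \<one> (vtx f b)" for b
  proof -
    have "component (box_runit f) b \<bullet> v b
      = (component (box_runit f) b \<bullet> corner f \<J> b True) \<bullet> inverse_mor (runit M (vtx f b))"
      using f lD by (simp add: v_def)
    then show ?thesis unfolding l(2) using f by simp
  qed
  have "box_runit f \<odot> ?t = \<one>\<^sub>A f"
    using f by (intro Arr_hom_eqI[OF Arr.Comp_in_hom[OF t l(1)] Arr.Ident_in_hom]) (simp_all add: tc lv del: component_Square)
  moreover have "?t \<odot> box_runit f = \<one>\<^sub>A (f \<box> \<J>)"
  proof (rule box_L1_eqI[OF Arr.Comp_in_hom[OF l(1) t] Arr.Ident_in_hom f])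
    fix b
    have "component (?t \<odot> box_runit f) b \<bullet> corner f \<J> b True = v b \<bullet> runit M (vtx f b)"
      using f lD v by (simp add: tc l(2) del: component_Square)
    then show "component (?t \<odot> box_runit f) b \<bullet> corner f \<J> b True
        = component (\<one>\<^sub>A (f \<box> \<J>)) b \<bullet> corner f \<J> b True"
      using f by (simp add: v_def)
  qed (use f in simp)
  ultimately show ?thesis by (intro Arr.is_isoI[OF l(1) t])
qed

section \<open>Coherence of the pushout product\<close>

lemma box_square_ident:
  assumes f: "f \<in> Mor C" and g: "g \<in> Mor C"
  shows "box_square C M (\<one>\<^sub>A f) (\<one>\<^sub>A g) = \<one>\<^sub>A (f \<box> g)"
proof (rule box_hom_eqI[OF box_square(1) Arr.Ident_in_hom f g])
  fix a b
  show "component (box_square C M (\<one>\<^sub>A f) (\<one>\<^sub>A g)) (a \<and> b) \<bullet> corner f g a b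
      = component (\<one>\<^sub>A (f \<box> g)) (a \<and> b) \<bullet> corner f g a b"
    using f g by (subst box_square(2)[OF Arr.Ident_in_hom Arr.Ident_in_hom]) simp_all
qed (use f g Arr.Ident_in_hom in simp_all)

lemma box_square_comp:
  assumes s: "s \<in> hom (Arr C) f f'" and s': "s' \<in> hom (Arr C) f' f''"
    and t: "t \<in> hom (Arr C) g g'" and t': "t' \<in> hom (Arr C) g' g''"
  shows "box_square C M (s' \<odot> s) (t' \<odot> t)
    = box_square C M s' t' \<odot> box_square C M s t"
proof -
  note S = Arr.Comp_in_hom[OF s s'] and T = Arr.Comp_in_hom[OF t t']
  note D = Arr_homD[OF s] Arr_homD[OF s'] Arr_homD[OF t] Arr_homD[OF t']
    Arr_homD[OF box_square(1)[OF s t]] Arr_homD[OF box_square(1)[OF s' t']]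
  show ?thesis
  proof (rule box_hom_eqI[OF box_square(1)[OF S T] Arr.Comp_in_hom[OF box_square(1)[OF s t] box_square(1)[OF s' t']]])
    fix a b
    let ?l = "component (box_square C M (s' \<odot> s) (t' \<odot> t)) (a \<and> b) \<bullet> corner f g a b"
    let ?r = "component (box_square C M s' t' \<odot> box_square C M s t) (a \<and> b) \<bullet> corner f g a b"
    have "?l = corner f'' g'' a b \<bullet> (component s' a \<star> component t' b) \<bullet> (component s a \<star> component t b)"
      using D by (simp add: box_square(2)[OF S T] interchange)
    also have "\<dots> = component (box_square C M s' t') (a \<and> b) \<bullet> corner f' g' a b \<bullet> (component s a \<star> component t b)"
      using D by (simp add: component_box_square_comp[OF s' t'])
    also have "\<dots> = ?r"
      using D by (simp add: box_square(2)[OF s t])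
    finally show "?l = ?r" .
  qed (use D in simp_all)
qed

lemma box_assoc_natural:
  assumes r: "r \<in> hom (Arr C) f f'" and s: "s \<in> hom (Arr C) g g'" and t: "t \<in> hom (Arr C) h h'"
  shows "box_assoc f' g' h' \<odot> box_square C M (box_square C M r s) t
    = box_square C M r (box_square C M s t) \<odot> box_assoc f g h"
proof -
  note rs = box_square(1)[OF r s] and st = box_square(1)[OF s t]
  note rst = box_square(1)[OF rs t] and rst' = box_square(1)[OF r st]
  note D = Arr_homD[OF r] Arr_homD[OF s] Arr_homD[OF t]
  have [simp]: "f \<in> Mor C" "f' \<in> Mor C" "g \<in> Mor C" "g' \<in> Mor C" "h \<in> Mor C" "h' \<in> Mor C"
    using D by simp_all
  note A = box_assoc(1)[of f g h] and A' = box_assoc(1)[of f' g' h']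
  note D = D Arr_homD[OF rs] Arr_homD[OF st] Arr_homD[OF rst] Arr_homD[OF rst']
    Arr_homD[OF A, simplified] Arr_homD[OF A', simplified]
  show ?thesis
  proof (rule box3_hom_eqI[of _ f g h "f' \<box> (g' \<box> h')"])
    fix a b c
    let ?K = "corner (f \<box> g) h (a \<and> b) c \<bullet> (corner f g a b \<star> \<one> (vtx h c))"
    let ?A = "component r a" and ?B = "component s b" and ?C = "component t c"
    let ?\<alpha> = "assoc M (vtx f' a) (vtx g' b) (vtx h' c)"
    let ?l = "component (box_assoc f' g' h' \<odot> box_square C M (box_square C M r s) t) (a \<and> b \<and> c) \<bullet> ?K"
    let ?r = "component (box_square C M r (box_square C M s t) \<odot> box_assoc f g h) (a \<and> b \<and> c) \<bullet> ?K"
    have "?l = component (box_assoc f' g' h') (a \<and> b \<and> c) \<bullet>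
          component (box_square C M (box_square C M r s) t) ((a \<and> b) \<and> c) \<bullet> ?K"
      using D by simp
    also have "\<dots> = component (box_assoc f' g' h') (a \<and> b \<and> c) \<bullet> corner (f' \<box> g') h' (a \<and> b) c \<bullet>
        (component (box_square C M r s) (a \<and> b) \<star> ?C) \<bullet> (corner f g a b \<star> \<one> (vtx h c))"
      using D by (subst component_box_square_comp[OF rs t]) simp_all
    also have "\<dots> = component (box_assoc f' g' h') (a \<and> b \<and> c) \<bullet> corner (f' \<box> g') h' (a \<and> b) c \<bullet>
        (corner f' g' a b \<star> \<one> (vtx h' c)) \<bullet> ((?A \<star> ?B) \<star> ?C)"
      using D by (simp add: interchange box_square(2)[OF r s])
    also have "\<dots> = corner f' (g' \<box> h') a (b \<and> c) \<bullet> (\<one> (vtx f' a) \<star> corner g' h' b c) \<bullet> ?\<alpha> \<bullet> ((?A \<star> ?B) \<star> ?C)"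
      using D by (simp add: component_box_assoc_comp)
    also have "\<dots> = corner f' (g' \<box> h') a (b \<and> c) \<bullet> (?A \<star> component (box_square C M s t) (b \<and> c)) \<bullet>
        (\<one> (vtx f a) \<star> corner g h b c) \<bullet> assoc M (vtx f a) (vtx g b) (vtx h c)"
      using D by (simp add: assoc_nat interchange' box_square(2)[OF s t])
    also have "\<dots> = component (box_square C M r (box_square C M s t)) (a \<and> b \<and> c) \<bullet> corner f (g \<box> h) a (b \<and> c) \<bullet>
        (\<one> (vtx f a) \<star> corner g h b c) \<bullet> assoc M (vtx f a) (vtx g b) (vtx h c)"
      using D by (simp add: component_box_square_comp[OF r st])
    also have "\<dots> = ?r"
      using D by (simp add: box_assoc(2))
    finally show "?l = ?r" .
  qed (use A A' rst rst' in \<open>auto intro: Arr.Comp_in_hom\<close>)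
qed

lemma box_symm_natural:
  assumes s: "s \<in> hom (Arr C) f f'" and t: "t \<in> hom (Arr C) g g'"
  shows "box_symm f' g' \<odot> box_square C M s t = box_square C M t s \<odot> box_symm f g"
proof -
  note st = box_square(1)[OF s t] and ts = box_square(1)[OF t s]
  note D = Arr_homD[OF s] Arr_homD[OF t]
  have [simp]: "f \<in> Mor C" "f' \<in> Mor C" "g \<in> Mor C" "g' \<in> Mor C" using D by simp_all
  note S = box_symm(1)[of f g] and S' = box_symm(1)[of f' g']
  note D = D Arr_homD[OF st] Arr_homD[OF ts] Arr_homD[OF S, simplified] Arr_homD[OF S', simplified]
  show ?thesis
  proof (rule box_hom_eqI[of _ f g "g' \<box> f'"])
    fix a b
    let ?l = "component (box_symm f' g' \<odot> box_square C M s t) (a \<and> b) \<bullet> corner f g a b"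
    let ?r = "component (box_square C M t s \<odot> box_symm f g) (a \<and> b) \<bullet> corner f g a b"
    have "?l = corner g' f' b a \<bullet> symm M (vtx f' a) (vtx g' b) \<bullet> (component s a \<star> component t b)"
      using D by (simp add: box_square(2)[OF s t] component_box_symm_comp)
    also have "\<dots> = corner g' f' b a \<bullet> (component t b \<star> component s a) \<bullet> symm M (vtx f a) (vtx g b)"
      using D by (simp add: symm_nat)
    also have "\<dots> = component (box_square C M t s) (b \<and> a) \<bullet> corner g f b a \<bullet> symm M (vtx f a) (vtx g b)"
      using D by (simp only: component_box_square_comp[OF t s] symm_simps vertex_in_Obj_bool)
    also have "\<dots> = ?r"
      using D by (simp add: box_symm(2) conj_commute[of b a])
    finally show "?l = ?r" .
  qed (use S S' st ts in \<open>auto intro: Arr.Comp_in_hom\<close>)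
qed

lemma box_symm_symm:
  assumes f: "f \<in> Mor C" and g: "g \<in> Mor C"
  shows "box_symm g f \<odot> box_symm f g = \<one>\<^sub>A (f \<box> g)"
proof (rule box_hom_eqI[OF Arr.Comp_in_hom[OF box_symm(1)[OF f g] box_symm(1)[OF g f]] Arr.Ident_in_hom f g])
  fix a b
  note D = Arr_homD[OF box_symm(1)[OF f g]] Arr_homD[OF box_symm(1)[OF g f]]
  have "component (box_symm g f \<odot> box_symm f g) (a \<and> b) \<bullet> corner f g a b
    = component (box_symm g f) (b \<and> a) \<bullet> corner g f b a \<bullet> symm M (vtx f a) (vtx g b)"
    using D f g by (simp add: box_symm(2) conj_commute[of b a])
  also have "\<dots> = corner f g a b"
    using f g by (subst component_box_symm_comp) simp_all
  finally show "component (box_symm g f \<odot> box_symm f g) (a \<and> b) \<bullet> corner f g a b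
    = component (\<one>\<^sub>A (f \<box> g)) (a \<and> b) \<bullet> corner f g a b"
    using f g by simp
qed (use f g in simp)

lemma box_lunit_natural:
  assumes s: "s \<in> hom (Arr C) f g"
  shows "box_lunit g \<odot> box_square C M (\<one>\<^sub>A \<J>) s = s \<odot> box_lunit f"
proof -
  note D = Arr_homD[OF s]
  have [simp]: "f \<in> Mor C" "g \<in> Mor C" using D by simp_all
  have I: "\<one>\<^sub>A \<J> \<in> hom (Arr C) \<J> \<J>" by (rule Arr.Ident_in_hom) simp
  note l = box_lunit(1)[of f, simplified] box_lunit(1)[of g, simplified] and Is = box_square(1)[OF I s]
  note D = D Arr_homD[OF l(1)] Arr_homD[OF l(2)] Arr_homD[OF Is] Arr_homD[OF I]
  show ?thesis
  proof (rule L1_box_eqI[of _ f g])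
    fix b
    have "component (box_square C M (\<one>\<^sub>A \<J>) s) b \<bullet> corner \<J> f True b
       = corner \<J> g True b \<bullet> (\<one> \<I> \<star> component s b)"
      using box_square(2)[OF I s, of True b] by simp
    then have "component (box_lunit g \<odot> box_square C M (\<one>\<^sub>A \<J>) s) b \<bullet> corner \<J> f True b
      = (component (box_lunit g) b \<bullet> corner \<J> g True b) \<bullet> (\<one> \<I> \<star> component s b)"
      using D by simp
    also have "\<dots> = component s b \<bullet> lunit M (vtx f b)"
      using D by (simp only: box_lunit(2)) (simp add: lunit_nat)
    also have "\<dots> = component (s \<odot> box_lunit f) b \<bullet> corner \<J> f True b"
      using D by (simp add: box_lunit(2))
    finally show "component (box_lunit g \<odot> box_square C M (\<one>\<^sub>A \<J>) s) b \<bullet> corner \<J> f True b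
      = component (s \<odot> box_lunit f) b \<bullet> corner \<J> f True b" .
  qed (use l Is s in \<open>auto intro: Arr.Comp_in_hom\<close>)
qed

lemma box_runit_natural:
  assumes s: "s \<in> hom (Arr C) f g"
  shows "box_runit g \<odot> box_square C M s (\<one>\<^sub>A \<J>) = s \<odot> box_runit f"
proof -
  note D = Arr_homD[OF s]
  have [simp]: "f \<in> Mor C" "g \<in> Mor C" using D by simp_all
  have I: "\<one>\<^sub>A \<J> \<in> hom (Arr C) \<J> \<J>" by (rule Arr.Ident_in_hom) simp
  note l = box_runit(1)[of f, simplified] box_runit(1)[of g, simplified] and Is = box_square(1)[OF s I]
  note D = D Arr_homD[OF l(1)] Arr_homD[OF l(2)] Arr_homD[OF Is] Arr_homD[OF I]
  show ?thesis
  proof (rule box_L1_eqI[of _ f g])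
    fix b
    have "component (box_square C M s (\<one>\<^sub>A \<J>)) b \<bullet> corner f \<J> b True
       = corner g \<J> b True \<bullet> (component s b \<star> \<one> \<I>)"
      using box_square(2)[OF s I, of b True] by simp
    then have "component (box_runit g \<odot> box_square C M s (\<one>\<^sub>A \<J>)) b \<bullet> corner f \<J> b True
      = (component (box_runit g) b \<bullet> corner g \<J> b True) \<bullet> (component s b \<star> \<one> \<I>)"
      using D by simp
    also have "\<dots> = component s b \<bullet> runit M (vtx f b)"
      using D by (simp only: box_runit(2)) (simp add: runit_nat)
    also have "\<dots> = component (s \<odot> box_runit f) b \<bullet> corner f \<J> b True"
      using D by (simp add: box_runit(2))
    finally show "component (box_runit g \<odot> box_square C M s (\<one>\<^sub>A \<J>)) b \<bullet> corner f \<J> b True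
      = component (s \<odot> box_runit f) b \<bullet> corner f \<J> b True" .
  qed (use l Is s in \<open>auto intro: Arr.Comp_in_hom\<close>)
qed

text \<open>On the corners with middle index \<open>1\<close> this is the triangle of \<open>C\<close>; those with middle index
  \<open>0\<close> have an initial source.\<close>

lemma box_triangle:
  assumes f: "f \<in> Mor C" and g: "g \<in> Mor C"
  shows "box_square C M (\<one>\<^sub>A f) (box_lunit g) \<odot> box_assoc f \<J> g
    = box_square C M (box_runit f) (\<one>\<^sub>A g)"
proof -
  note [simp] = f g
  have If: "\<one>\<^sub>A f \<in> hom (Arr C) f f" and Ig: "\<one>\<^sub>A g \<in> hom (Arr C) g g"
    by (simp_all add: Arr.Ident_in_hom)
  note A = box_assoc(1)[OF f _ g, of \<J>, simplified]
  note l = box_square(1)[OF If box_lunit(1)[OF g]] and r = box_square(1)[OF box_runit(1)[OF f] Ig]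
  note D = Arr_homD[OF A] Arr_homD[OF l] Arr_homD[OF r] Arr_homD[OF box_lunit(1)[OF g]] Arr_homD[OF box_runit(1)[OF f]]
  show ?thesis
  proof (rule box3_hom_eqI[OF Arr.Comp_in_hom[OF A l] r f _ g])
    fix a b c
    let ?K = "corner (f \<box> \<J>) g (a \<and> b) c \<bullet> (corner f \<J> a b \<star> \<one> (vtx g c))"
    show "component (box_square C M (\<one>\<^sub>A f) (box_lunit g) \<odot> box_assoc f \<J> g) (a \<and> b \<and> c) \<bullet> ?K
      = component (box_square C M (box_runit f) (\<one>\<^sub>A g)) (a \<and> b \<and> c) \<bullet> ?K"
    proof (cases b)
      case False
      \<comment> \<open>Both sides are maps out of an initial object.\<close>
      have "is_initial C ((vtx f a \<star>\<^sub>o initial_obj C) \<star>\<^sub>o vtx g c)"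
        by (intro initial_tens initial_obj) simp_all
      then show ?thesis
        using D False by (elim initial_eqI) simp_all
    next
      case True
      have "component (box_square C M (\<one>\<^sub>A f) (box_lunit g) \<odot> box_assoc f \<J> g) (a \<and> b \<and> c) \<bullet> ?K
        = component (box_square C M (\<one>\<^sub>A f) (box_lunit g)) (a \<and> c) \<bullet> corner f (\<J> \<box> g) a c \<bullet>
          (\<one> (vtx f a) \<star> corner \<J> g True c) \<bullet> assoc M (vtx f a) \<I> (vtx g c)"
        using D True box_assoc(2)[of f \<J> g a True c] by simp
      also have "\<dots> = corner f g a c \<bullet> (\<one> (vtx f a) \<star> component (box_lunit g) c) \<bullet>
          (\<one> (vtx f a) \<star> corner \<J> g True c) \<bullet> assoc M (vtx f a) \<I> (vtx g c)"
        by (subst component_box_square_comp[OF If box_lunit(1)[OF g]]) simp_all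
      also have "\<dots> = corner f g a c \<bullet> (\<one> (vtx f a) \<star> lunit M (vtx g c)) \<bullet> assoc M (vtx f a) \<I> (vtx g c)"
        using D by (simp add: interchange' box_lunit(2))
      also have "\<dots> = corner f g a c \<bullet> (runit M (vtx f a) \<star> \<one> (vtx g c))"
        by (simp add: triangle)
      also have "\<dots> = corner f g a c \<bullet> (component (box_runit f) a \<star> \<one> (vtx g c)) \<bullet>
          (corner f \<J> a True \<star> \<one> (vtx g c))"
        using D by (simp add: interchange box_runit(2))
      also have "\<dots> = component (box_square C M (box_runit f) (\<one>\<^sub>A g)) (a \<and> c) \<bullet>
          corner (f \<box> \<J>) g a c \<bullet> (corner f \<J> a True \<star> \<one> (vtx g c))"
        by (subst component_box_square_comp[OF box_runit(1)[OF f] Ig]) simp_all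
      finally show ?thesis using True by simp
    qed
  qed simp
qed

text \<open>Both sides are restricted to a corner and pushed through the pushout products one factor at a
  time. They arrive at the same corner of \<open>w \<box> (x \<box> (y \<box> z))\<close>, preceded by the two sides of the
  pentagon in \<open>C\<close>.\<close>

lemma box_pentagon:
  assumes w: "w \<in> Mor C" and x: "x \<in> Mor C" and y: "y \<in> Mor C" and z: "z \<in> Mor C"
  shows "box_assoc w x (y \<box> z) \<odot> box_assoc (w \<box> x) y z =
    box_square C M (\<one>\<^sub>A w) (box_assoc x y z) \<odot> box_assoc w (x \<box> y) z
      \<odot> box_square C M (box_assoc w x y) (\<one>\<^sub>A z)"
proof -
  note [simp] = w x y z
  have Iw: "\<one>\<^sub>A w \<in> hom (Arr C) w w" and Iz: "\<one>\<^sub>A z \<in> hom (Arr C) z z"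
    by (simp_all add: Arr.Ident_in_hom)
  note A1 = box_assoc(1)[OF w x box_simps(1)[OF y z]]
  note A2 = box_assoc(1)[OF box_simps(1)[OF w x] y z]
  note A3 = box_assoc(1)[OF w box_simps(1)[OF x y] z]
  note Axyz = box_assoc(1)[OF x y z] and Awxy = box_assoc(1)[OF w x y]
  note B1 = box_square(1)[OF Iw Axyz] and B3 = box_square(1)[OF Awxy Iz]
  note D = Arr_homD[OF A1] Arr_homD[OF A2] Arr_homD[OF A3] Arr_homD[OF Axyz] Arr_homD[OF Awxy]
    Arr_homD[OF B1] Arr_homD[OF B3]
  show ?thesis
  proof (rule box4_hom_eqI[OF Arr.Comp_in_hom[OF A2 A1]
        Arr.Comp_in_hom[OF Arr.Comp_in_hom[OF B3 A3] B1] w x y z])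
    fix a b c d
    let ?W = "vtx w a" and ?X = "vtx x b" and ?Y = "vtx y c" and ?Z = "vtx z d"
    let ?K = "corner ((w \<box> x) \<box> y) z (a \<and> b \<and> c) d \<bullet>
       ((corner (w \<box> x) y (a \<and> b) c \<bullet> (corner w x a b \<star> \<one> ?Y)) \<star> \<one> ?Z)"
    let ?c = "corner w (x \<box> (y \<box> z)) a (b \<and> c \<and> d)"
    let ?l = "component (box_assoc w x (y \<box> z) \<odot> box_assoc (w \<box> x) y z) (a \<and> b \<and> c \<and> d) \<bullet> ?K"
    let ?r = "?c \<bullet> (\<one> ?W \<star> (corner x (y \<box> z) b (c \<and> d) \<bullet> (\<one> ?X \<star> corner y z c d))) \<bullet> assoc M ?W ?X (?Y \<star>\<^sub>o ?Z) \<bullet> assoc M (?W \<star>\<^sub>o ?X) ?Y ?Z"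
    have "?l = component (box_assoc w x (y \<box> z)) (a \<and> b \<and> c \<and> d) \<bullet>
        component (box_assoc (w \<box> x) y z) ((a \<and> b) \<and> c \<and> d) \<bullet> corner ((w \<box> x) \<box> y) z ((a \<and> b) \<and> c) d \<bullet>
        (corner (w \<box> x) y (a \<and> b) c \<star> \<one> ?Z) \<bullet> ((corner w x a b \<star> \<one> ?Y) \<star> \<one> ?Z)"
      using D by (simp add: interchange)
    also have "\<dots> = component (box_assoc w x (y \<box> z)) (a \<and> b \<and> c \<and> d) \<bullet>
        corner (w \<box> x) (y \<box> z) (a \<and> b) (c \<and> d) \<bullet> (\<one> (vtx (w \<box> x) (a \<and> b)) \<star> corner y z c d) \<bullet>
        assoc M (vtx (w \<box> x) (a \<and> b)) ?Y ?Z \<bullet> ((corner w x a b \<star> \<one> ?Y) \<star> \<one> ?Z)"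
      by (subst component_box_assoc_comp) simp_all
    also have "\<dots> = component (box_assoc w x (y \<box> z)) (a \<and> b \<and> c \<and> d) \<bullet>
        corner (w \<box> x) (y \<box> z) (a \<and> b) (c \<and> d) \<bullet> (corner w x a b \<star> \<one> (vtx (y \<box> z) (c \<and> d))) \<bullet>
        (\<one> (?W \<star>\<^sub>o ?X) \<star> corner y z c d) \<bullet> assoc M (?W \<star>\<^sub>o ?X) ?Y ?Z"
      using D by (simp add: assoc_nat interchange')
    also have "\<dots> = ?c \<bullet> (\<one> ?W \<star> corner x (y \<box> z) b (c \<and> d)) \<bullet>
        assoc M ?W ?X (vtx (y \<box> z) (c \<and> d)) \<bullet> (\<one> (?W \<star>\<^sub>o ?X) \<star> corner y z c d) \<bullet> assoc M (?W \<star>\<^sub>o ?X) ?Y ?Z"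
      by (subst component_box_assoc_comp) simp_all
    also have "\<dots> = ?r"
      by (simp add: assoc_nat_ident[THEN comp_reassoc] interchange')
    finally have L: "?l = ?r" .
    let ?R = "box_square C M (\<one>\<^sub>A w) (box_assoc x y z) \<odot> box_assoc w (x \<box> y) z
      \<odot> box_square C M (box_assoc w x y) (\<one>\<^sub>A z)"
    let ?B1 = "component (box_square C M (\<one>\<^sub>A w) (box_assoc x y z)) (a \<and> b \<and> c \<and> d)"
    let ?A3 = "component (box_assoc w (x \<box> y) z) (a \<and> b \<and> c \<and> d)"
    have "component ?R (a \<and> b \<and> c \<and> d) \<bullet> ?K = ?B1 \<bullet> ?A3 \<bullet>
        component (box_square C M (box_assoc w x y) (\<one>\<^sub>A z)) ((a \<and> b \<and> c) \<and> d) \<bullet> ?K"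
      using D by simp
    also have "\<dots> = ?B1 \<bullet> ?A3 \<bullet> corner (w \<box> (x \<box> y)) z (a \<and> b \<and> c) d \<bullet>
        (component (box_assoc w x y) (a \<and> b \<and> c) \<star> \<one> ?Z) \<bullet>
        ((corner (w \<box> x) y (a \<and> b) c \<bullet> (corner w x a b \<star> \<one> ?Y)) \<star> \<one> ?Z)"
      by (subst component_box_square_comp[OF Awxy Iz]) simp_all
    also have "\<dots> = ?B1 \<bullet> ?A3 \<bullet> corner (w \<box> (x \<box> y)) z (a \<and> b \<and> c) d \<bullet>
        (corner w (x \<box> y) a (b \<and> c) \<star> \<one> ?Z) \<bullet> ((\<one> ?W \<star> corner x y b c) \<star> \<one> ?Z) \<bullet> (assoc M ?W ?X ?Y \<star> \<one> ?Z)"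
      using D by (simp add: interchange box_assoc(2))
    also have "\<dots> = ?B1 \<bullet> corner w ((x \<box> y) \<box> z) a ((b \<and> c) \<and> d) \<bullet> (\<one> ?W \<star> corner (x \<box> y) z (b \<and> c) d) \<bullet>
        assoc M ?W (vtx (x \<box> y) (b \<and> c)) ?Z \<bullet> ((\<one> ?W \<star> corner x y b c) \<star> \<one> ?Z) \<bullet> (assoc M ?W ?X ?Y \<star> \<one> ?Z)"
      using component_box_assoc_comp[of w "x \<box> y" z
          "((\<one> ?W \<star> corner x y b c) \<star> \<one> ?Z) \<bullet> (assoc M ?W ?X ?Y \<star> \<one> ?Z)" a "b \<and> c" d] by simp
    also have "\<dots> = ?B1 \<bullet> corner w ((x \<box> y) \<box> z) a (b \<and> c \<and> d) \<bullet> (\<one> ?W \<star> corner (x \<box> y) z (b \<and> c) d) \<bullet>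
        (\<one> ?W \<star> (corner x y b c \<star> \<one> ?Z)) \<bullet> assoc M ?W (?X \<star>\<^sub>o ?Y) ?Z \<bullet> (assoc M ?W ?X ?Y \<star> \<one> ?Z)"
      by (simp add: assoc_nat[THEN comp_reassoc])
    also have "\<dots> = ?c \<bullet> (\<one> ?W \<star> component (box_assoc x y z) (b \<and> c \<and> d)) \<bullet> (\<one> ?W \<star> corner (x \<box> y) z (b \<and> c) d) \<bullet>
        (\<one> ?W \<star> (corner x y b c \<star> \<one> ?Z)) \<bullet> assoc M ?W (?X \<star>\<^sub>o ?Y) ?Z \<bullet> (assoc M ?W ?X ?Y \<star> \<one> ?Z)"
      by (subst component_box_square_comp[OF Iw Axyz]) simp_all
    also have "\<dots> = ?c \<bullet> (\<one> ?W \<star> (corner x (y \<box> z) b (c \<and> d) \<bullet> (\<one> ?X \<star> corner y z c d))) \<bullet>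
        (\<one> ?W \<star> assoc M ?X ?Y ?Z) \<bullet> assoc M ?W (?X \<star>\<^sub>o ?Y) ?Z \<bullet> (assoc M ?W ?X ?Y \<star> \<one> ?Z)"
      using D by (simp add: interchange' box_assoc(2))
    also have "\<dots> = ?c \<bullet> (\<one> ?W \<star> (corner x (y \<box> z) b (c \<and> d) \<bullet> (\<one> ?X \<star> corner y z c d))) \<bullet>
        assoc M ?W ?X (?Y \<star>\<^sub>o ?Z) \<bullet> assoc M (?W \<star>\<^sub>o ?X) ?Y ?Z"
      by (simp add: pentagon)
    finally show "component (box_assoc w x (y \<box> z) \<odot> box_assoc (w \<box> x) y z) (a \<and> b \<and> c \<and> d) \<bullet> ?K
      = component ?R (a \<and> b \<and> c \<and> d) \<bullet> ?K"
      unfolding L by simp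
  qed
qed

text \<open>As for the pentagon; the two sides reach the corner with indices \<open>b\<close>, \<open>c\<close>, \<open>a\<close>, so conjunctions have to be
  permuted along the way.\<close>

lemma box_hexagon:
  assumes x: "x \<in> Mor C" and y: "y \<in> Mor C" and z: "z \<in> Mor C"
  shows "box_assoc y z x \<odot> box_symm x (y \<box> z) \<odot> box_assoc x y z =
    box_square C M (\<one>\<^sub>A y) (box_symm x z) \<odot> box_assoc y x z
      \<odot> box_square C M (box_symm x y) (\<one>\<^sub>A z)"
proof -
  note [simp] = x y z
  have Iy: "\<one>\<^sub>A y \<in> hom (Arr C) y y" and Iz: "\<one>\<^sub>A z \<in> hom (Arr C) z z"
    by (simp_all add: Arr.Ident_in_hom)
  note A1 = box_assoc(1)[OF x y z] and A2 = box_assoc(1)[OF y x z] and A3 = box_assoc(1)[OF y z x]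
  note S = box_symm(1)[OF x box_simps(1)[OF y z]] and Sxy = box_symm(1)[OF x y] and Sxz = box_symm(1)[OF x z]
  note B1 = box_square(1)[OF Iy Sxz] and B3 = box_square(1)[OF Sxy Iz]
  note D = Arr_homD[OF A1] Arr_homD[OF A2] Arr_homD[OF A3] Arr_homD[OF S] Arr_homD[OF Sxy]
    Arr_homD[OF Sxz] Arr_homD[OF B1] Arr_homD[OF B3]
  show ?thesis
  proof (rule box3_hom_eqI[OF Arr.Comp_in_hom[OF Arr.Comp_in_hom[OF A1 S] A3]
        Arr.Comp_in_hom[OF Arr.Comp_in_hom[OF B3 A2] B1] x y z])
    fix a b c
    let ?X = "vtx x a" and ?Y = "vtx y b" and ?Z = "vtx z c"
    let ?K = "corner (x \<box> y) z (a \<and> b) c \<bullet> (corner x y a b \<star> \<one> ?Z)"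
    let ?c = "corner y (z \<box> x) b (c \<and> a)"
    have idx: "(a \<and> b \<and> c) = (b \<and> c \<and> a)" "(b \<and> a \<and> c) = (b \<and> c \<and> a)"
      "(a \<and> b) = (b \<and> a)" "(a \<and> c) = (c \<and> a)" by blast+
    have swap: "component (box_symm x y) (b \<and> a) \<bullet> corner x y a b = corner y x b a \<bullet> symm M ?X ?Y"
      "component (box_symm x z) (c \<and> a) \<bullet> corner x z a c = corner z x c a \<bullet> symm M ?X ?Z"
      using box_symm(2)[OF x y, of a b] box_symm(2)[OF x z, of a c]
      by (simp_all only: idx(3,4))
    let ?L = "box_assoc y z x \<odot> box_symm x (y \<box> z) \<odot> box_assoc x y z"
    let ?l = "component ?L (a \<and> b \<and> c) \<bullet> ?K"
    let ?r = "?c \<bullet> (\<one> ?Y \<star> corner z x c a) \<bullet> assoc M ?Y ?Z ?X \<bullet> symm M ?X (?Y \<star>\<^sub>o ?Z) \<bullet> assoc M ?X ?Y ?Z"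
    have "?l = component (box_assoc y z x) (a \<and> b \<and> c) \<bullet> component (box_symm x (y \<box> z)) (a \<and> b \<and> c) \<bullet>
        corner x (y \<box> z) a (b \<and> c) \<bullet> (\<one> ?X \<star> corner y z b c) \<bullet> assoc M ?X ?Y ?Z"
      using D by (simp add: box_assoc(2))
    also have "\<dots> = component (box_assoc y z x) (b \<and> c \<and> a) \<bullet> corner (y \<box> z) x (b \<and> c) a \<bullet>
        symm M ?X (vtx (y \<box> z) (b \<and> c)) \<bullet> (\<one> ?X \<star> corner y z b c) \<bullet> assoc M ?X ?Y ?Z"
      by (subst component_box_symm_comp) (simp_all add: idx)
    also have "\<dots> = component (box_assoc y z x) (b \<and> c \<and> a) \<bullet> corner (y \<box> z) x (b \<and> c) a \<bullet>
        (corner y z b c \<star> \<one> ?X) \<bullet> symm M ?X (?Y \<star>\<^sub>o ?Z) \<bullet> assoc M ?X ?Y ?Z"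
      by (simp add: symm_nat[THEN comp_reassoc])
    also have "\<dots> = ?r"
      by (subst component_box_assoc_comp) simp_all
    finally have L: "?l = ?r" .
    let ?R = "box_square C M (\<one>\<^sub>A y) (box_symm x z) \<odot> box_assoc y x z
      \<odot> box_square C M (box_symm x y) (\<one>\<^sub>A z)"
    let ?B1 = "component (box_square C M (\<one>\<^sub>A y) (box_symm x z)) (b \<and> a \<and> c)"
    let ?A2 = "component (box_assoc y x z) (b \<and> a \<and> c)"
    have "component ?R (a \<and> b \<and> c) \<bullet> ?K = ?B1 \<bullet> ?A2 \<bullet>
        component (box_square C M (box_symm x y) (\<one>\<^sub>A z)) ((a \<and> b) \<and> c) \<bullet> ?K"
      using D by (simp add: idx(1,2))
    also have "\<dots> = ?B1 \<bullet> ?A2 \<bullet> corner (y \<box> x) z (a \<and> b) c \<bullet>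
        (component (box_symm x y) (a \<and> b) \<star> \<one> ?Z) \<bullet> (corner x y a b \<star> \<one> ?Z)"
      by (subst component_box_square_comp[OF Sxy Iz]) simp_all
    also have "\<dots> = ?B1 \<bullet> ?A2 \<bullet> corner (y \<box> x) z (b \<and> a) c \<bullet> (corner y x b a \<star> \<one> ?Z) \<bullet> (symm M ?X ?Y \<star> \<one> ?Z)"
      using D by (simp add: interchange swap(1) idx(3))
    also have "\<dots> = ?B1 \<bullet> corner y (x \<box> z) b (a \<and> c) \<bullet> (\<one> ?Y \<star> corner x z a c) \<bullet> assoc M ?Y ?X ?Z \<bullet> (symm M ?X ?Y \<star> \<one> ?Z)"
      by (subst component_box_assoc_comp) simp_all
    also have "\<dots> = corner y (z \<box> x) b (a \<and> c) \<bullet> (\<one> ?Y \<star> component (box_symm x z) (a \<and> c)) \<bullet>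
        (\<one> ?Y \<star> corner x z a c) \<bullet> assoc M ?Y ?X ?Z \<bullet> (symm M ?X ?Y \<star> \<one> ?Z)"
      by (subst component_box_square_comp[OF Iy Sxz]) simp_all
    also have "\<dots> = corner y (z \<box> x) b (a \<and> c) \<bullet> (\<one> ?Y \<star> corner z x c a) \<bullet>
        (\<one> ?Y \<star> symm M ?X ?Z) \<bullet> assoc M ?Y ?X ?Z \<bullet> (symm M ?X ?Y \<star> \<one> ?Z)"
      using D by (simp add: interchange' swap(2) idx(4))
    also have "\<dots> = ?c \<bullet> (\<one> ?Y \<star> corner z x c a) \<bullet> assoc M ?Y ?Z ?X \<bullet> symm M ?X (?Y \<star>\<^sub>o ?Z) \<bullet> assoc M ?X ?Y ?Z"
      by (simp add: hexagon idx(4))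
    finally show "component ?L (a \<and> b \<and> c) \<bullet> ?K = component ?R (a \<and> b \<and> c) \<bullet> ?K"
      unfolding L by simp
  qed
qed

section \<open>The internal hom of the pushout product\<close>

text \<open>The map into the pullback classifies the square from \<open>Hom(X\<^sub>1,Y\<^sub>0) \<otimes> f\<close> to \<open>g\<close> whose
  components are the evaluation at \<open>X\<^sub>1\<close>, preceded by \<open>f\<close> at the vertex \<open>0\<close> and followed by \<open>g\<close> at \<open>1\<close>.\<close>

lemma hom_box:
  assumes f: "f \<in> Mor C" and g: "g \<in> Mor C"
  shows "hom_box C M f g \<in> hom C (ihom M (Cod C f) (Dom C g)) (square_obj f g)"
    and "eval0 f g \<bullet> (hom_box C M f g \<star> \<one> (Dom C f))
      = ev M (Cod C f) (Dom C g) \<bullet> (\<one> (ihom M (Cod C f) (Dom C g)) \<star> f)"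
    and "eval1 f g \<bullet> (hom_box C M f g \<star> \<one> (Cod C f)) = g \<bullet> ev M (Cod C f) (Dom C g)"
proof -
  note [simp] = f g hom_pullback_simps(1-3)
  let ?H = "ihom M (Cod C f) (Dom C g)"
  let ?u = "ihom_mor C M f (\<one> (Dom C g))" and ?v = "ihom_mor C M (\<one> (Cod C f)) g"
  let ?p = "fst (snd (hom_pullback C M f g))" and ?q = "hom_tensor C M f g"
  have u: "?u \<in> Mor C" "Dom C ?u = ?H" "Cod C ?u = ihom M (Dom C f) (Dom C g)"
    "uncurry (Dom C f) (Dom C g) ?u = ev M (Cod C f) (Dom C g) \<bullet> (\<one> ?H \<star> f)"
    using ihom_mor[of f "\<one> (Dom C g)"] by simp_all
  have v: "?v \<in> Mor C" "Dom C ?v = ?H" "Cod C ?v = ihom M (Cod C f) (Cod C g)"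
    "uncurry (Cod C f) (Cod C g) ?v = g \<bullet> ev M (Cod C f) (Dom C g)"
    using ihom_mor[of "\<one> (Cod C f)" g] by simp_all
  have "ihom_mor C M (\<one> (Dom C f)) g \<bullet> ?u = ihom_mor C M f (\<one> (Cod C g)) \<bullet> ?v"
    using u v by (subst compatible_iff[of f g ?u ?H ?v]) simp_all
  then have "\<exists>!h. h \<in> hom C ?H (square_obj f g) \<and> ?p \<bullet> h = ?u \<and> ?q \<bullet> h = ?v"
    using u v by (intro pullback_universal[OF hom_pullback]) (simp_all add: ihom_mor)
  from theI'[OF this] have h: "hom_box C M f g \<in> hom C ?H (square_obj f g)"
    "?p \<bullet> hom_box C M f g = ?u" "?q \<bullet> hom_box C M f g = ?v"
    using u(2) by (simp_all add: hom_box_def hom_tensor_def square_obj_def split: prod.splits)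
  show "hom_box C M f g \<in> hom C ?H (square_obj f g)" by (rule h)
  have "eval0 f g \<bullet> (hom_box C M f g \<star> \<one> (Dom C f)) = uncurry (Dom C f) (Dom C g) (?p \<bullet> hom_box C M f g)"
    unfolding eval0_def using h(1) by (subst uncurry_comp) (auto simp: hom_def)
  then show "eval0 f g \<bullet> (hom_box C M f g \<star> \<one> (Dom C f)) = ev M (Cod C f) (Dom C g) \<bullet> (\<one> ?H \<star> f)"
    unfolding h(2) u(4) .
  have "eval1 f g \<bullet> (hom_box C M f g \<star> \<one> (Cod C f)) = uncurry (Cod C f) (Cod C g) (?q \<bullet> hom_box C M f g)"
    unfolding eval1_def using h(1) by (subst uncurry_comp) (auto simp: hom_def)
  then show "eval1 f g \<bullet> (hom_box C M f g \<star> \<one> (Cod C f)) = g \<bullet> ev M (Cod C f) (Dom C g)"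
    unfolding h(3) v(4) .
qed

lemma hom_box_simps [simp]:
  assumes "f \<in> Mor C" "g \<in> Mor C"
  shows "hom_box C M f g \<in> Mor C" "Dom C (hom_box C M f g) = ihom M (Cod C f) (Dom C g)"
    "Cod C (hom_box C M f g) = square_obj f g"
  using hom_box(1)[OF assms] by (simp_all add: hom_def)

text \<open>The evaluation on corners: the corner \<open>(0,1)\<close> is the evaluation of \<open>Hom(X\<^sub>1,Y\<^sub>0)\<close> at \<open>X\<^sub>1\<close>, the corners
  \<open>(1,0)\<close> and \<open>(1,1)\<close> form the universal square on the pullback.\<close>

definition box_eval :: "'m \<Rightarrow> 'm \<Rightarrow> bool \<Rightarrow> bool \<Rightarrow> 'm" where
  "box_eval f g a b = (if a then if b then eval1 f g else eval0 f g
     else ev M (Cod C f) (Dom C g) \<bullet> (\<one> (ihom M (Cod C f) (Dom C g)) \<star> (if b then \<one> (Cod C f) else f)))"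

lemma bimorphism_box_eval:
  assumes f: "f \<in> Mor C" and g: "g \<in> Mor C"
  shows "bimorphism (hom_box C M f g) f g (box_eval f g)"
  unfolding bimorphism_def
proof (intro conjI allI)
  fix a b
  show "box_eval f g a b \<in> hom C (vtx (hom_box C M f g) a \<star>\<^sub>o vtx f b) (vtx g (a \<and> b))"
    using f g by (cases a; cases b) (simp_all add: box_eval_def hom_def)
  show "box_eval f g True b \<bullet> (hom_box C M f g \<star> \<one> (vtx f b)) = edg g b \<bullet> box_eval f g False b"
    using f g by (cases b) (simp_all add: box_eval_def hom_box(2,3))
  show "box_eval f g a True \<bullet> (\<one> (vtx (hom_box C M f g) a) \<star> f) = edg g a \<bullet> box_eval f g a False"
    using f g by (cases a) (simp_all add: box_eval_def eval_square)
qed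

definition box_ev :: "'m \<Rightarrow> 'm \<Rightarrow> 'm square" where
  "box_ev f g = (THE s. s \<in> hom (Arr C) (hom_box C M f g \<box> f) g \<and>
     (\<forall>a b. component s (a \<and> b) \<bullet> corner (hom_box C M f g) f a b = box_eval f g a b))"

lemma box_ev:
  assumes f: "f \<in> Mor C" and g: "g \<in> Mor C"
  shows "box_ev f g \<in> hom (Arr C) (hom_box C M f g \<box> f) g"
    and "component (box_ev f g) (a \<and> b) \<bullet> corner (hom_box C M f g) f a b = box_eval f g a b"
  using theI'[OF box_lift[OF bimorphism_box_eval[OF f g]], folded box_ev_def] f g by auto

text \<open>A square \<open>s\<close> out of \<open>k \<box> f\<close> is a bimorphism \<open>\<sigma>\<close>. Its value at \<open>(0,1)\<close> is a curried map to
  \<open>Hom(X\<^sub>1,Y\<^sub>0)\<close>, its values at \<open>(1,0)\<close> and \<open>(1,1)\<close> form a square and thus a map into the pullback, and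
  naturality in the first variable makes the two maps a square to \<open>hom_box\<close>.\<close>

lemma box_closed:
  assumes k: "k \<in> Mor C" and f: "f \<in> Mor C" and g: "g \<in> Mor C"
    and s: "s \<in> hom (Arr C) (k \<box> f) g"
  shows "\<exists>!t. t \<in> hom (Arr C) k (hom_box C M f g) \<and>
    box_ev f g \<odot> box_square C M t (\<one>\<^sub>A f) = s"
proof -
  note [simp] = k f g
  let ?h = "hom_box C M f g" and ?H = "ihom M (Cod C f) (Dom C g)"
  note sD = Arr_homD[OF s]
  define \<sigma> where "\<sigma> a b = component s (a \<and> b) \<bullet> corner k f a b" for a b
  have bi: "bimorphism k f g \<sigma>"
    unfolding \<sigma>_def by (rule bimorphism_square[OF bimorphism_corner s]) simp_all
  note \<sigma> = bimorphismD[OF bi k f g]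
  have If: "\<one>\<^sub>A f \<in> hom (Arr C) f f" by (simp add: Arr.Ident_in_hom)
  have ev_iff: "box_ev f g \<odot> box_square C M t (\<one>\<^sub>A f) = s \<longleftrightarrow>
      uncurry (Cod C f) (Dom C g) (component t False) = \<sigma> False True \<and>
      eval0 f g \<bullet> (component t True \<star> \<one> (Dom C f)) = \<sigma> True False \<and>
      eval1 f g \<bullet> (component t True \<star> \<one> (Cod C f)) = \<sigma> True True"
    if t: "t \<in> hom (Arr C) k ?h" for t
  proof -
    let ?r = "box_ev f g \<odot> box_square C M t (\<one>\<^sub>A f)"
    note ts = box_square(1)[OF t If] and e = box_ev(1)[OF f g]
    note r = Arr.Comp_in_hom[OF ts e]
    note D = Arr_homD[OF t] Arr_homD[OF ts] Arr_homD[OF e]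
    have rc: "component ?r (a \<and> b) \<bullet> corner k f a b = box_eval f g a b \<bullet> (component t a \<star> \<one> (vtx f b))" for a b
    proof -
      have "component ?r (a \<and> b) \<bullet> corner k f a b
         = (component (box_ev f g) (a \<and> b) \<bullet> corner ?h f a b) \<bullet> (component t a \<star> \<one> (vtx f b))"
        using D by (simp add: box_square(2)[OF t If])
      then show ?thesis by (simp only: box_ev(2)[OF f g])
    qed
    have "?r = s \<longleftrightarrow> (\<forall>a b. box_eval f g a b \<bullet> (component t a \<star> \<one> (vtx f b)) = \<sigma> a b)"
    proof
      assume "?r = s"
      then show "\<forall>a b. box_eval f g a b \<bullet> (component t a \<star> \<one> (vtx f b)) = \<sigma> a b"
        using rc by (simp add: \<sigma>_def)
    next
      assume "\<forall>a b. box_eval f g a b \<bullet> (component t a \<star> \<one> (vtx f b)) = \<sigma> a b"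
      then show "?r = s"
        by (intro box_hom_eqI[OF r s k f]) (simp only: rc \<sigma>_def)
    qed
    also have "\<dots> \<longleftrightarrow> uncurry (Cod C f) (Dom C g) (component t False) = \<sigma> False True \<and>
      eval0 f g \<bullet> (component t True \<star> \<one> (Dom C f)) = \<sigma> True False \<and>
      eval1 f g \<bullet> (component t True \<star> \<one> (Cod C f)) = \<sigma> True True"
    proof -
      \<comment> \<open>The condition at \<open>(0,0)\<close> is the one at \<open>(0,1)\<close> restricted along \<open>f\<close>, which leaves three.\<close>
      have "box_eval f g False False \<bullet> (component t False \<star> \<one> (Dom C f))
        = uncurry (Cod C f) (Dom C g) (component t False) \<bullet> (\<one> (Dom C k) \<star> f)"
        using D by (simp add: box_eval_def uncurry_def interchange)
      moreover have "\<sigma> False False = \<sigma> False True \<bullet> (\<one> (Dom C k) \<star> f)"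
        using \<sigma>(5)[of False True] \<sigma>(1-3) by simp
      moreover have "box_eval f g False True \<bullet> (component t False \<star> \<one> (Cod C f))
        = uncurry (Cod C f) (Dom C g) (component t False)"
        using D by (simp add: box_eval_def uncurry_def)
      ultimately show ?thesis
        by (auto simp: all_bool_eq box_eval_def)
    qed
    finally show ?thesis .
  qed
  obtain t0 where t0: "t0 \<in> Mor C" "Dom C t0 = Dom C k" "Cod C t0 = ?H"
    "uncurry (Cod C f) (Dom C g) t0 = \<sigma> False True"
    using curry_exists[of "Dom C k" "Cod C f" "\<sigma> False True" "Dom C g"] \<sigma>(1-3)[of False True] by auto
  have "g \<bullet> \<sigma> True False = \<sigma> True True \<bullet> (\<one> (Cod C k) \<star> f)"
    using \<sigma>(5)[of True True] by simp
  then have ex1: "\<exists>!b. b \<in> hom C (Cod C k) (square_obj f g) \<and>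
      eval0 f g \<bullet> (b \<star> \<one> (Dom C f)) = \<sigma> True False \<and> eval1 f g \<bullet> (b \<star> \<one> (Cod C f)) = \<sigma> True True"
    using \<sigma>(1-3) by (intro ex1_into_square_obj) simp_all
  then obtain t1 where t1: "t1 \<in> hom C (Cod C k) (square_obj f g)"
    "eval0 f g \<bullet> (t1 \<star> \<one> (Dom C f)) = \<sigma> True False" "eval1 f g \<bullet> (t1 \<star> \<one> (Cod C f)) = \<sigma> True True"
    by blast
  have t1m: "t1 \<in> Mor C" "Dom C t1 = Cod C k" "Cod C t1 = square_obj f g"
    using t1(1) by (simp_all add: hom_def)
  \<comment> \<open>Both composites classify the square with sides \<open>\<sigma> False False\<close> and \<open>g \<bullet> \<sigma> False True\<close>.\<close>
  have "?h \<bullet> t0 = t1 \<bullet> k"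
  proof (rule into_square_obj_eqI[OF f g])
    show "?h \<bullet> t0 \<in> hom C (Dom C k) (square_obj f g)" "t1 \<bullet> k \<in> hom C (Dom C k) (square_obj f g)"
      using t0 t1m by (simp_all add: hom_def)
    let ?l = "eval0 f g \<bullet> ((?h \<bullet> t0) \<star> \<one> (Dom C f))"
    let ?r = "eval0 f g \<bullet> ((t1 \<bullet> k) \<star> \<one> (Dom C f))"
    have "?l = (eval0 f g \<bullet> (?h \<star> \<one> (Dom C f))) \<bullet> (t0 \<star> \<one> (Dom C f))"
      using t0 by (simp add: interchange)
    also have "\<dots> = uncurry (Cod C f) (Dom C g) t0 \<bullet> (\<one> (Dom C k) \<star> f)"
      unfolding hom_box(2)[OF f g] using t0(1-3) by (simp add: uncurry_def interchange)
    also have "\<dots> = \<sigma> False False"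
      unfolding t0(4) using \<sigma>(5)[of False True] \<sigma>(1-3) by simp
    also have "\<dots> = (eval0 f g \<bullet> (t1 \<star> \<one> (Dom C f))) \<bullet> (k \<star> \<one> (Dom C f))"
      unfolding t1(2) using \<sigma>(4)[of True False] \<sigma>(1-3) by simp
    also have "\<dots> = ?r"
      using t1m by (simp add: interchange)
    finally show "?l = ?r" .
    let ?l = "eval1 f g \<bullet> ((?h \<bullet> t0) \<star> \<one> (Cod C f))"
    let ?r = "eval1 f g \<bullet> ((t1 \<bullet> k) \<star> \<one> (Cod C f))"
    have "?l = (eval1 f g \<bullet> (?h \<star> \<one> (Cod C f))) \<bullet> (t0 \<star> \<one> (Cod C f))"
      using t0 by (simp add: interchange)
    also have "\<dots> = g \<bullet> uncurry (Cod C f) (Dom C g) t0"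
      unfolding hom_box(3)[OF f g] using t0(1-3) by (simp add: uncurry_def)
    also have "\<dots> = (eval1 f g \<bullet> (t1 \<star> \<one> (Cod C f))) \<bullet> (k \<star> \<one> (Cod C f))"
      unfolding t1(3) t0(4) using \<sigma>(4)[of True True] by simp
    also have "\<dots> = ?r"
      using t1m by (simp add: interchange)
    finally show "?l = ?r" .
  qed
  then have T: "Square k ?h t0 t1 \<in> hom (Arr C) k ?h"
    using t0 t1m by (intro Arr_homI) (simp_all add: vertex_def)
  show ?thesis
  proof (rule ex1I)
    show "Square k ?h t0 t1 \<in> hom (Arr C) k ?h \<and>
        box_ev f g \<odot> box_square C M (Square k ?h t0 t1) (\<one>\<^sub>A f) = s"
      using T ev_iff[OF T] t0(4) t1(2,3) by simp
  next
    fix t assume *: "t \<in> hom (Arr C) k ?h \<and> box_ev f g \<odot> box_square C M t (\<one>\<^sub>A f) = s"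
    then have t: "t \<in> hom (Arr C) k ?h" by simp
    note tD = Arr_homD[OF t]
    have e: "uncurry (Cod C f) (Dom C g) (component t False) = \<sigma> False True"
      "eval0 f g \<bullet> (component t True \<star> \<one> (Dom C f)) = \<sigma> True False"
      "eval1 f g \<bullet> (component t True \<star> \<one> (Cod C f)) = \<sigma> True True"
      using * ev_iff[OF t] by blast+
    have "component t False = t0"
      by (rule uncurry_inject[of "Cod C f" "Dom C g"]) (use e(1) t0 tD in simp_all)
    moreover have "component t True \<in> hom C (Cod C k) (square_obj f g)"
      using tD by (simp add: hom_def)
    then have "component t True = t1" using ex1 t1 e(2,3) by blast
    ultimately show "t = Square k ?h t0 t1"
      using tD by (cases t) (simp add: component_def)
  qed
qed

section \<open>The two structures\<close>

definition arrow_box :: "('m, 'm square) csm_structure" where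
  "arrow_box =
     \<lparr> tensor_obj = box C M,
       tensor_mor = box_square C M,
       unit_obj = \<J>,
       assoc = box_assoc,
       lunit = box_lunit,
       runit = box_runit,
       symm = box_symm,
       ihom = hom_box C M,
       ev = box_ev \<rparr>"

lemma arrow_box_simps [simp]:
  "tensor_obj arrow_box = box C M" "tensor_mor arrow_box = box_square C M" "unit_obj arrow_box = \<J>"
  "assoc arrow_box = box_assoc" "lunit arrow_box = box_lunit" "runit arrow_box = box_runit"
  "symm arrow_box = box_symm" "ihom arrow_box = hom_box C M" "ev arrow_box = box_ev"
  by (simp_all add: arrow_box_def)

lemma closed_symmetric_monoidal_arrow_box: "closed_symmetric_monoidal (Arr C) arrow_box"
proof (unfold_locales, goal_cases)
  case 1
  have "s \<in> Mor (Arr C) \<Longrightarrow> s \<in> hom (Arr C) (sq_dom s) (sq_cod s)" for s by (simp add: hom_def)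
  then show ?case
    by (intro bifunctorI)
      (auto intro!: box_square(1) box_square_comp simp: box_square_ident)
qed (simp_all add: box_assoc(1) box_assoc_iso box_assoc_natural box_lunit(1) box_lunit_iso box_lunit_natural
   box_runit(1) box_runit_iso box_runit_natural box_pentagon box_triangle box_symm(1) box_symm_natural
   box_symm_symm box_hexagon box_ev(1) box_closed)

end

theorem theorem1p2:
  fixes C :: "('o, 'm) category" and M :: "('o, 'm) csm_structure"
  assumes "infinite (UNIV :: 'u set)"
    and "bicomplete TYPE('u) C"
    and "closed_symmetric_monoidal C M"
  shows
    "(\<exists>T. closed_symmetric_monoidal (Arr C) T \<and>
        (\<forall>f \<in> Mor C. \<forall>g \<in> Mor C. tensor_obj T f g = f \<otimes>\<^bsub>M\<^esub> g) \<and>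
        (\<forall>s \<in> Mor (Arr C). \<forall>t \<in> Mor (Arr C). tensor_mor T s t = tensor_square M s t) \<and>
        unit_obj T = L0 C (unit_obj M) \<and>
        (\<forall>f \<in> Mor C. \<forall>g \<in> Mor C. ihom T f g = hom_tensor C M f g)) \<and>
     (\<exists>B. closed_symmetric_monoidal (Arr C) B \<and>
        (\<forall>f \<in> Mor C. \<forall>g \<in> Mor C. tensor_obj B f g = box C M f g) \<and>
        (\<forall>s \<in> Mor (Arr C). \<forall>t \<in> Mor (Arr C). tensor_mor B s t = box_square C M s t) \<and>
        unit_obj B = L1 C (unit_obj M) \<and>
        (\<forall>f \<in> Mor C. \<forall>g \<in> Mor C. ihom B f g = hom_box C M f g))"
proof -
  interpret closed_symmetric_monoidal C M by fact
  have "small_complete TYPE('u) C" "small_cocomplete TYPE('u) C"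
    using assms(2) by (simp_all add: bicomplete_def)
  then interpret csm_with_squares C M
    using ex_initial_if_small_cocomplete ex_pushout_if_small_cocomplete[OF assms(1)]
      ex_pullback_if_small_complete[OF assms(1)]
    by unfold_locales blast+
  show ?thesis
    using closed_symmetric_monoidal_arrow_tensor closed_symmetric_monoidal_arrow_box
    by (intro conjI exI[of _ arrow_tensor] exI[of _ arrow_box]) (simp_all add: L0_def)
qed

end
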